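(* There is an absolute constant $c>0$ (independent of $\sigma,\beta,\kappa$ below) such that the following holds. Fix $\sigma\in(1/2,1)$, $\beta\in(0,1)$ and $0<\kappa<\min(\sigma-1/2,\,1-\beta)$. Then there exists a function $\upsilon:(1/2,1)\to\mathbb{R}_+$ which satisfies $$\upsilon(\sigma)>c\,\min\left\{1,\ (e^2-e)\,\frac{|\log(2\sigma-1)|}{|\log(2\sigma-1)|+1}\right\}$$ such that for any $\theta\in\mathbb{R}$ and all sufficiently large $T$ we have $$\max_{t\in[T^{\beta},T]}\mathrm{Re}\left(e^{-i\theta}\log\zeta(\sigma+it)\right)\ \ge\ \upsilon(\sigma)\,\frac{\kappa^{1-\sigma}}{\sqrt{|\log(2\sigma-1)|}}\,\frac{(\log T)^{1-\sigma}}{(\log_2 T)^{\sigma}}.$$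
   Context: $\zeta$ is the Riemann zeta function and $\log_2 T=\log\log T$. For $t>0$, $\log\zeta(\sigma+it)$ denotes the branch obtained by continuous variation along the horizontal ray $\{\alpha+it:\alpha\ge\sigma\}$ from $\alpha=+\infty$, where $\log\zeta\to 0$; it is defined when $\zeta$ has no zero on this ray. An inequality "$\max_{t\in[T^\beta,T]}\ldots\ge X$" means that there is a $t\in[T^\beta,T]$, at which $\log\zeta(\sigma+it)$ is defined, where the quantity is at least $X$. *)

theory Defs
  imports "HOL-Complex_Analysis.Complex_Analysis" "HOL-Library.FuncSet"
begin

(* The conditions determine f on -{1} by the identity theorem, so the choice operator
   only leaves the value at the pole s = 1 unspecified. *)
definition zeta :: "complex \<Rightarrow> complex" where
  "zeta = (SOME f. f holomorphic_on (- {1}) \<and>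
     (\<forall>s. Re s > 1 \<longrightarrow> f s = (\<Sum>n. of_nat (Suc n) powr (- s))))"

definition log_zeta_defined :: "complex \<Rightarrow> bool" where
  "log_zeta_defined s \<longleftrightarrow> Im s > 0 \<and> (\<forall>\<alpha>\<ge>Re s. zeta (Complex \<alpha> (Im s)) \<noteq> 0)"

(* Two functions L satisfying these conditions differ by a constant multiple of 2 pi i,
   which the limit at infinity forces to be 0. *)
definition log_zeta_branch :: "complex \<Rightarrow> (real \<Rightarrow> complex) \<Rightarrow> bool" where
  "log_zeta_branch s L \<longleftrightarrow>
     continuous_on {Re s..} L \<and>
     (\<forall>\<alpha>\<ge>Re s. exp (L \<alpha>) = zeta (Complex \<alpha> (Im s))) \<and>
     (L \<longlongrightarrow> 0) at_top"

(* Meaningful only when log_zeta_defined s holds. *)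
definition log_zeta :: "complex \<Rightarrow> complex" where
  "log_zeta s = (THE w. \<exists>L. log_zeta_branch s L \<and> w = L (Re s))"

end

theory Submission
  imports Defs "HOL-Number_Theory.Number_Theory" "HOL-Probability.Probability" "HOL-Real_Asymp.Real_Asymp"
begin

text \<open>The two upper bounds on \<kappa> are budgets of exponents. The pigeonhole step costs a
  power of T proportional to \<kappa>. The condition \<kappa> < \<sigma> - 1/2 keeps this cost below
  the saving of the density estimate, and \<kappa> < 1 - \<beta> keeps the points below the required
  range negligible. Any density estimate whose saving is linear in \<sigma> - 1/2 with an absolute
  slope is therefore enough, and logarithms may be lost freely in the mean values.

  This is why elementary inputs suffice. The alternating series, transformed \<open>k\<close> times,
  continues zeta to \<open>Re s > 1 - k\<close>; cut at length about T^(1+\<delta>), with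
  \<open>k\<close> large in terms of \<delta>, it also takes the place of an approximate functional
  equation in the second moment. The mean value theorem is proved with a logarithmic loss.

  Non-negativity of the kernel means that a one-sided bound on the real part is all that has to be
  contradicted. Its Gaussian decay means that zeros have to be excluded only at distance O(log T)
  from t. The same decay leaves primes beyond a constant multiple of x, where the phases are
  uncontrolled, with a contribution that a large constant makes small.\<close>

text \<open>
  Following Montgomery, let \<open>x = C \<kappa> log T log log T\<close> for a small absolute constant \<open>C\<close>. Dirichlet's
  pigeonhole argument on an arithmetic progression produces more than \<open>T powr (1 - \<kappa>)\<close> points
  \<open>t \<le> T / 2\<close>, spaced by a multiple of \<open>log T\<close>, at which \<open>p powr (\<i> t)\<close> is close to \<open>1\<close> for all
  primes \<open>p\<close> up to a constant multiple of \<open>x\<close>. A zero-density estimate saving a power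
  \<open>T powr (\<delta> (\<sigma> - 1/2))\<close> with an absolute \<open>\<delta>\<close> shows that near at least one of them zeta has no zeros
  to the right of a line left of \<open>\<sigma>\<close>. There \<open>log zeta (\<sigma> + \<i> (t + u))\<close> is integrated in \<open>u\<close> against
  the non-negative kernel \<open>exp (- u\<^sup>2 / 2) (1 + cos (\<theta> + u log x))\<close>; shifting the contour to \<open>Re s = 2\<close>
  shows that this isolates \<open>exp (\<i> \<theta>)\<close> times a smoothed sum of \<open>p powr (- \<sigma> - \<i> t)\<close> over
  primes \<open>p\<close> of size about \<open>x\<close>. By Chebyshev this sum is at least a constant times
  \<open>x powr (1 - \<sigma>) / log x\<close>, and hence so is the largest value of the integrand.

  The density estimate bounds \<open>f = zeta M - 1\<close>, with \<open>M\<close> the partial sum of length \<open>T\<close> of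
  \<open>1 / zeta\<close>: \<open>f\<close> is \<open>O (1 / T)\<close> on \<open>Re s = 2\<close> and \<open>O (T powr \<epsilon>)\<close> on average on a line slightly to the
  right of \<open>1/2\<close>, and Cauchy's formula interpolates between the two lines.

  As \<open>sqrt L \<le> (L + 1) / 2\<close>, the factor \<open>\<upsilon> (\<sigma>) / sqrt L\<close> with \<open>L = \<bar>log (2 \<sigma> - 1)\<bar>\<close> is bounded
  by an absolute constant, so it is absorbed into \<open>c\<close>.
\<close>

subsection \<open>Euler transform of the alternating series\<close>

text \<open>Weierstrass M-test on closed discs. The majorant may depend on a bound \<open>R\<close>
  for the modulus as well as on the abscissa, because some of the series below have terms growing
  polynomially in \<open>norm s\<close>.\<close>

lemma holomorphic_on_suminf_halfplane:
  fixes f :: "nat \<Rightarrow> complex \<Rightarrow> complex"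
  assumes hol: "\<And>n. f n holomorphic_on {s. Re s > a}"
    and bd: "\<And>b R. b > a \<Longrightarrow> R > 0 \<Longrightarrow>
      \<exists>M. summable M \<and> (\<forall>n s. Re s \<ge> b \<longrightarrow> norm s \<le> R \<longrightarrow> norm (f n s) \<le> M n)"
  shows "(\<lambda>s. \<Sum>n. f n s) holomorphic_on {s. Re s > a}"
proof (rule holomorphic_uniform_sequence[OF open_halfspace_Re_gt])
  show "(\<lambda>s. \<Sum>n<N. f n s) holomorphic_on {s. Re s > a}" for N
    using hol by (intro holomorphic_intros)
  fix x assume x: "x \<in> {s. Re s > a}"
  define d where "d = (Re x - a) / 2"
  have d: "d > 0" "2 * d = Re x - a" using x by (auto simp: d_def)
  have y: "Re y \<ge> a + d" "norm y \<le> norm x + d" if "y \<in> cball x d" for y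
  proof -
    have "\<bar>Re (x - y)\<bar> \<le> d" using abs_Re_le_cmod[of "x - y"] that by (simp add: dist_norm)
    then have "Re y \<ge> Re x - d" by (simp add: abs_le_iff)
    then show "Re y \<ge> a + d" using d by linarith
    show "norm y \<le> norm x + d"
      using that norm_triangle_ineq2[of y x] by (auto simp: dist_norm norm_minus_commute)
  qed
  have "a + d > a" "norm x + d > 0" using d by (auto intro: add_nonneg_pos)
  from bd[OF this] obtain M where M: "summable M"
    "\<And>n s. Re s \<ge> a + d \<Longrightarrow> norm s \<le> norm x + d \<Longrightarrow> norm (f n s) \<le> M n" by blast
  have "uniform_limit (cball x d) (\<lambda>N s. \<Sum>n<N. f n s) (\<lambda>s. \<Sum>n. f n s) sequentially"
    by (rule Weierstrass_m_test) (use M y in auto)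
  moreover have "cball x d \<subseteq> {s. Re s > a}" using y(1) d by fastforce
  ultimately show "\<exists>d>0. cball x d \<subseteq> {s. Re s > a} \<and>
      uniform_limit (cball x d) (\<lambda>N s. \<Sum>n<N. f n s) (\<lambda>s. \<Sum>n. f n s) sequentially"
    using d by blast
qed

lemma norm_of_real_powr: "x > 0 \<Longrightarrow> norm (complex_of_real x powr s) = x powr Re s"
  by (simp add: norm_powr_real_powr)

lemma of_real_powr_has_vector_derivative:
  assumes "x > 0"
  shows "((\<lambda>x. complex_of_real x powr s) has_vector_derivative s * complex_of_real x powr (s - 1)) (at x)"
proof -
  have "((\<lambda>z. z powr s) has_field_derivative s * complex_of_real x powr (s - 1)) (at (complex_of_real x))"
    by (rule has_field_derivative_powr) (use assms in \<open>auto simp: complex_nonpos_Reals_iff\<close>)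
  from has_vector_derivative_real_field[OF this] show ?thesis .
qed

text \<open>Up to the sign \<open>(-1) ^ k\<close> this is the \<open>k\<close>-th forward
  difference of \<open>x powr (- s)\<close>. Each difference gains a power of \<open>x\<close>,
  which moves convergence one unit to the left.\<close>

fun dpow :: "nat \<Rightarrow> complex \<Rightarrow> real \<Rightarrow> complex" where
  "dpow 0 s x = complex_of_real x powr (- s)"
| "dpow (Suc k) s x = dpow k s x - dpow k s (x + 1)"

lemma dpow_has_vector_derivative:
  "x > 0 \<Longrightarrow> (dpow k s has_vector_derivative - s * dpow k (s + 1) x) (at x)"
proof (induction k arbitrary: x)
  case 0
  then show ?case using of_real_powr_has_vector_derivative[of x "- s"] by simp
next
  case (Suc k)
  have "(dpow k s has_vector_derivative - s * dpow k (s + 1) (x + 1)) (at (x + 1))"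
    using Suc by simp
  moreover have "((\<lambda>x::real. x + 1) has_vector_derivative 1) (at x)"
    by (auto intro!: derivative_eq_intros)
  ultimately have "((\<lambda>x. dpow k s (x + 1)) has_vector_derivative - s * dpow k (s + 1) (x + 1)) (at x)"
    using vector_diff_chain_at[of "\<lambda>x. x + 1" 1 x "dpow k s"] by (simp add: o_def)
  from has_vector_derivative_diff[OF Suc.IH[OF Suc.prems] this]
  have "((\<lambda>x. dpow k s x - dpow k s (x + 1)) has_vector_derivative - s * dpow (Suc k) (s + 1) x) (at x)"
    by (simp add: algebra_simps)
  moreover have "(\<lambda>x. dpow k s x - dpow k s (x + 1)) = dpow (Suc k) s" by auto
  ultimately show ?case by metis
qed

lemma norm_diff_le_vector_derivative:
  fixes f :: "real \<Rightarrow> complex"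
  assumes "a \<le> b" "\<And>x. a \<le> x \<Longrightarrow> x \<le> b \<Longrightarrow> (f has_vector_derivative f' x) (at x)"
    "\<And>x. a \<le> x \<Longrightarrow> x \<le> b \<Longrightarrow> norm (f' x) \<le> B"
  shows "norm (f b - f a) \<le> B * (b - a)"
proof (cases "a = b")
  case False
  then have "a < b" using assms by simp
  have "continuous_on {a..b} f"
    using has_vector_derivative_continuous[OF assms(2)]
    by (intro continuous_at_imp_continuous_on) auto
  moreover have "(f has_derivative (\<lambda>h. h *\<^sub>R f' x)) (at x)" if "a < x" "x < b" for x
    using assms(2)[of x] that by (simp add: has_vector_derivative_def)
  ultimately obtain x where "x \<in> {a<..<b}" "norm (f b - f a) \<le> norm ((b - a) *\<^sub>R f' x)"
    using mvt_general[OF \<open>a < b\<close>, of f "\<lambda>x h. h *\<^sub>R f' x"] by auto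
  then have "norm (f b - f a) \<le> (b - a) * norm (f' x)" "norm (f' x) \<le> B"
    using assms(1) assms(3)[of x] by auto
  moreover from this have "(b - a) * norm (f' x) \<le> (b - a) * B"
    using assms(1) by (intro mult_left_mono) auto
  ultimately have "norm (f b - f a) \<le> (b - a) * B" by linarith
  then show ?thesis by (simp only: mult.commute)
qed simp

text \<open>The derivative of \<open>dpow k s\<close> is \<open>- s * dpow k (s + 1)\<close>, so the
  mean value inequality over a unit step trades a difference for a factor \<open>norm s\<close> and
  a shift of \<open>s\<close> by 1. The base \<open>norm s + k\<close> is chosen to absorb that
  shift.\<close>

lemma norm_dpow_le:
  "x > 0 \<Longrightarrow> Re s + k \<ge> 0 \<Longrightarrow> norm (dpow k s x) \<le> (norm s + k) ^ k * x powr (- (Re s + k))"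
proof (induction k arbitrary: s x)
  case 0
  then show ?case by (simp add: norm_of_real_powr)
next
  case (Suc k)
  define B where "B = (norm s + Suc k) ^ Suc k * x powr (- (Re s + Suc k))"
  have "norm (dpow k s (x + 1) - dpow k s x) \<le> B * ((x + 1) - x)"
  proof (rule norm_diff_le_vector_derivative)
    fix y assume y: "x \<le> y" "y \<le> x + 1"
    show "(dpow k s has_vector_derivative - s * dpow k (s + 1) y) (at y)"
      by (rule dpow_has_vector_derivative) (use y Suc in auto)
    have "norm (s + 1) + k \<le> norm s + Suc k" using norm_triangle_ineq[of s 1] by simp
    then have 1: "(norm (s + 1) + k) ^ k \<le> (norm s + Suc k) ^ k" by (intro power_mono) auto
    have 2: "y powr (- (Re s + Suc k)) \<le> x powr (- (Re s + Suc k))"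
      by (rule powr_mono2') (use y Suc in auto)
    have "norm (dpow k (s + 1) y) \<le> (norm (s + 1) + k) ^ k * y powr (- (Re (s + 1) + k))"
      using Suc y by (intro Suc.IH) auto
    also have "\<dots> \<le> (norm s + Suc k) ^ k * x powr (- (Re s + Suc k))"
      using 1 2 by (intro mult_mono) (auto simp: add_ac)
    finally have "norm (dpow k (s + 1) y) \<le> (norm s + Suc k) ^ k * x powr (- (Re s + Suc k))" .
    then have "norm s * norm (dpow k (s + 1) y) \<le> (norm s + Suc k) * ((norm s + Suc k) ^ k * x powr (- (Re s + Suc k)))"
      by (intro mult_mono) auto
    then show "norm (- s * dpow k (s + 1) y) \<le> B"
      by (simp add: B_def norm_mult mult_ac)
  qed auto
  then show ?case by (simp add: B_def norm_minus_commute)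
qed

lemma dpow_holomorphic: "x > 0 \<Longrightarrow> (\<lambda>s. dpow k s x) holomorphic_on A"
proof (induction k arbitrary: x)
  case 0
  then show ?case by (auto intro!: holomorphic_intros)
next
  case (Suc k)
  then show ?case by (auto intro!: holomorphic_intros)
qed

lemma summable_shift_powr:
  assumes "a > 1" "N > 0"
  shows "summable (\<lambda>n. (real N + real n) powr (- a))"
proof -
  have "summable (\<lambda>n. real n powr (- a))" using assms by (subst summable_real_powr_iff) auto
  then have "summable (\<lambda>n. real (n + N) powr (- a))" by (rule summable_ignore_initial_segment)
  then show ?thesis by (simp add: add_ac)
qed

lemma summable_dpow:
  assumes "Re s + k > 1" "N > 0"
  shows "summable (\<lambda>n. norm ((-1) ^ n * dpow k s (real N + real n)))"
proof (rule summable_comparison_test)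
  show "summable (\<lambda>n. (norm s + k) ^ k * (real N + real n) powr (- (Re s + k)))"
    using assms by (intro summable_mult summable_shift_powr) auto
  show "\<exists>M. \<forall>n\<ge>M. norm (norm ((-1) ^ n * dpow k s (real N + real n))) \<le> (norm s + k) ^ k * (real N + real n) powr (- (Re s + k))"
  proof (intro exI[of _ 0] allI impI)
    fix n :: nat
    have "norm (dpow k s (real N + real n)) \<le> (norm s + k) ^ k * (real N + real n) powr (- (Re s + k))"
      by (rule norm_dpow_le) (use assms in auto)
    then show "norm (norm ((-1) ^ n * dpow k s (real N + real n))) \<le> (norm s + k) ^ k * (real N + real n) powr (- (Re s + k))"
      by (simp add: norm_mult norm_power)
  qed
qed

text \<open>The \<open>k\<close>-fold Euler transform of the alternating series \<open>(-1)^n (N + n) powr (- s)\<close>.\<close>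

definition euler_tail :: "nat \<Rightarrow> nat \<Rightarrow> complex \<Rightarrow> complex" where
  "euler_tail k N s = (\<Sum>j<k. dpow j s (real N) / 2 ^ Suc j) +
     (\<Sum>n. (-1) ^ n * dpow k s (real N + real n)) / 2 ^ k"

text \<open>Summation by parts: the alternating sum of \<open>a n - a (Suc n)\<close> is twice that
  of \<open>a n\<close>, minus \<open>a 0\<close>, and the new finite term supplies exactly this
  \<open>a 0\<close>. Hence the functions for different \<open>k\<close> glue together.\<close>

lemma euler_tail_Suc:
  assumes "Re s + k > 1" "N > 0"
  shows "euler_tail (Suc k) N s = euler_tail k N s"
proof -
  define a where "a n = dpow k s (real N + real n)" for n
  have s: "summable (\<lambda>n. (-1) ^ n * a n)"
    using summable_norm_cancel[OF summable_dpow[OF assms]] by (simp add: a_def)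
  have d: "dpow (Suc k) s (real N + real n) = a n - a (Suc n)" for n
    by (simp add: a_def add_ac)
  have s2: "summable (\<lambda>n. (-1) ^ Suc n * a (Suc n))" using s by (subst summable_Suc_iff)
  define S where "S = (\<Sum>n. (-1) ^ n * dpow (Suc k) s (real N + real n))"
  have "S = (\<Sum>n. (-1) ^ n * a n + (-1) ^ Suc n * a (Suc n))"
    unfolding S_def d by (simp add: algebra_simps)
  also have "\<dots> = (\<Sum>n. (-1) ^ n * a n) + (\<Sum>n. (-1) ^ Suc n * a (Suc n))"
    using s s2 by (rule suminf_add[symmetric])
  also have "(\<Sum>n. (-1) ^ Suc n * a (Suc n)) = (\<Sum>n. (-1) ^ n * a n) - a 0"
    using suminf_split_head[OF s] by simp
  finally have S: "S = 2 * (\<Sum>n. (-1) ^ n * a n) - a 0"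
    by simp
  have "euler_tail k N s = (\<Sum>j<k. dpow j s (real N) / 2 ^ Suc j) + (\<Sum>n. (-1) ^ n * a n) / 2 ^ k"
    by (simp add: euler_tail_def a_def)
  moreover have "euler_tail (Suc k) N s = (\<Sum>j<k. dpow j s (real N) / 2 ^ Suc j) + a 0 / 2 ^ Suc k + S / 2 ^ Suc k"
    by (simp add: euler_tail_def a_def S_def del: dpow.simps)
  ultimately show ?thesis unfolding S
    by (simp add: diff_divide_distrib)
qed

lemma euler_tail_add:
  assumes "Re s + k > 1" "N > 0"
  shows "euler_tail (k + j) N s = euler_tail k N s"
proof (induction j)
  case (Suc j)
  then show ?case using euler_tail_Suc[of s "k + j" N] assms by simp
qed simp

lemma euler_tail_eq:
  assumes "Re s + k > 1" "Re s + j > 1" "N > 0"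
  shows "euler_tail k N s = euler_tail j N s"
  using euler_tail_add[of s k N "j - k"] euler_tail_add[of s j N "k - j"] assms
  by (cases "j \<le> k") auto

lemma euler_tail_holomorphic:
  assumes "N > 0"
  shows "euler_tail k N holomorphic_on {s. Re s + k > 1}"
proof -
  have S: "{s. Re s + k > 1} = {s. Re s > 1 - real k}" by auto
  have "(\<lambda>s. \<Sum>n. (-1) ^ n * dpow k s (real N + real n)) holomorphic_on {s. Re s > 1 - real k}"
  proof (rule holomorphic_on_suminf_halfplane)
    show "(\<lambda>s. (-1) ^ n * dpow k s (real N + real n)) holomorphic_on {s. Re s > 1 - real k}" for n
      using assms by (intro holomorphic_intros dpow_holomorphic) auto
    fix b R :: real assume b: "b > 1 - real k" and R: "R > 0"
    define M where "M n = (R + k) ^ k * (real N + real n) powr (- (b + k))" for n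
    have "norm ((-1) ^ n * dpow k y (real N + real n)) \<le> M n" if y: "Re y \<ge> b" "norm y \<le> R" for y n
    proof -
      have "norm (dpow k y (real N + real n)) \<le> (norm y + k) ^ k * (real N + real n) powr (- (Re y + k))"
        using y b assms by (intro norm_dpow_le) auto
      also have "\<dots> \<le> M n" unfolding M_def
        using y assms R by (intro mult_mono power_mono powr_mono) auto
      finally show ?thesis by (simp add: norm_mult norm_power)
    qed
    moreover have "summable M" unfolding M_def using b assms by (intro summable_mult summable_shift_powr) auto
    ultimately show "\<exists>M. summable M \<and> (\<forall>n y. Re y \<ge> b \<longrightarrow> norm y \<le> R \<longrightarrow>
        norm ((-1) ^ n * dpow k y (real N + real n)) \<le> M n)" by blast
  qed
  then show ?thesis unfolding euler_tail_def S
    using assms by (intro holomorphic_intros dpow_holomorphic) auto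
qed

lemma euler_tail_step:
  assumes "Re s + k > 1" "N > 0"
  shows "euler_tail k N s + euler_tail k (Suc N) s = of_nat N powr (- s)"
proof -
  define a where "a n = dpow k s (real N + real n)" for n
  have s: "summable (\<lambda>n. (-1) ^ n * a n)"
    using summable_norm_cancel[OF summable_dpow[OF assms]] by (simp add: a_def)
  have "(\<Sum>n. (-1) ^ Suc n * a (Suc n)) = (\<Sum>n. (-1) ^ n * a n) - a 0"
    using suminf_split_head[OF s] by simp
  moreover have "(\<Sum>n. - ((-1) ^ Suc n * a (Suc n))) = - (\<Sum>n. (-1) ^ Suc n * a (Suc n))"
    using s by (intro suminf_minus) (subst summable_Suc_iff)
  moreover have "- ((-1) ^ Suc n * a (Suc n)) = (-1) ^ n * dpow k s (real (Suc N) + real n)" for n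
    by (simp add: a_def add_ac)
  moreover have "a 0 = dpow k s N" by (simp add: a_def)
  ultimately have 1: "(\<Sum>n. (-1) ^ n * a n) + (\<Sum>n. (-1) ^ n * dpow k s (real (Suc N) + real n)) = dpow k s N"
    by (simp only: add_diff_eq minus_diff_eq) simp
  \<comment> \<open>The finite parts at \<open>N\<close> and \<open>Suc N\<close> telescope in
    \<open>j\<close>; the remainder left over is what \<open>1\<close> says the two infinite parts
    contribute.\<close>
  have 2: "(\<Sum>j<k. dpow j s (real N) / 2 ^ Suc j) + (\<Sum>j<k. dpow j s (real (Suc N)) / 2 ^ Suc j)
      = of_nat N powr (- s) - dpow k s N / 2 ^ k" for k
  proof (induction k)
    case (Suc k)
    have "dpow (Suc k) s N = dpow k s N - dpow k s (real (Suc N))" by (simp add: add_ac)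
    moreover have "dpow k s N / 2 ^ k = dpow k s N / 2 ^ Suc k + dpow k s N / 2 ^ Suc k" by simp
    ultimately show ?case using Suc by (simp add: diff_divide_distrib algebra_simps)
  qed auto
  have "euler_tail k N s + euler_tail k (Suc N) s =
     ((\<Sum>j<k. dpow j s (real N) / 2 ^ Suc j) + (\<Sum>j<k. dpow j s (real (Suc N)) / 2 ^ Suc j)) +
     ((\<Sum>n. (-1) ^ n * a n) + (\<Sum>n. (-1) ^ n * dpow k s (real (Suc N) + real n))) / 2 ^ k"
    by (simp add: euler_tail_def a_def add_divide_distrib)
  also have "\<dots> = of_nat N powr (- s)" unfolding 1 2 by simp
  finally show ?thesis .
qed

lemma alternating_telescope:
  fixes E f :: "nat \<Rightarrow> 'a::comm_ring_1"
  assumes "\<And>n. n > 0 \<Longrightarrow> E n + E (Suc n) = f n"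
  shows "E 1 = (\<Sum>n=1..N. (-1) ^ Suc n * f n) + (-1) ^ N * E (Suc N)"
proof (induction N)
  case (Suc N)
  then show ?case using assms[of "Suc N", symmetric] by (simp add: ring_distribs)
qed simp

text \<open>Only the part of the series beyond \<open>N\<close> gets transformed. In the second
  moment \<open>N\<close> is taken slightly longer than the height, where that part is
  bounded.\<close>

lemma euler_tail_split:
  assumes "Re s + k > 1"
  shows "euler_tail k 1 s = (\<Sum>n=1..N. (-1) ^ Suc n * of_nat n powr (- s)) + (-1) ^ N * euler_tail k (Suc N) s"
  by (rule alternating_telescope[of "\<lambda>N. euler_tail k N s"]) (rule euler_tail_step[OF assms])

subsection \<open>Analytic continuation of zeta\<close>

lemma summable_zeta_series: "Re s > 1 \<Longrightarrow> summable (\<lambda>n. norm (of_nat (Suc n) powr (- s)))"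
proof -
  assume "Re s > 1"
  then have "summable (\<lambda>n. (real 1 + real n) powr (- Re s))" by (intro summable_shift_powr) auto
  moreover have "norm (of_nat (Suc n) powr (- s)) = (real 1 + real n) powr (- Re s)" for n
    using norm_of_real_powr[of "real (Suc n)" "- s"] by simp
  ultimately show ?thesis by simp
qed

text \<open>The alternating series is the full series minus twice its terms at even integers. Index
  \<open>n\<close> stands for the integer \<open>n + 1\<close>, so these terms sit at odd
  \<open>n = 2 * m + 1\<close>, and each is \<open>2 powr (- s)\<close> times term
  \<open>m\<close>.\<close>

lemma euler_tail_0:
  assumes s: "Re s > 1"
  shows "euler_tail 0 1 s = (1 - 2 powr (1 - s)) * (\<Sum>n. of_nat (Suc n) powr (- s))"
proof -
  define a where "a n = of_nat (Suc n) powr (- s)" for n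
  have sa: "summable a"
    unfolding a_def by (rule summable_norm_cancel) (rule summable_zeta_series[OF s])
  have d: "dpow 0 s (real 1 + real n) = a n" for n by (simp add: a_def)
  have sb: "summable (\<lambda>n. (-1) ^ n * a n)"
    using summable_norm_cancel[OF summable_dpow[of s 0 1]] s unfolding d by simp
  have e: "euler_tail 0 1 s = (\<Sum>n. (-1) ^ n * a n)"
    unfolding euler_tail_def d by simp
  have g: "a (2 * m + 1) = 2 powr (- s) * a m" for m
  proof -
    have "complex_of_nat (Suc (2 * m + 1)) = 2 * of_nat (Suc m)" by simp
    then show ?thesis unfolding a_def using powr_times_real[of 2 "of_nat (Suc m)" "- s"] by simp
  qed
  have "(\<lambda>m. (\<lambda>n. (1 - (-1) ^ n) * a n) (2 * m + 1)) sums (2 * 2 powr (- s) * suminf a)"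
    using sums_mult[OF summable_sums[OF sa], of "2 * 2 powr (- s)"] unfolding g by (simp add: mult.assoc)
  moreover have "(1 - (-1) ^ n) * a n = 0" if n: "n \<notin> range (\<lambda>m. 2 * m + 1)" for n
  proof -
    have "even n"
    proof (rule ccontr)
      assume "odd n"
      then obtain m where "n = 2 * m + 1" by (rule oddE)
      then show False using n by auto
    qed
    then show ?thesis by simp
  qed
  ultimately have "(\<lambda>n. (1 - (-1) ^ n) * a n) sums (2 * 2 powr (- s) * suminf a)"
    by (subst (asm) sums_mono_reindex) (auto simp: strict_mono_def)
  moreover have "(\<lambda>n. (1 - (-1) ^ n) * a n) sums (suminf a - (\<Sum>n. (-1) ^ n * a n))"
    using sums_diff[OF summable_sums[OF sa] summable_sums[OF sb]] by (simp add: algebra_simps)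
  ultimately have "suminf a - (\<Sum>n. (-1) ^ n * a n) = 2 * 2 powr (- s) * suminf a"
    by (rule sums_unique2[symmetric])
  moreover have "2 powr (1 - s) = 2 * 2 powr (- s)" by (simp add: powr_diff powr_minus divide_inverse)
  moreover have "(\<Sum>n. of_nat (Suc n) powr (- s)) = suminf a" unfolding a_def ..
  ultimately show ?thesis unfolding e by (simp add: algebra_simps)
qed

text \<open>\<open>s - 1\<close> times the difference between \<open>Suc n powr (- s)\<close> and
  the integral of \<open>x powr (- s)\<close> over the unit interval to the right of
  \<open>Suc n\<close>. The factor \<open>s - 1\<close> removes the pole; unlike the alternating
  series, this needs no division by \<open>1 - 2 powr (1 - s)\<close>, which has zeros on the whole
  line \<open>Re s = 1\<close>.\<close>

definition zterm :: "nat \<Rightarrow> complex \<Rightarrow> complex" where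
  "zterm n s = (s - 1) * of_real (real (Suc n)) powr (- s) -
     (of_real (real (Suc n)) powr (1 - s) - of_real (real (Suc n) + 1) powr (1 - s))"

text \<open>The function \<open>(s - 1) * zeta s\<close> on the half-plane \<open>Re s > 0\<close>.\<close>

definition zeta_reg :: "complex \<Rightarrow> complex" where
  "zeta_reg s = 1 + (\<Sum>n. zterm n s)"

lemma norm_zterm_le:
  assumes "Re s > 0"
  shows "norm (zterm n s) \<le> norm (s - 1) * norm s * real (Suc n) powr (- (Re s + 1))"
proof -
  define m where "m = real (Suc n)"
  have m: "m > 0" by (simp add: m_def)
  define B where "B = norm s * m powr (- (Re s + 1))"
  have 1: "norm (complex_of_real x powr (- s) - complex_of_real m powr (- s)) \<le> B" if x: "m \<le> x" "x \<le> m + 1" for x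
  proof -
    have "norm (complex_of_real x powr (- s) - complex_of_real m powr (- s)) \<le> B * (x - m)"
    proof (rule norm_diff_le_vector_derivative[where f = "\<lambda>x. complex_of_real x powr (- s)"])
      fix y assume y: "m \<le> y" "y \<le> x"
      show "((\<lambda>x. complex_of_real x powr (- s)) has_vector_derivative - s * complex_of_real y powr (- s - 1)) (at y)"
        using y m by (intro of_real_powr_has_vector_derivative) auto
      have "y powr (- (Re s + 1)) \<le> m powr (- (Re s + 1))"
        by (rule powr_mono2') (use y m assms in auto)
      moreover have "norm (complex_of_real y powr (- s - 1)) = y powr (- (Re s + 1))"
        using y m by (subst norm_of_real_powr) auto
      ultimately show "norm (- s * complex_of_real y powr (- s - 1)) \<le> B"
        by (auto simp: B_def norm_mult intro: mult_left_mono)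
    qed (use x in auto)
    also have "\<dots> \<le> B * 1" using x m by (intro mult_left_mono) (auto simp: B_def)
    finally show ?thesis by simp
  qed
  \<comment> \<open>The derivative of \<open>H\<close> is
    \<open>(1 - s) * (x powr (- s) - m powr (- s))\<close>, which \<open>1\<close> controls, while
    the increment of \<open>H\<close> over the unit interval is the term itself.\<close>
  define H where "H x = complex_of_real x powr (1 - s) - (1 - s) * complex_of_real m powr (- s) * of_real x" for x
  have "norm (H (m + 1) - H m) \<le> (norm (s - 1) * B) * (m + 1 - m)"
  proof (rule norm_diff_le_vector_derivative)
    fix x assume x: "m \<le> x" "x \<le> m + 1"
    have "((\<lambda>x. complex_of_real x powr (1 - s)) has_vector_derivative (1 - s) * complex_of_real x powr (- s)) (at x)"
      using of_real_powr_has_vector_derivative[of x "1 - s"] x m by simp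
    then show "(H has_vector_derivative (1 - s) * (complex_of_real x powr (- s) - complex_of_real m powr (- s))) (at x)"
      unfolding H_def right_diff_distrib
      by (auto intro!: has_vector_derivative_diff derivative_eq_intros)
    show "norm ((1 - s) * (complex_of_real x powr (- s) - complex_of_real m powr (- s))) \<le> norm (s - 1) * B"
      using 1[OF x] by (auto simp: norm_mult norm_minus_commute intro: mult_left_mono)
  qed auto
  moreover have "zterm n s = H (m + 1) - H m"
    by (simp add: H_def zterm_def m_def algebra_simps)
  ultimately show ?thesis by (simp add: B_def m_def mult_ac)
qed

lemma summable_powr_Suc: "a > 1 \<Longrightarrow> summable (\<lambda>n. real (Suc n) powr (- a))"
  using summable_shift_powr[of a 1] by (simp add: add_ac)

lemma summable_zterm:
  assumes "Re s > 0"
  shows "summable (\<lambda>n. norm (zterm n s))"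
proof (rule summable_comparison_test)
  show "summable (\<lambda>n. norm (s - 1) * norm s * real (Suc n) powr (- (Re s + 1)))"
    using assms by (intro summable_mult summable_powr_Suc) auto
  show "\<exists>N. \<forall>n\<ge>N. norm (norm (zterm n s)) \<le> norm (s - 1) * norm s * real (Suc n) powr (- (Re s + 1))"
    using norm_zterm_le[OF assms] by auto
qed

lemma zeta_reg_bound:
  assumes "a > 0" "Re s \<ge> a"
  shows "norm (zeta_reg s) \<le> 1 + norm (s - 1) * norm s * (\<Sum>n. real (Suc n) powr (- (a + 1)))"
proof -
  have sm: "summable (\<lambda>n. norm (zterm n s))" using assms by (intro summable_zterm) auto
  have "norm (\<Sum>n. zterm n s) \<le> (\<Sum>n. norm (zterm n s))" using sm by (rule summable_norm)
  also have "\<dots> \<le> (\<Sum>n. norm (s - 1) * norm s * real (Suc n) powr (- (a + 1)))"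
  proof (rule suminf_le)
    show "norm (zterm n s) \<le> norm (s - 1) * norm s * real (Suc n) powr (- (a + 1))" for n
    proof -
      have "real (Suc n) powr (- (Re s + 1)) \<le> real (Suc n) powr (- (a + 1))"
        using assms by (intro powr_mono) auto
      then have "norm (s - 1) * norm s * real (Suc n) powr (- (Re s + 1)) \<le> norm (s - 1) * norm s * real (Suc n) powr (- (a + 1))"
        by (intro mult_left_mono) auto
      then show ?thesis using norm_zterm_le[of s n] assms by linarith
    qed
    show "summable (\<lambda>n. norm (s - 1) * norm s * real (Suc n) powr (- (a + 1)))"
      using assms by (intro summable_mult summable_powr_Suc) auto
  qed (rule sm)
  also have "\<dots> = norm (s - 1) * norm s * (\<Sum>n. real (Suc n) powr (- (a + 1)))"
    by (intro suminf_mult summable_powr_Suc) (use assms in auto)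
  finally show ?thesis unfolding zeta_reg_def using norm_triangle_ineq[of 1 "\<Sum>n. zterm n s"] by simp
qed

lemma zeta_reg_holomorphic: "zeta_reg holomorphic_on {s. Re s > 0}"
proof -
  have "(\<lambda>s. \<Sum>n. zterm n s) holomorphic_on {s. Re s > 0}"
  proof (rule holomorphic_on_suminf_halfplane)
    show "zterm n holomorphic_on {s. Re s > 0}" for n
      unfolding zterm_def by (intro holomorphic_intros)
    fix b R :: real assume b: "b > 0" and R: "R > 0"
    define M where "M n = (R + 1) * R * real (Suc n) powr (- (b + 1))" for n
    have "norm (zterm n y) \<le> M n" if y: "Re y \<ge> b" "norm y \<le> R" for y n
    proof -
      have "norm (zterm n y) \<le> norm (y - 1) * norm y * real (Suc n) powr (- (Re y + 1))"
        using y b by (intro norm_zterm_le) auto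
      also have "\<dots> \<le> M n" unfolding M_def
        using y R norm_triangle_ineq4[of y 1] by (intro mult_mono powr_mono) auto
      finally show ?thesis .
    qed
    moreover have "summable M" unfolding M_def using b by (intro summable_mult summable_powr_Suc) auto
    ultimately show "\<exists>M. summable M \<and> (\<forall>n y. Re y \<ge> b \<longrightarrow> norm y \<le> R \<longrightarrow> norm (zterm n y) \<le> M n)"
      by blast
  qed
  then show ?thesis unfolding zeta_reg_def by (intro holomorphic_intros)
qed

lemma zeta_reg_eq_series:
  assumes s: "Re s > 1"
  shows "zeta_reg s = (s - 1) * (\<Sum>n. of_nat (Suc n) powr (- s))"
proof -
  define b where "b n = complex_of_real (real (Suc n)) powr (1 - s)" for n
  have "(\<lambda>n. real (Suc n) powr (1 - Re s)) \<longlonglongrightarrow> 0"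
    using tendsto_neg_powr[of "1 - Re s" "\<lambda>n. real (Suc n)" sequentially] s
    using filterlim_compose[OF filterlim_real_sequentially filterlim_Suc] by auto
  then have "(\<lambda>n. norm (b n)) \<longlonglongrightarrow> 0"
    unfolding b_def by (subst norm_of_real_powr) auto
  then have "b \<longlonglongrightarrow> 0" by (rule tendsto_norm_zero_cancel)
  from telescope_sums'[OF this] have t: "(\<lambda>n. b n - b (Suc n)) sums 1" by (simp add: b_def)
  have "(\<lambda>n. (s - 1) * of_nat (Suc n) powr (- s)) sums ((s - 1) * (\<Sum>n. of_nat (Suc n) powr (- s)))"
    using summable_norm_cancel[OF summable_zeta_series[OF s]] by (intro sums_mult summable_sums)
  from sums_diff[OF this t] have "(\<lambda>n. zterm n s) sums ((s - 1) * (\<Sum>n. of_nat (Suc n) powr (- s)) - 1)"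
    by (simp add: zterm_def b_def add_ac)
  then show ?thesis by (simp add: zeta_reg_def sums_iff)
qed

text \<open>Both sides are multiples of the Dirichlet series for \<open>Re s > 1\<close>, and the
  identity theorem carries the equation to the left. Written without quotients, both sides stay
  holomorphic at the zeros of \<open>1 - 2 powr (1 - s)\<close>.\<close>

lemma zeta_reg_eq_euler_tail:
  assumes "Re s > 0"
  shows "(1 - 2 powr (1 - s)) * zeta_reg s = (s - 1) * euler_tail 1 1 s"
proof -
  let ?S = "{s. Re s > 0}"
  have op: "open ?S" "connected ?S"
    by (auto intro!: open_halfspace_Re_gt convex_connected convex_halfspace_Re_gt)
  have "euler_tail 1 1 holomorphic_on ?S"
    using euler_tail_holomorphic[of 1 1] by (rule holomorphic_on_subset) auto
  then have h: "(\<lambda>s. (1 - 2 powr (1 - s)) * zeta_reg s - (s - 1) * euler_tail 1 1 s) holomorphic_on ?S"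
    using zeta_reg_holomorphic by (intro holomorphic_intros) auto
  have "(1 - 2 powr (1 - s)) * zeta_reg s - (s - 1) * euler_tail 1 1 s = 0"
  proof (rule analytic_continuation_open[of "{s. Re s > 1}" ?S
      "\<lambda>s. (1 - 2 powr (1 - s)) * zeta_reg s - (s - 1) * euler_tail 1 1 s" "\<lambda>_. 0"])
    show "open {s. Re s > 1}" by (rule open_halfspace_Re_gt)
    show "{s. Re s > 1} \<noteq> {}" by (auto intro!: exI[of _ 2])
    show "(1 - 2 powr (1 - s)) * zeta_reg s - (s - 1) * euler_tail 1 1 s = 0" if "s \<in> {s. Re s > 1}" for s
      using zeta_reg_eq_series[of s] euler_tail_0[of s] euler_tail_eq[of s 1 0 1] that by simp
  qed (use op h assms in auto)
  then show ?thesis by simp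
qed

text \<open>Two formulas overlap in the strip: \<open>zeta_reg\<close> covers the line
  \<open>Re s = 1\<close>, and Euler transforms cover the left, with more of them as
  \<open>Re s\<close> decreases. The last conjunct records the explicit formula for later
  use.\<close>

lemma zeta_continuation_exists:
  "\<exists>f. f holomorphic_on (- {1}) \<and> (\<forall>s. Re s > 1 \<longrightarrow> f s = (\<Sum>n. of_nat (Suc n) powr (- s)))
     \<and> (\<forall>s. Re s > 0 \<and> s \<noteq> 1 \<longrightarrow> f s = zeta_reg s / (s - 1))"
proof -
  define e where "e s = euler_tail (nat \<lceil>2 - Re s\<rceil>) 1 s" for s
  have e: "e s = euler_tail k 1 s" if "Re s + k > 1" for s k
    unfolding e_def by (rule euler_tail_eq) (use that in linarith)+
  have p: "1 - 2 powr (1 - s) \<noteq> (0::complex)" if "Re s < 1" for s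
  proof
    assume "1 - 2 powr (1 - s) = (0::complex)"
    then have "norm (2 powr (1 - s)) = 1" by (metis eq_iff_diff_eq_0 norm_one)
    then show False using that norm_of_real_powr[of 2 "1 - s"] by simp
  qed
  define f where "f s = (if Re s > 0 then zeta_reg s / (s - 1) else e s / (1 - 2 powr (1 - s)))" for s
  have f2: "f s = e s / (1 - 2 powr (1 - s))" if "Re s < 1" for s
  proof (cases "Re s > 0")
    case True
    have "s \<noteq> 1" using that by auto
    then show ?thesis using zeta_reg_eq_euler_tail[OF True] p[OF that] e[of s 1] True
      by (simp add: f_def divide_simps mult_ac)
  qed (simp add: f_def)
  have "f holomorphic_on ({s. Re s > 0} - {1})"
  proof -
    have "(\<lambda>s. zeta_reg s / (s - 1)) holomorphic_on ({s. Re s > 0} - {1})"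
      by (intro holomorphic_intros holomorphic_on_subset[OF zeta_reg_holomorphic]) auto
    then show ?thesis by (rule holomorphic_transform) (auto simp: f_def)
  qed
  moreover have "f holomorphic_on {s. Re s < 1}"
  proof -
    have "f field_differentiable at s" if "Re s < 1" for s
    proof -
      \<comment> \<open>The index inside \<open>e\<close> jumps with \<open>Re s\<close>, so
        holomorphy is checked near a point with that point's own index kept fixed; \<open>e\<close>
        agrees with it on \<open>U\<close>.\<close>
      define k where "k = nat \<lceil>2 - Re s\<rceil>"
      define U where "U = {s. Re s + k > 1} \<inter> {s. Re s < 1}"
      have "open U" unfolding U_def using open_halfspace_Re_gt[of "1 - real k"] open_halfspace_Re_lt[of 1]
        by (intro open_Int) (simp_all add: algebra_simps)
      have "(\<lambda>s. euler_tail k 1 s / (1 - 2 powr (1 - s))) holomorphic_on U"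
        using p by (intro holomorphic_intros holomorphic_on_subset[OF euler_tail_holomorphic]) (auto simp: U_def)
      then have "f holomorphic_on U"
        by (rule holomorphic_transform) (use f2 e in \<open>auto simp: U_def\<close>)
      moreover have "s \<in> U" unfolding U_def k_def using that by simp linarith
      ultimately show ?thesis using \<open>open U\<close> holomorphic_on_imp_differentiable_at by blast
    qed
    then show ?thesis by (auto simp: holomorphic_on_def intro: field_differentiable_at_within)
  qed
  moreover have "open ({s. Re s > 0} - {1})" "open {s. Re s < 1}"
    by (auto intro!: open_Diff open_halfspace_Re_gt open_halfspace_Re_lt)
  ultimately have "f holomorphic_on ({s. Re s > 0} - {1} \<union> {s. Re s < 1})"
    by (intro holomorphic_on_Un)
  moreover have "{s. Re s > 0} - {1} \<union> {s. Re s < 1} = - {1}" by (auto simp: complex_eq_iff)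
  moreover have "f s = (\<Sum>n. of_nat (Suc n) powr (- s))" if "Re s > 1" for s
  proof -
    have "s \<noteq> 1" using that by auto
    then show ?thesis using that zeta_reg_eq_series[OF that] by (simp add: f_def)
  qed
  ultimately show ?thesis by (intro exI[of _ f]) (auto simp: f_def)
qed

lemma zeta_holomorphic: "zeta holomorphic_on (- {1})"
  and zeta_eq_series: "Re s > 1 \<Longrightarrow> zeta s = (\<Sum>n. of_nat (Suc n) powr (- s))"
proof -
  have "zeta holomorphic_on (- {1}) \<and> (\<forall>s. Re s > 1 \<longrightarrow> zeta s = (\<Sum>n. of_nat (Suc n) powr (- s)))"
    unfolding zeta_def by (rule someI_ex[of "\<lambda>f. f holomorphic_on (- {1}) \<and> (\<forall>s. Re s > 1 \<longrightarrow> f s = (\<Sum>n. of_nat (Suc n) powr (- s)))"])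
      (use zeta_continuation_exists in blast)
  then show "zeta holomorphic_on (- {1})" "Re s > 1 \<Longrightarrow> zeta s = (\<Sum>n. of_nat (Suc n) powr (- s))"
    by auto
qed

text \<open>The choice operator yields only the two defining properties of \<open>zeta\<close>, so
  the explicit formula is transferred from a constructed continuation by the identity theorem on the
  punctured plane, which is connected.\<close>

lemma zeta_eq_zeta_reg:
  assumes "Re s > 0" "s \<noteq> 1"
  shows "zeta s = zeta_reg s / (s - 1)"
proof -
  from zeta_continuation_exists obtain f where f: "f holomorphic_on (- {1})"
    "\<And>s. Re s > 1 \<Longrightarrow> f s = (\<Sum>n. of_nat (Suc n) powr (- s))"
    "\<And>s. Re s > 0 \<Longrightarrow> s \<noteq> 1 \<Longrightarrow> f s = zeta_reg s / (s - 1)" by blast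
  have "zeta s = f s"
  proof (rule analytic_continuation_open[of "{s. Re s > 1}" "- {1}" zeta f])
    show "open {s. Re s > 1}" by (rule open_halfspace_Re_gt)
    show "{s. Re s > 1} \<noteq> {}" by (auto intro!: exI[of _ 2])
    show "connected (- {1::complex})" by (rule connected_punctured_universe) simp
  qed (use zeta_holomorphic f assms zeta_eq_series in auto)
  then show ?thesis using f assms by simp
qed

text \<open>Linear growth is far from sharp, but it is only used inside a logarithm or against a
  factor \<open>exp (- ((ln T)\<^sup>2))\<close>.\<close>

lemma zeta_growth:
  assumes "a > 0"
  obtains C where "C > 0" "\<And>s. Re s \<ge> a \<Longrightarrow> \<bar>Im s\<bar> \<ge> 1 \<Longrightarrow> norm (zeta s) \<le> C * norm s"
proof
  define K where "K = (\<Sum>n. real (Suc n) powr (- (a + 1)))"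
  have K: "K \<ge> 0" unfolding K_def using assms by (intro suminf_nonneg summable_powr_Suc) auto
  then show "1 + K > 0" by simp
  fix s assume s: "Re s \<ge> a" "\<bar>Im s\<bar> \<ge> 1"
  have n: "norm s \<ge> 1" "norm (s - 1) \<ge> 1"
    using abs_Im_le_cmod[of s] abs_Im_le_cmod[of "s - 1"] s by auto
  then have "s \<noteq> 1" by auto
  then have "norm (zeta s) = norm (zeta_reg s) / norm (s - 1)"
    using zeta_eq_zeta_reg[of s] s assms by (auto simp: norm_divide)
  also have "\<dots> \<le> (1 + norm (s - 1) * norm s * K) / norm (s - 1)"
    using zeta_reg_bound[OF assms s(1)] n unfolding K_def by (intro divide_right_mono) auto
  also have "\<dots> = 1 / norm (s - 1) + norm s * K" 
  proof -
    have "norm (s - 1) \<noteq> 0" using n by linarith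
    moreover have "(1 + d * x * K) / d = 1 / d + x * K" if "d \<noteq> 0" for d x :: real
      using that by (simp add: field_simps)
    ultimately show ?thesis by blast
  qed
  also have "\<dots> \<le> norm s + norm s * K"
  proof -
    have "1 / norm (s - 1) \<le> 1" using n by (subst divide_le_eq_1_pos) linarith+
    then show ?thesis using n by linarith
  qed
  finally show "norm (zeta s) \<le> (1 + K) * norm s" by (simp add: algebra_simps)
qed

lemma zeta_eq_euler_tail:
  assumes "0 < Re s" "Re s < 1" "Re s + k > 1"
  shows "(1 - 2 powr (1 - s)) * zeta s = euler_tail k 1 s"
proof -
  have s: "s \<noteq> 1" using assms by auto
  have "(s - 1) * ((1 - 2 powr (1 - s)) * zeta s) = (1 - 2 powr (1 - s)) * zeta_reg s"
    using zeta_eq_zeta_reg[OF assms(1) s] s by simp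
  also have "\<dots> = (s - 1) * euler_tail k 1 s"
    using zeta_reg_eq_euler_tail[of s] euler_tail_eq[of s k 1 1] assms by simp
  finally show ?thesis using s by simp
qed

subsection \<open>Euler product\<close>

lemma norm_of_nat_powr: "n > 0 \<Longrightarrow> norm (complex_of_nat n powr s) = real n powr Re s"
  using norm_of_real_powr[of "real n" s] by simp

lemma of_nat_mult_powr: "complex_of_nat (m * n) powr s = of_nat m powr s * of_nat n powr s"
  using powr_times_real[of "of_nat m" "of_nat n" s] by simp

lemma summable_of_nat_powr:
  assumes "Re s > 1"
  shows "summable (\<lambda>n. norm (complex_of_nat n powr (- s)))"
proof -
  have "summable (\<lambda>n. norm (complex_of_nat (Suc n) powr (- s)))"
    using summable_zeta_series[OF assms] by simp
  then show ?thesis by (subst (asm) summable_Suc_iff)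
qed

text \<open>One prime at a time: multiplication by the new prime \<open>p\<close> maps the set of
  survivors onto those of its elements divisible by \<open>p\<close>, because primes in
  \<open>F\<close> differ from \<open>p\<close>. Discarding these multiplies the sum by
  \<open>1 - p powr (- s)\<close>.\<close>

lemma infsum_sieve:
  assumes s: "Re s > 1" and "finite F" "\<And>p. p \<in> F \<Longrightarrow> prime p"
  shows "infsum (\<lambda>n. complex_of_nat n powr (- s)) {n. n > 0 \<and> (\<forall>p\<in>F. \<not> p dvd n)} =
           (\<Prod>p\<in>F. 1 - of_nat p powr (- s)) * zeta s"
  using assms(2,3)
proof (induction F rule: finite_induct)
  case empty
  let ?f = "\<lambda>n. complex_of_nat n powr (- s)"
  have sm: "?f summable_on UNIV" by (rule norm_summable_imp_summable_on[OF summable_of_nat_powr[OF s]])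
  have "infsum ?f {n. n > 0} = infsum ?f UNIV" by (rule infsum_cong_neutral) auto
  also have "\<dots> = suminf ?f" using has_sum_imp_sums[OF has_sum_infsum[OF sm]] by (simp add: sums_iff)
  also have "\<dots> = (\<Sum>n. ?f (Suc n))"
    using suminf_split_head[OF summable_norm_cancel[OF summable_of_nat_powr[OF s]]] by simp
  finally show ?case using zeta_eq_series[OF s] by simp
next
  case (insert p F)
  let ?f = "\<lambda>n. complex_of_nat n powr (- s)"
  define A where "A = {n. n > 0 \<and> (\<forall>p\<in>F. \<not> p dvd n)}"
  define A' where "A' = {n. n > 0 \<and> (\<forall>q\<in>insert p F. \<not> q dvd n)}"
  have p: "prime p" "p > 0" using insert prime_gt_0_nat by auto
  have sm: "?f summable_on X" for X
    using norm_summable_imp_summable_on[OF summable_of_nat_powr[OF s]] summable_on_subset_banach by blast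
  have un: "A = A' \<union> (\<lambda>n. p * n) ` A"
  proof (intro equalityI subsetI)
    fix n assume n: "n \<in> A"
    show "n \<in> A' \<union> (\<lambda>n. p * n) ` A"
    proof (cases "p dvd n")
      case True
      then obtain m where "n = p * m" by (elim dvdE)
      moreover from this have "m \<in> A" using n by (auto simp: A_def)
      ultimately show ?thesis by blast
    qed (use n in \<open>auto simp: A_def A'_def\<close>)
  next
    fix n assume "n \<in> A' \<union> (\<lambda>n. p * n) ` A"
    moreover have "p * m \<in> A" if m: "m \<in> A" for m
    proof -
      have "\<not> q dvd p * m" if "q \<in> F" for q
      proof
        assume "q dvd p * m"
        moreover have q: "prime q" "q \<noteq> p" using insert that by auto
        ultimately have "q dvd p" using m that by (auto simp: A_def prime_dvd_mult_iff)
        then show False using q p primes_dvd_imp_eq by blast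
      qed
      then show ?thesis using m p by (auto simp: A_def)
    qed
    ultimately show "n \<in> A" by (auto simp: A_def A'_def)
  qed
  have "infsum ?f A = infsum ?f A' + infsum ?f ((\<lambda>n. p * n) ` A)"
    by (subst un, rule infsum_Un_disjoint[OF sm sm]) (auto simp: A'_def)
  also have "infsum ?f ((\<lambda>n. p * n) ` A) = infsum (?f \<circ> (\<lambda>n. p * n)) A"
    using p by (intro infsum_reindex) (auto simp: inj_on_def)
  also have "\<dots> = infsum (\<lambda>n. of_nat p powr (- s) * ?f n) A"
    by (simp only: o_def of_nat_mult_powr)
  also have "\<dots> = of_nat p powr (- s) * infsum ?f A" by (rule infsum_cmult_right')
  finally have "infsum ?f A' = (1 - of_nat p powr (- s)) * infsum ?f A" by (simp add: algebra_simps)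
  also have "infsum ?f A = (\<Prod>p\<in>F. 1 - of_nat p powr (- s)) * zeta s"
    unfolding A_def using insert by auto
  finally show ?case using insert unfolding A'_def by (simp add: mult.assoc)
qed

text \<open>After sieving by all primes up to \<open>N\<close>, every survivor other than 1 exceeds
  \<open>N\<close>, so the product differs from 1 by at most a tail of an absolutely convergent
  series.\<close>

lemma euler_product_zeta:
  assumes s: "Re s > 1"
  shows "(\<lambda>N. (\<Prod>p | prime p \<and> p \<le> N. 1 - complex_of_nat p powr (- s)) * zeta s) \<longlonglongrightarrow> 1"
proof -
  let ?f = "\<lambda>n. complex_of_nat n powr (- s)"
  let ?g = "\<lambda>n. norm (?f n)"
  define A where "A N = {n. n > 0 \<and> (\<forall>p\<in>{p. prime p \<and> p \<le> N}. \<not> p dvd n)}" for N :: nat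
  have sm: "?f summable_on X" for X
    using norm_summable_imp_summable_on[OF summable_of_nat_powr[OF s]] summable_on_subset_banach by blast
  have smg: "?g summable_on X" for X
    using norm_summable_imp_summable_on[of ?g] summable_of_nat_powr[OF s] summable_on_subset_banach by force
  have 1: "1 \<in> A N" for N by (auto simp: A_def)
  have 2: "A N - {1} \<subseteq> {N<..}" for N
  proof
    fix n assume n: "n \<in> A N - {1}"
    then obtain p where "prime p" "p dvd n" using prime_factor_nat[of n] by auto
    then show "n \<in> {N<..}" using n dvd_imp_le[of p n] by (force simp: A_def)
  qed
  have b: "norm (infsum ?f (A N) - 1) \<le> infsum ?g UNIV - sum ?g {..N}" for N
  proof -
    have "infsum ?f (A N) - 1 = infsum ?f (A N) - infsum ?f {1}" by simp
    also have "\<dots> = infsum ?f (A N - {1})"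
      using infsum_Diff[OF sm sm, of "{1}" "A N"] 1 by simp
    finally have "norm (infsum ?f (A N) - 1) \<le> infsum ?g (A N - {1})"
      using norm_infsum_bound[of ?f "A N - {1}"] smg by simp
    also have "\<dots> \<le> infsum ?g {N<..}"
      by (rule infsum_mono2[OF smg smg 2]) auto
    also have "{N<..} = UNIV - {..N}" by auto
    also have "infsum ?g (UNIV - {..N}) = infsum ?g UNIV - infsum ?g {..N}"
      by (rule infsum_Diff[OF smg smg]) auto
    finally show ?thesis by simp
  qed
  have "?g sums infsum ?g UNIV" using has_sum_imp_sums[OF has_sum_infsum[OF smg]] .
  then have "(\<lambda>N. sum ?g {..N}) \<longlonglongrightarrow> infsum ?g UNIV" by (simp add: sums_def_le)
  then have "(\<lambda>N. infsum ?g UNIV - sum ?g {..N}) \<longlonglongrightarrow> 0" by (auto intro!: tendsto_eq_intros)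
  then have "(\<lambda>N. infsum ?f (A N) - 1) \<longlonglongrightarrow> 0"
    by (rule Lim_null_comparison[rotated]) (use b in auto)
  moreover have "infsum ?f (A N) = (\<Prod>p | prime p \<and> p \<le> N. 1 - complex_of_nat p powr (- s)) * zeta s" for N
    unfolding A_def by (rule infsum_sieve[OF s]) auto
  ultimately show ?thesis using Lim_null by force
qed

section \<open>The logarithm of zeta as a series over primes, and partial sums of its
  inverse\<close>

definition log_zeta_series :: "complex \<Rightarrow> complex" where
  "log_zeta_series s = (\<Sum>n. if prime n then - Ln (1 - of_nat n powr (- s)) else 0)"

definition prime_zeta :: "complex \<Rightarrow> complex" where
  "prime_zeta s = (\<Sum>n. if prime n then of_nat n powr (- s) else 0)"

text \<open>The contribution of squares and higher powers of primes. It converges for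
  \<open>Re s > 1/2\<close>, so it can be subtracted from any continuation of
  \<open>log zeta\<close> to the line \<open>Re s = \<sigma>\<close> at a bounded cost.\<close>

definition log_zeta_rest :: "complex \<Rightarrow> complex" where
  "log_zeta_rest s = (\<Sum>n. if prime n then - Ln (1 - of_nat n powr (- s)) - of_nat n powr (- s) else 0)"

lemma norm_prime_powr_le:
  assumes "prime p" "Re s \<ge> a" "a \<ge> 0"
  shows "norm (complex_of_nat p powr (- s)) \<le> 2 powr (- a)"
proof -
  have p: "p \<ge> 2" using assms prime_ge_2_nat by auto
  have "norm (complex_of_nat p powr (- s)) = real p powr (- Re s)" using p by (subst norm_of_nat_powr) auto
  also have "\<dots> \<le> real p powr (- a)" using p assms by (intro powr_mono) auto
  also have "\<dots> \<le> 2 powr (- a)" using p assms by (intro powr_mono2') auto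
  finally show ?thesis .
qed

lemma norm_Ln_prime_le:
  assumes "prime p" "Re s > 1"
  shows "norm (Ln (1 - complex_of_nat p powr (- s))) \<le> 2 * real p powr (- Re s)"
proof -
  have p: "p \<ge> 2" using assms prime_ge_2_nat by auto
  have "norm (complex_of_nat p powr (- s)) \<le> 2 powr (- Re s)"
    using assms by (intro norm_prime_powr_le) auto
  also have "\<dots> < 2 powr (-1)" using assms by (intro powr_less_mono) auto
  finally have "norm (- (complex_of_nat p powr (- s))) < 1/2" by (simp add: powr_minus)
  from norm_Ln_le[OF this] show ?thesis using p by (simp add: norm_of_nat_powr)
qed

lemma norm_Ln_rest_le:
  assumes "prime p" "Re s > 1/2"
  shows "norm (- Ln (1 - complex_of_nat p powr (- s)) - of_nat p powr (- s)) \<le> 4 * real p powr (- (2 * Re s))"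
proof -
  have p: "p \<ge> 2" using assms prime_ge_2_nat by auto
  define z where "z = - (complex_of_nat p powr (- s))"
  have "norm z \<le> 2 powr (- (1/2))"
    unfolding z_def norm_minus_cancel using assms by (intro norm_prime_powr_le) auto
  also have "\<dots> = 1 / sqrt 2" using powr_minus_divide[of "2::real" "1/2"] powr_half_sqrt[of 2] by (simp del: powr_half_sqrt)
  \<comment> \<open>The value 3/4 makes the factor \<open>1 / (1 - norm z)\<close> at most
    4.\<close>
  also have "\<dots> \<le> 3 / 4"
  proof -
    have "4 / 3 \<le> sqrt 2" by (rule real_le_rsqrt) (simp add: power2_eq_square)
    then show ?thesis by (simp add: field_simps)
  qed
  finally have z: "norm z \<le> 3/4" .
  have "norm (- Ln (1 - complex_of_nat p powr (- s)) - of_nat p powr (- s)) = norm (Ln (1 + z) - z)"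
    unfolding z_def by (subst norm_minus_cancel[symmetric]) simp
  also have "\<dots> \<le> norm z ^ 2 / (1 - norm z)" using z by (intro Ln_approx_linear) auto
  also have "\<dots> \<le> norm z ^ 2 / (1/4)" using z by (intro divide_left_mono) auto
  also have "norm z = real p powr (- Re s)" using p by (simp add: z_def norm_of_nat_powr)
  also have "(real p powr (- Re s)) ^ 2 = real p powr (- (2 * Re s))"
    using p by (simp add: powr_power)
  finally show ?thesis by simp
qed

lemma summable_nat_powr: "a > 1 \<Longrightarrow> summable (\<lambda>n. real n powr (- a))"
  by (subst summable_real_powr_iff) auto

lemma summable_log_zeta_series:
  assumes "Re s > 1"
  shows "summable (\<lambda>n. norm (if prime n then - Ln (1 - of_nat n powr (- s)) else 0))"
proof (rule summable_comparison_test)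
  show "summable (\<lambda>n. 2 * real n powr (- Re s))" using assms by (intro summable_mult summable_nat_powr)
qed (use norm_Ln_prime_le assms in auto)

lemma summable_prime_zeta:
  assumes "Re s > 1"
  shows "summable (\<lambda>n. norm (if prime n then of_nat n powr (- s) else 0 :: complex))"
proof (rule summable_comparison_test)
  show "summable (\<lambda>n. norm (complex_of_nat n powr (- s)))" by (rule summable_of_nat_powr[OF assms])
qed auto

lemma log_zeta_series_eq:
  assumes "Re s > 1"
  shows "log_zeta_series s = prime_zeta s + log_zeta_rest s"
proof -
  let ?l = "\<lambda>n. if prime n then - Ln (1 - of_nat n powr (- s)) else 0"
  let ?p = "\<lambda>n. if prime n then of_nat n powr (- s) else 0 :: complex"
  have "suminf ?l - suminf ?p = (\<Sum>n. ?l n - ?p n)"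
    by (rule suminf_diff; rule summable_norm_cancel)
       (rule summable_log_zeta_series[OF assms] summable_prime_zeta[OF assms])+
  also have "(\<lambda>n. ?l n - ?p n) = (\<lambda>n. if prime n then - Ln (1 - of_nat n powr (- s)) - of_nat n powr (- s) else 0)"
    by auto
  finally have "log_zeta_series s - prime_zeta s = log_zeta_rest s"
    unfolding log_zeta_series_def log_zeta_rest_def prime_zeta_def .
  then show ?thesis by (simp add: algebra_simps)
qed

text \<open>Exponentiating partial sums gives the inverses of the finite products in
  \<open>euler_product_zeta\<close>, so no branch of the logarithm has to be followed.\<close>

lemma exp_log_zeta_series:
  assumes s: "Re s > 1"
  shows "exp (log_zeta_series s) = zeta s"
proof -
  let ?l = "\<lambda>n. if prime n then - Ln (1 - of_nat n powr (- s)) else 0"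
  have "?l sums log_zeta_series s"
    unfolding log_zeta_series_def
    by (rule summable_sums, rule summable_norm_cancel, rule summable_log_zeta_series[OF s])
  then have "(\<lambda>N. sum ?l {..N}) \<longlonglongrightarrow> log_zeta_series s" by (simp add: sums_def_le)
  then have "(\<lambda>N. exp (- sum ?l {..N})) \<longlonglongrightarrow> exp (- log_zeta_series s)" by (intro tendsto_intros)
  moreover have "exp (- sum ?l {..N}) = (\<Prod>p | prime p \<and> p \<le> N. 1 - complex_of_nat p powr (- s))" for N
  proof -
    have "- sum ?l {..N} = (\<Sum>p | prime p \<and> p \<le> N. Ln (1 - complex_of_nat p powr (- s)))"
      unfolding sum_negf[symmetric] by (rule sum.mono_neutral_cong_right) auto
    then have "exp (- sum ?l {..N}) = (\<Prod>p | prime p \<and> p \<le> N. exp (Ln (1 - complex_of_nat p powr (- s))))"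
      by (simp add: exp_sum)
    also have "\<dots> = (\<Prod>p | prime p \<and> p \<le> N. 1 - complex_of_nat p powr (- s))"
    proof (rule prod.cong)
      fix p assume p: "p \<in> {p. prime p \<and> p \<le> N}"
      have "norm (complex_of_nat p powr (- s)) \<le> 2 powr (-1)"
        using p s by (intro norm_prime_powr_le) auto
      then have "norm (complex_of_nat p powr (- s)) < 1" by (simp add: powr_minus)
      then have "1 - complex_of_nat p powr (- s) \<noteq> 0" by (metis eq_iff_diff_eq_0 less_irrefl norm_one)
      then show "exp (Ln (1 - complex_of_nat p powr (- s))) = 1 - complex_of_nat p powr (- s)" by simp
    qed simp
    finally show ?thesis .
  qed
  ultimately have "(\<lambda>N. (\<Prod>p | prime p \<and> p \<le> N. 1 - complex_of_nat p powr (- s)) * zeta s) \<longlonglongrightarrow> exp (- log_zeta_series s) * zeta s"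
    by (auto intro!: tendsto_intros)
  with euler_product_zeta[OF s] have "exp (- log_zeta_series s) * zeta s = 1"
    using LIMSEQ_unique by blast
  then show ?thesis by (simp add: exp_minus field_simps)
qed

lemma zeta_nonzero: "Re s > 1 \<Longrightarrow> zeta s \<noteq> 0"
  using exp_log_zeta_series[of s] by (metis exp_not_eq_zero)

lemma norm_log_zeta_rest_le:
  assumes "a > 1/2" "Re s \<ge> a"
  shows "norm (log_zeta_rest s) \<le> 4 * (\<Sum>n. real n powr (- (2 * a)))"
proof -
  let ?h = "\<lambda>n. if prime n then - Ln (1 - of_nat n powr (- s)) - of_nat n powr (- s) else 0"
  have sm: "summable (\<lambda>n. 4 * real n powr (- (2 * a)))"
    using assms by (intro summable_mult summable_nat_powr) auto
  have b: "norm (?h n) \<le> 4 * real n powr (- (2 * a))" for n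
  proof (cases "prime n")
    case True
    have "real n powr (- (2 * Re s)) \<le> real n powr (- (2 * a))"
      using True prime_ge_1_nat[of n] assms by (intro powr_mono) auto
    then show ?thesis using norm_Ln_rest_le[OF True, of s] True assms by simp
  qed simp
  have "summable (\<lambda>n. norm (?h n))"
    using b by (intro summable_comparison_test[OF _ sm]) auto
  then have "norm (suminf ?h) \<le> (\<Sum>n. norm (?h n))" by (rule summable_norm)
  also have "\<dots> \<le> (\<Sum>n. 4 * real n powr (- (2 * a)))"
    by (rule suminf_le[OF b _ sm]) fact
  also have "\<dots> = 4 * (\<Sum>n. real n powr (- (2 * a)))"
    by (intro suminf_mult summable_nat_powr) (use assms in auto)
  finally show ?thesis by (simp add: log_zeta_rest_def)
qed

lemma prime_euler_factor_notin_nonpos_Reals: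
  assumes "prime n" "Re s > 0"
  shows "1 - complex_of_nat n powr (- s) \<notin> \<real>\<^sub>\<le>\<^sub>0"
proof -
  have "norm (complex_of_nat n powr (- s)) \<le> 2 powr (- Re s)"
    using assms by (intro norm_prime_powr_le) auto
  also have "\<dots> < 2 powr 0" using assms by (intro powr_less_mono) auto
  finally have "Re (complex_of_nat n powr (- s)) < 1"
    using complex_Re_le_cmod[of "complex_of_nat n powr (- s)"] by simp
  then show ?thesis by (auto simp: complex_nonpos_Reals_iff)
qed

lemma log_zeta_rest_holomorphic: "log_zeta_rest holomorphic_on {s. Re s > 1/2}"
proof -
  let ?h = "\<lambda>n s. if prime n then - Ln (1 - of_nat n powr (- s)) - of_nat n powr (- s) else 0"
  have "(\<lambda>s. \<Sum>n. ?h n s) holomorphic_on {s. Re s > 1/2}"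
  proof (rule holomorphic_on_suminf_halfplane)
    show "?h n holomorphic_on {s. Re s > 1/2}" for n
      using prime_euler_factor_notin_nonpos_Reals[of n] by (cases "prime n") (auto intro!: holomorphic_intros)
    fix b R :: real assume b: "b > 1/2"
    have "norm (?h n y) \<le> 4 * real n powr (- (2 * b))" if y: "Re y \<ge> b" for y n
    proof (cases "prime n")
      case True
      have "real n powr (- (2 * Re y)) \<le> real n powr (- (2 * b))"
        using True prime_ge_1_nat[of n] y by (intro powr_mono) auto
      then show ?thesis using norm_Ln_rest_le[OF True, of y] True y b by simp
    qed simp
    moreover have "summable (\<lambda>n. 4 * real n powr (- (2 * b)))"
      using b by (intro summable_mult summable_nat_powr) auto
    ultimately show "\<exists>M. summable M \<and> (\<forall>n y. Re y \<ge> b \<longrightarrow> norm y \<le> R \<longrightarrow> norm (?h n y) \<le> M n)"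
      by blast
  qed
  then show ?thesis unfolding log_zeta_rest_def .
qed

text \<open>The factor \<open>2 powr (2 - Re s)\<close> provides the limit 0 at infinity that
  normalizes the branch; on \<open>Re s = 2\<close> it equals 1.\<close>

lemma norm_log_zeta_series_le:
  assumes "Re s \<ge> 2"
  shows "norm (log_zeta_series s) \<le> 2 powr (2 - Re s) * (2 * (\<Sum>n. real n powr (- 2)))"
proof -
  let ?l = "\<lambda>n. if prime n then - Ln (1 - of_nat n powr (- s)) else 0"
  have sm: "summable (\<lambda>n. 2 powr (2 - Re s) * (2 * real n powr (- 2)))"
    by (intro summable_mult summable_nat_powr) auto
  have b: "norm (?l n) \<le> 2 powr (2 - Re s) * (2 * real n powr (- 2))" for n
  proof (cases "prime n")
    case True
    have n: "real n \<ge> 2" using prime_ge_2_nat[OF True] by simp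
    have "real n powr (- Re s) = real n powr (2 - Re s) * real n powr (-2)"
      using n by (simp add: powr_add[symmetric])
    also have "\<dots> \<le> 2 powr (2 - Re s) * real n powr (-2)"
      using n assms by (intro mult_right_mono powr_mono2') auto
    finally show ?thesis using norm_Ln_prime_le[OF True, of s] True assms by simp
  qed simp
  have s: "Re s > 1" using assms by simp
  have "norm (suminf ?l) \<le> (\<Sum>n. norm (?l n))" by (rule summable_norm) (rule summable_log_zeta_series[OF s])
  also have "\<dots> \<le> (\<Sum>n. 2 powr (2 - Re s) * (2 * real n powr (- 2)))"
    by (rule suminf_le[OF b _ sm]) (rule summable_log_zeta_series[OF s])
  also have "\<dots> = 2 powr (2 - Re s) * (2 * (\<Sum>n. real n powr (- 2)))"
    by (subst suminf_mult, (intro summable_mult summable_nat_powr)?, simp, subst suminf_mult, (intro summable_nat_powr)?, auto)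
  finally show ?thesis by (simp add: log_zeta_series_def)
qed

text \<open>The condition on the prime factorization says that \<open>n\<close> is squarefree.\<close>

definition moebius :: "nat \<Rightarrow> complex" where
  "moebius n = (if n > 0 \<and> prime_factorization n = mset_set (prime_factors n) then (-1) ^ card (prime_factors n) else 0)"

lemma norm_moebius_le: "norm (moebius n) \<le> 1"
  by (simp add: moebius_def norm_power)

lemma of_nat_prod_powr: "finite S \<Longrightarrow> complex_of_nat (\<Prod>S) powr s = (\<Prod>p\<in>S. of_nat p powr s)"
proof (induction S rule: finite_induct)
  case (insert x F)
  then show ?case using of_nat_mult_powr[of x "\<Prod>F" s] by simp
qed simp

lemma prime_factorization_prod_primes:
  fixes S :: "nat set"
  assumes "finite S" "\<And>p. p \<in> S \<Longrightarrow> prime p"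
  shows "prime_factorization (\<Prod>S) = mset_set S" "prime_factors (\<Prod>S) = S"
proof -
  have "prime_factorization (prod_mset (mset_set S)) = mset_set S"
    by (rule prime_factorization_prod_mset_primes) (use assms in auto)
  then show "prime_factorization (\<Prod>S) = mset_set S" by (simp add: prod_unfold_prod_mset)
  then show "prime_factors (\<Prod>S) = S" using assms by simp
qed

lemma sum_inverse_square_le:
  assumes "Z \<ge> (1::nat)"
  shows "(\<Sum>n=Suc Z..K. 1 / real n ^ 2) \<le> 1 / Z"
proof -
  have "K \<ge> Z \<Longrightarrow> (\<Sum>n=Suc Z..K. 1 / real n ^ 2) \<le> 1 / Z - 1 / K"
  proof (induction K rule: dec_induct)
    case (step K)
    have K: "real K > 0" using step assms by simp
    have "1 / real (Suc K) ^ 2 \<le> 1 / K - 1 / Suc K"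
    proof -
      have "1 / real (Suc K) ^ 2 \<le> 1 / (real K * real (Suc K))"
        using K by (intro divide_left_mono) (auto simp: power2_eq_square intro!: mult_right_mono)
      also have "\<dots> = 1 / K - 1 / Suc K" using K by (simp add: field_simps)
      finally show ?thesis .
    qed
    then show ?case using step by (simp add: sum.nat_ivl_Suc')
  qed simp
  moreover have "1 / real K \<ge> 0" by simp
  ultimately show ?thesis by (cases "K \<ge> Z") (auto intro: order_trans)
qed

text \<open>Expanding the product over primes up to \<open>N\<close> gives the Moebius sum over the
  squarefree integers composed of such primes. For \<open>N \<ge> Z\<close> these include every
  squarefree \<open>n \<le> Z\<close>; the others exceed \<open>Z\<close> and contribute at most a
  tail of the inverse squares.\<close>

lemma moebius_sum_approx:
  assumes s: "Re s = 2" and Z: "Z \<ge> 1"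
  shows "norm ((\<Sum>n=1..Z. moebius n * of_nat n powr (- s)) - 1 / zeta s) \<le> 1 / Z"
proof -
  let ?f = "\<lambda>n. moebius n * complex_of_nat n powr (- s)"
  define P where "P N = {p::nat. prime p \<and> p \<le> N}" for N
  define E where "E N = (\<Prod>p\<in>P N. 1 - complex_of_nat p powr (- s))" for N
  have fin: "finite (P N)" for N by (simp add: P_def)
  have s1: "Re s > 1" using s by simp
  have lim: "E \<longlonglongrightarrow> 1 / zeta s"
  proof -
    have "(\<lambda>N. E N * zeta s / zeta s) \<longlonglongrightarrow> 1 / zeta s"
      using euler_product_zeta[OF s1] zeta_nonzero[OF s1] unfolding E_def P_def by (intro tendsto_intros)
    then show ?thesis using zeta_nonzero[OF s1] by simp
  qed
  have bound: "norm ((\<Sum>n=1..Z. ?f n) - E N) \<le> 1 / Z" if N: "N \<ge> Z" for N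
  proof -
    define B where "B = Prod ` Pow (P N)"
    have prS: "prime_factorization (\<Prod>S) = mset_set S" "prime_factors (\<Prod>S) = S" if "S \<in> Pow (P N)" for S
      using that fin by (auto intro!: prime_factorization_prod_primes intro: finite_subset simp: P_def)
    have inj: "inj_on Prod (Pow (P N))" by (rule inj_onI) (metis prS(2))
    have pos: "\<Prod>S > 0" if "S \<in> Pow (P N)" for S
      using that by (intro prod_pos) (auto simp: P_def prime_gt_0_nat)
    have "E N = (\<Prod>p\<in>P N. - (complex_of_nat p powr (- s)) + 1)" by (simp add: E_def)
    also have "\<dots> = (\<Sum>S\<in>Pow (P N). (\<Prod>p\<in>S. - (complex_of_nat p powr (- s))) * (\<Prod>p\<in>P N - S. 1))"
      by (rule prod_add[OF fin])
    also have "\<dots> = (\<Sum>S\<in>Pow (P N). ?f (\<Prod>S))"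
    proof (rule sum.cong)
      fix S assume S: "S \<in> Pow (P N)"
      have "finite S" using S fin finite_subset by auto
      then have "(\<Prod>p\<in>S. - (complex_of_nat p powr (- s))) = (-1) ^ card S * of_nat (\<Prod>S) powr (- s)"
        by (simp only: of_nat_prod_powr prod_uminus)
      moreover have "moebius (\<Prod>S) = (-1) ^ card S"
        using prS[OF S] pos[OF S] by (simp add: moebius_def)
      ultimately show "(\<Prod>p\<in>S. - (complex_of_nat p powr (- s))) * (\<Prod>p\<in>P N - S. 1) = ?f (\<Prod>S)" by simp
    qed simp
    also have "\<dots> = sum ?f B" unfolding B_def by (subst sum.reindex[OF inj]) (simp add: o_def)
    finally have E: "E N = sum ?f B" .
    have finB: "finite B" unfolding B_def using fin by auto
    have sub: "sum ?f {1..Z} = sum ?f (B \<inter> {1..Z})"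
    proof (rule sum.mono_neutral_right)
      show "\<forall>n\<in>{1..Z} - B \<inter> {1..Z}. ?f n = 0"
      proof (rule ballI, rule ccontr)
        fix n assume n: "n \<in> {1..Z} - B \<inter> {1..Z}" and "?f n \<noteq> 0"
        then have q: "prime_factorization n = mset_set (prime_factors n)" "n > 0"
          by (auto simp: moebius_def split: if_splits)
        have "prime_factors n \<in> Pow (P N)"
          using n N q by (auto simp: P_def in_prime_factors_iff dest!: dvd_imp_le)
        moreover have "n = \<Prod>(prime_factors n)"
          using q prod_mset_prime_factorization_nat[of n] by (simp add: prod_unfold_prod_mset)
        ultimately have "n \<in> B" unfolding B_def by (metis image_eqI)
        then show False using n by auto
      qed
    qed auto
    have "E N - sum ?f {1..Z} = sum ?f (B - {1..Z})"
      unfolding E sub using sum.Int_Diff[OF finB, of ?f "{1..Z}"] by simp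
    then have "norm (sum ?f {1..Z} - E N) = norm (sum ?f (B - {1..Z}))" by (metis norm_minus_commute)
    also have "\<dots> \<le> (\<Sum>n\<in>B - {1..Z}. 1 / real n ^ 2)"
    proof (rule sum_norm_le)
      fix n assume n: "n \<in> B - {1..Z}"
      then have "n > 0" using pos by (auto simp: B_def)
      then have "norm (complex_of_nat n powr (- s)) = 1 / real n ^ 2"
        using s powr_minus[of "real n" 2] by (subst norm_of_nat_powr) (auto simp: powr_numeral divide_inverse)
      then show "norm (?f n) \<le> 1 / real n ^ 2"
        using norm_moebius_le[of n] by (simp add: norm_mult divide_right_mono)
    qed
    also have "\<dots> \<le> (\<Sum>n=Suc Z..Max B. 1 / real n ^ 2)"
    proof (rule sum_mono2)
      show "B - {1..Z} \<subseteq> {Suc Z..Max B}"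
      proof
        fix n assume n: "n \<in> B - {1..Z}"
        then have "n > 0" "n \<le> Max B" using pos finB by (auto simp: B_def)
        then show "n \<in> {Suc Z..Max B}" using n by auto
      qed
    qed auto
    also have "\<dots> \<le> 1 / Z" by (rule sum_inverse_square_le[OF Z])
    finally show ?thesis .
  qed
  have "(\<lambda>N. norm ((\<Sum>n=1..Z. ?f n) - E N)) \<longlonglongrightarrow> norm ((\<Sum>n=1..Z. ?f n) - 1 / zeta s)"
    by (intro tendsto_intros lim)
  then show ?thesis
    by (rule tendsto_upperbound) (use bound in \<open>auto intro: eventually_sequentiallyI\<close>)
qed

subsection \<open>The branch of log zeta\<close>

text \<open>The values are integer multiples of \<open>2 * pi * \<i>\<close>, and distinct ones are
  at least \<open>2 * pi\<close> apart.\<close>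

lemma exp_eq_1_imp_constant_on:
  fixes f :: "'a::topological_space \<Rightarrow> complex"
  assumes "connected S" "continuous_on S f" "\<And>x. x \<in> S \<Longrightarrow> exp (f x) = 1"
  shows "f constant_on S"
proof (rule continuous_discrete_range_constant[OF assms(1,2)])
  fix x assume x: "x \<in> S"
  have "2 * pi \<le> norm (f y - f x)" if "y \<in> S" "f y \<noteq> f x" for y
  proof -
    have "exp (f y - f x) = 1" using assms(3) x that by (simp add: exp_diff)
    then obtain n :: int where n: "Re (f y - f x) = 0" "Im (f y - f x) = of_int (2 * n) * pi"
      by (auto simp: exp_eq_1)
    with that have "n \<noteq> 0" by (auto simp: complex_eq_iff)
    then have "\<bar>real_of_int n\<bar> \<ge> 1" by linarith
    then have "2 * pi \<le> \<bar>Im (f y - f x)\<bar>" unfolding n by (simp add: abs_mult)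
    also have "\<dots> \<le> norm (f y - f x)" by (rule abs_Im_le_cmod)
    finally show ?thesis .
  qed
  then show "\<exists>e>0. \<forall>y. y \<in> S \<and> f y \<noteq> f x \<longrightarrow> e \<le> norm (f y - f x)"
    using pi_gt_zero by (intro exI[of _ "2 * pi"]) auto
qed

lemma log_zeta_eqI:
  assumes "log_zeta_branch s L"
  shows "log_zeta s = L (Re s)"
  unfolding log_zeta_def
proof (rule the_equality)
  show "\<exists>L'. log_zeta_branch s L' \<and> L (Re s) = L' (Re s)" using assms by blast
  fix w assume "\<exists>L'. log_zeta_branch s L' \<and> w = L' (Re s)"
  then obtain L' where L': "log_zeta_branch s L'" "w = L' (Re s)" by blast
  let ?d = "\<lambda>\<alpha>. L' \<alpha> - L \<alpha>"
  have "?d constant_on {Re s..}"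
  proof (rule exp_eq_1_imp_constant_on)
    show "continuous_on {Re s..} ?d"
      using assms L' unfolding log_zeta_branch_def by (intro continuous_intros) auto
    have "exp (L' x) = exp (L x)" if "x \<in> {Re s..}" for x
      using assms L' that unfolding log_zeta_branch_def by simp
    then show "exp (?d x) = 1" if "x \<in> {Re s..}" for x
      using that by (simp add: exp_diff)
  qed (rule connected_Ici)
  then obtain c where c: "\<And>x. x \<ge> Re s \<Longrightarrow> ?d x = c" by (auto simp: constant_on_def)
  have "(?d \<longlongrightarrow> 0 - 0) at_top"
    using assms L' unfolding log_zeta_branch_def by (intro tendsto_diff) auto
  moreover have "eventually (\<lambda>x. ?d x = c) at_top"
    using eventually_ge_at_top[of "Re s"] by eventually_elim (rule c)
  ultimately have "((\<lambda>_::real. c) \<longlongrightarrow> 0) at_top" by (simp add: tendsto_cong)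
  then have "c = 0" by (simp add: tendsto_const_iff)
  then show "w = L (Re s)" using c[of "Re s"] L' by simp
qed

lemma log_zeta_series_holomorphic: "log_zeta_series holomorphic_on {s. Re s > 1}"
proof -
  let ?h = "\<lambda>n s. if prime n then - Ln (1 - of_nat n powr (- s)) else 0"
  have "(\<lambda>s. \<Sum>n. ?h n s) holomorphic_on {s. Re s > 1}"
  proof (rule holomorphic_on_suminf_halfplane)
    show "?h n holomorphic_on {s. Re s > 1}" for n
      using prime_euler_factor_notin_nonpos_Reals[of n] by (cases "prime n") (auto intro!: holomorphic_intros)
    fix b R :: real assume b: "b > 1"
    have "norm (?h n y) \<le> 2 * real n powr (- b)" if y: "Re y \<ge> b" for y n
    proof (cases "prime n")
      case True
      have "real n powr (- Re y) \<le> real n powr (- b)"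
        using True prime_ge_1_nat[of n] y by (intro powr_mono) auto
      then show ?thesis using norm_Ln_prime_le[OF True, of y] True y b by simp
    qed simp
    moreover have "summable (\<lambda>n. 2 * real n powr (- b))"
      using b by (intro summable_mult summable_nat_powr) auto
    ultimately show "\<exists>M. summable M \<and> (\<forall>n y. Re y \<ge> b \<longrightarrow> norm y \<le> R \<longrightarrow> norm (?h n y) \<le> M n)"
      by blast
  qed
  then show ?thesis unfolding log_zeta_series_def .
qed

text \<open>Unbounded to the right so that it contains the whole ray along which the branch is
  continued. For \<open>t \<ge> H\<close> it lies in the upper half-plane, away from the
  pole.\<close>

definition half_strip :: "real \<Rightarrow> real \<Rightarrow> real \<Rightarrow> complex set" where
  "half_strip a t H = {s. a < Re s \<and> \<bar>Im s - t\<bar> < H}"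

lemma half_strip_eq: "half_strip a t H = {s. Re s > a} \<inter> {s. Im s > t - H} \<inter> {s. Im s < t + H}"
  by (auto simp: half_strip_def abs_less_iff)

lemma open_half_strip: "open (half_strip a t H)"
  unfolding half_strip_eq by (intro open_Int open_halfspace_Re_gt open_halfspace_Im_gt open_halfspace_Im_lt)

lemma convex_half_strip: "convex (half_strip a t H)"
  unfolding half_strip_eq by (intro convex_Int convex_halfspace_Re_gt convex_halfspace_Im_gt convex_halfspace_Im_lt)

lemma zeta_holomorphic_half_strip: "t \<ge> H \<Longrightarrow> zeta holomorphic_on half_strip a t H"
  by (rule holomorphic_on_subset[OF zeta_holomorphic]) (auto simp: half_strip_def)

text \<open>Convexity gives a holomorphic logarithm. It can differ from
  \<open>log_zeta_series\<close> by a constant whose exponential is 1; subtracting that constant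
  fixes the normalization.\<close>

lemma zeta_log_exists:
  assumes nz: "\<And>s. s \<in> half_strip a t H \<Longrightarrow> zeta s \<noteq> 0" and "t \<ge> H" "H > 0" "a \<le> 1"
  obtains g where "g holomorphic_on half_strip a t H" "\<And>s. s \<in> half_strip a t H \<Longrightarrow> exp (g s) = zeta s"
    "\<And>s. s \<in> half_strip a t H \<Longrightarrow> Re s > 1 \<Longrightarrow> g s = log_zeta_series s"
proof -
  let ?R = "half_strip a t H"
  let ?l = log_zeta_series
  have "contractible ?R" by (rule convex_imp_contractible[OF convex_half_strip])
  with zeta_holomorphic_half_strip[OF assms(2)] obtain g where
    g: "g holomorphic_on ?R" "\<And>z. z \<in> ?R \<Longrightarrow> zeta z = exp (g z)"
    using contractible_imp_holomorphic_log[of zeta ?R] nz by metis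
  let ?R' = "half_strip 1 t H"
  have sub: "?R' \<subseteq> ?R" using assms by (auto simp: half_strip_def)
  have "(\<lambda>s. g s - ?l s) constant_on ?R'"
  proof (rule exp_eq_1_imp_constant_on)
    show "connected ?R'" by (intro convex_connected convex_half_strip)
    have "?l holomorphic_on ?R'"
      by (rule holomorphic_on_subset[OF log_zeta_series_holomorphic]) (auto simp: half_strip_def)
    then show "continuous_on ?R' (\<lambda>s. g s - ?l s)"
      using g(1) sub by (intro holomorphic_on_imp_continuous_on holomorphic_on_diff) (auto intro: holomorphic_on_subset)
    fix s assume s: "s \<in> ?R'"
    then have "exp (g s) = exp (?l s)" "Re s > 1"
      using g(2)[of s, symmetric] exp_log_zeta_series[of s] sub by (auto simp: half_strip_def)
    then show "exp (g s - ?l s) = 1" by (simp add: exp_diff)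
  qed
  then obtain c where c: "\<And>s. s \<in> ?R' \<Longrightarrow> g s - ?l s = c" unfolding constant_on_def by blast
  have mem: "Complex 2 t \<in> ?R'" using assms by (simp add: half_strip_def)
  have "exp c = exp (g (Complex 2 t)) / exp (?l (Complex 2 t))"
    using c[OF mem] by (metis exp_diff)
  also have "\<dots> = 1" using g(2)[symmetric, of "Complex 2 t"] sub mem exp_log_zeta_series[of "Complex 2 t"] zeta_nonzero[of "Complex 2 t"] by auto
  finally have ec: "exp c = 1" .
  show ?thesis
  proof (rule that[of "\<lambda>s. g s - c"])
    show "(\<lambda>s. g s - c) holomorphic_on ?R" using g by (intro holomorphic_intros)
    show "exp (g s - c) = zeta s" if "s \<in> ?R" for s using g(2)[OF that, symmetric] ec by (simp add: exp_diff)
    show "g s - c = ?l s" if "s \<in> ?R" "Re s > 1" for s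
    proof -
      have "s \<in> ?R'" using that by (simp add: half_strip_def)
      from c[OF this] show ?thesis by (simp add: algebra_simps)
    qed
  qed
qed

lemma log_zeta_eq_holomorphic_log:
  assumes g: "g holomorphic_on half_strip a t H" "\<And>s. s \<in> half_strip a t H \<Longrightarrow> exp (g s) = zeta s"
    "\<And>s. s \<in> half_strip a t H \<Longrightarrow> Re s > 1 \<Longrightarrow> g s = log_zeta_series s"
    and s: "s \<in> half_strip a t H" and "t \<ge> H"
  shows "log_zeta_defined s" "log_zeta s = g s"
proof -
  have mem: "Complex \<alpha> (Im s) \<in> half_strip a t H" if "\<alpha> \<ge> Re s" for \<alpha>
    using s that by (simp add: half_strip_def)
  have "zeta (Complex \<alpha> (Im s)) \<noteq> 0" if "\<alpha> \<ge> Re s" for \<alpha>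
    using g(2)[OF mem[OF that]] by (metis exp_not_eq_zero)
  moreover have "Im s > 0" using s assms by (auto simp: half_strip_def)
  ultimately show "log_zeta_defined s" by (simp add: log_zeta_defined_def)
  have "log_zeta_branch s (\<lambda>\<alpha>. g (Complex \<alpha> (Im s)))"
    unfolding log_zeta_branch_def
  proof (intro conjI allI impI)
    show "continuous_on {Re s..} (\<lambda>\<alpha>. g (Complex \<alpha> (Im s)))"
    proof (rule continuous_on_compose2[OF holomorphic_on_imp_continuous_on[OF g(1)]])
      show "continuous_on {Re s..} (\<lambda>\<alpha>. Complex \<alpha> (Im s))"
        unfolding complex_eq_iff Complex_eq by (intro continuous_intros)
    qed (use mem in auto)
    show "exp (g (Complex \<alpha> (Im s))) = zeta (Complex \<alpha> (Im s))" if "\<alpha> \<ge> Re s" for \<alpha>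
      using g(2)[OF mem[OF that]] .
    show "((\<lambda>\<alpha>. g (Complex \<alpha> (Im s))) \<longlongrightarrow> 0) at_top"
    proof (rule Lim_null_comparison)
      let ?K = "2 * (\<Sum>n. real n powr (- 2))"
      show "\<forall>\<^sub>F \<alpha> in at_top. norm (g (Complex \<alpha> (Im s))) \<le> 2 powr (2 - \<alpha>) * ?K"
        using eventually_ge_at_top[of "max 2 (Re s)"]
      proof eventually_elim
        case (elim \<alpha>)
        then show ?case using g(3)[OF mem[of \<alpha>]] norm_log_zeta_series_le[of "Complex \<alpha> (Im s)"] by simp
      qed
      have "((\<lambda>\<alpha>::real. 2 powr (2 - \<alpha>) * ?K) \<longlongrightarrow> 0 * ?K) at_top"
        by (intro tendsto_mult tendsto_const) real_asymp
      then show "((\<lambda>\<alpha>::real. 2 powr (2 - \<alpha>) * ?K) \<longlongrightarrow> 0) at_top" by simp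
    qed
  qed
  from log_zeta_eqI[OF this] show "log_zeta s = g s" by simp
qed

text \<open>After rescaling to the unit disc and subtracting the central value,
  \<open>w / (2 * B - w)\<close> maps the half-plane \<open>Re w < B\<close> into the unit disc and
  fixes 0. The Schwarz lemma bounds the image, and solving for \<open>w\<close> gives the
  estimate.\<close>

lemma borel_caratheodory:
  assumes hol: "g holomorphic_on ball c r" and re: "\<And>z. z \<in> ball c r \<Longrightarrow> Re (g z) < A"
    and z: "norm (z - c) \<le> \<rho>" "\<rho> < r"
  shows "norm (g z - g c) \<le> 2 * (A - Re (g c)) * \<rho> / (r - \<rho>)"
proof -
  have r: "r > 0" "\<rho> \<ge> 0" using z norm_ge_zero[of "z - c"] by linarith+
  define B where "B = A - Re (g c)"
  have B: "B > 0" using re[of c] r by (simp add: B_def)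
  define w where "w z = g (c + of_real r * z) - g c" for z
  have mem: "c + of_real r * z \<in> ball c r" if "norm z < 1" for z
    using that r by (simp add: dist_norm norm_mult)
  have rew: "Re (w z) < B" if "norm z < 1" for z
    using re[OF mem[OF that]] by (simp add: w_def B_def)
  have nz: "2 * of_real B - w z \<noteq> 0" if "norm z < 1" for z
  proof
    assume "2 * of_real B - w z = 0"
    then have "Re (2 * of_real B - w z) = 0" by simp
    then show False using rew[OF that] B by simp
  qed
  define f where "f z = w z / (2 * of_real B - w z)" for z
  have whol: "w holomorphic_on ball 0 1"
  proof -
    have "(g \<circ> (\<lambda>z. c + of_real r * z)) holomorphic_on ball 0 1"
      by (rule holomorphic_on_compose_gen[OF _ hol]) (use mem in \<open>auto intro!: holomorphic_intros\<close>)
    then show ?thesis unfolding w_def o_def by (intro holomorphic_intros)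
  qed
  have fhol: "f holomorphic_on ball 0 1"
    unfolding f_def using nz by (intro holomorphic_intros whol) auto
  have f0: "f 0 = 0" by (simp add: f_def w_def)
  have lt: "norm (f z) < 1" if "norm z < 1" for z
  proof -
    have "(norm (w z))\<^sup>2 < (norm (2 * of_real B - w z))\<^sup>2"
    proof -
      have "(norm (2 * of_real B - w z))\<^sup>2 - (norm (w z))\<^sup>2 = 4 * B * (B - Re (w z))"
        unfolding cmod_power2 by (simp add: power2_eq_square algebra_simps)
      moreover have "4 * B * (B - Re (w z)) > 0" using B rew[OF that] by simp
      ultimately show ?thesis by linarith
    qed
    then have "norm (w z) < norm (2 * of_real B - w z)" by (rule power2_less_imp_less) simp
    then show ?thesis using nz[OF that] by (simp add: f_def norm_divide)
  qed
  define \<zeta> where "\<zeta> = (z - c) / of_real r"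
  have \<zeta>: "norm \<zeta> \<le> \<rho> / r" "norm \<zeta> < 1"
    using z r by (auto simp: \<zeta>_def norm_divide divide_right_mono)
  have le: "norm (f \<zeta>) \<le> \<rho> / r"
    using Schwarz_Lemma(1)[OF fhol f0 lt \<zeta>(2)] \<zeta>(1) by linarith
  have "\<rho> / r < 1" using z r by simp
  have wz: "w \<zeta> = g z - g c" using r by (simp add: w_def \<zeta>_def)
  have "w \<zeta> * (1 + f \<zeta>) = 2 * of_real B * f \<zeta>"
    using nz[OF \<zeta>(2)] by (simp add: f_def field_simps)
  then have "norm (w \<zeta>) * norm (1 + f \<zeta>) = 2 * B * norm (f \<zeta>)"
    using B by (metis norm_mult norm_of_real abs_of_pos norm_numeral)
  moreover have "norm (1 + f \<zeta>) \<ge> 1 - \<rho> / r"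
    using norm_triangle_ineq2[of 1 "- f \<zeta>"] le by simp
  ultimately have "norm (w \<zeta>) * (1 - \<rho> / r) \<le> 2 * B * (\<rho> / r)"
    using mult_left_mono[of "1 - \<rho> / r" "norm (1 + f \<zeta>)" "norm (w \<zeta>)", OF _ norm_ge_zero]
      mult_left_mono[OF le, of "2 * B"] B by simp
  then have "norm (w \<zeta>) * (1 - \<rho> / r) * r \<le> 2 * B * (\<rho> / r) * r"
    using r by (intro mult_right_mono) auto
  moreover have "norm (w \<zeta>) * (1 - \<rho> / r) * r = norm (w \<zeta>) * (r - \<rho>)" "2 * B * (\<rho> / r) * r = 2 * B * \<rho>"
    using r by (simp_all add: field_simps)
  ultimately have "norm (w \<zeta>) * (r - \<rho>) \<le> 2 * B * \<rho>" by simp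
  then show ?thesis using z by (simp add: wz B_def pos_le_divide_eq)
qed

text \<open>Discs about \<open>2 + \<i> * Im s\<close> with radii \<open>2 - a\<close> and
  \<open>2 - b\<close>: the real part of \<open>g\<close> is the logarithm of
  \<open>norm (zeta s)\<close>, hence at most logarithmic in \<open>t\<close>, and \<open>g\<close>
  is bounded at the centre. The margins \<open>H \<ge> Y + 2\<close> and
  \<open>t \<ge> H + 1\<close> keep the discs inside the strip and away from the real axis.\<close>

lemma log_zeta_growth:
  assumes "1/2 < a" "a < b" "b < 1"
  obtains C where "C > 0" "\<And>g t H Y s. g holomorphic_on half_strip a t H \<Longrightarrow>
     (\<And>s. s \<in> half_strip a t H \<Longrightarrow> exp (g s) = zeta s) \<Longrightarrow>
     (\<And>s. s \<in> half_strip a t H \<Longrightarrow> Re s > 1 \<Longrightarrow> g s = log_zeta_series s) \<Longrightarrow>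
     H \<ge> Y + 2 \<Longrightarrow> Y \<ge> 0 \<Longrightarrow> t \<ge> H + 1 \<Longrightarrow> b \<le> Re s \<Longrightarrow> Re s \<le> 2 \<Longrightarrow> \<bar>Im s - t\<bar> \<le> Y \<Longrightarrow>
     norm (g s) \<le> C * (1 + ln t)"
proof -
  obtain C1 where C1: "C1 > 0" "\<And>s. Re s \<ge> 1/2 \<Longrightarrow> \<bar>Im s\<bar> \<ge> 1 \<Longrightarrow> norm (zeta s) \<le> C1 * norm s"
    using zeta_growth[of "1/2"] by auto
  define K where "K = 2 * (\<Sum>n. real n powr (- 2))"
  have K: "K \<ge> 0" unfolding K_def by (intro mult_nonneg_nonneg suminf_nonneg summable_nat_powr) auto
  define D where "D = 1 + \<bar>ln (6 * C1)\<bar> + K"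
  define C where "C = 2 * D * 2 / (b - a) + K + 1"
  have D: "D > 0" using K by (simp add: D_def)
  have Cp: "C > 0" using D K assms by (simp add: C_def add_nonneg_pos)
  have main: "norm (g s) \<le> C * (1 + ln t)"
    if g: "g holomorphic_on half_strip a t H" "\<And>s. s \<in> half_strip a t H \<Longrightarrow> exp (g s) = zeta s"
     "\<And>s. s \<in> half_strip a t H \<Longrightarrow> Re s > 1 \<Longrightarrow> g s = log_zeta_series s"
     and H: "H \<ge> Y + 2" "Y \<ge> 0" "t \<ge> H + 1" and s: "b \<le> Re s" "Re s \<le> 2" "\<bar>Im s - t\<bar> \<le> Y"
     for g t H Y s
  proof -
    define c where "c = Complex 2 (Im s)"
    define r where "r = 2 - a"
    have t: "t \<ge> 3" using H by linarith
    have lnt: "ln t \<ge> 0" using t by simp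
    have sub: "z \<in> half_strip a t H" "\<bar>Im z\<bar> \<ge> 1" "norm z \<le> 6 * t" if "z \<in> ball c r" for z
    proof -
      have d: "norm (z - c) < r" using that by (simp add: dist_norm norm_minus_commute)
      have "\<bar>Re (z - c)\<bar> < r" "\<bar>Im (z - c)\<bar> < r"
        using d abs_Re_le_cmod[of "z - c"] abs_Im_le_cmod[of "z - c"] by linarith+
      then have "\<bar>Re z - 2\<bar> < 2 - a" "\<bar>Im z - Im s\<bar> < 2 - a" by (simp_all add: c_def r_def)
      then have z: "a < Re z" "Re z < 4 - a" "\<bar>Im z - t\<bar> < Y + (2 - a)" using s by linarith+
      show "z \<in> half_strip a t H" using z H assms by (simp add: half_strip_def)
      show "\<bar>Im z\<bar> \<ge> 1" using z H assms by linarith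
      have "norm z \<le> \<bar>Re z\<bar> + \<bar>Im z\<bar>" by (rule cmod_le)
      also have "\<dots> \<le> 4 + 2 * t" using z H assms by linarith
      finally show "norm z \<le> 6 * t" using t by linarith
    qed
    define A where "A = 1 + ln (6 * C1 * t)"
    have re: "Re (g z) < A" if z: "z \<in> ball c r" for z
    proof -
      have "exp (Re (g z)) = norm (zeta z)" using g(2)[OF sub(1)[OF z]] norm_exp_eq_Re by metis
      also have "\<dots> \<le> C1 * norm z"
        using sub[OF z] assms by (intro C1) (auto simp: half_strip_def)
      also have "\<dots> \<le> C1 * (6 * t)" using sub[OF z] C1 by (intro mult_left_mono) auto
      finally have "Re (g z) \<le> ln (C1 * (6 * t))" using C1 t by (subst ln_ge_iff) auto
      then show ?thesis by (simp add: A_def mult_ac)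
    qed
    have rpos: "r > 0" using assms by (simp add: r_def)
    have cr: "c \<in> ball c r" using rpos by simp
    then have "norm (g c) \<le> K"
      using g(3)[OF sub(1)[of c]] norm_log_zeta_series_le[of c] by (simp add: c_def K_def)
    then have gc: "norm (g c) \<le> K" "- Re (g c) \<le> K" using abs_Re_le_cmod[of "g c"] by linarith+
    have "norm (g s - g c) \<le> 2 * (A - Re (g c)) * (2 - b) / (r - (2 - b))"
    proof (rule borel_caratheodory[OF _ re])
      show "g holomorphic_on ball c r" using g(1) by (rule holomorphic_on_subset) (use sub in auto)
      have "s - c = of_real (Re s - 2)" by (simp add: c_def complex_eq_iff)
      then have "norm (s - c) = \<bar>Re s - 2\<bar>" by (simp only: norm_of_real)
      then show "norm (s - c) \<le> 2 - b" using s by linarith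
      show "2 - b < r" using assms by (simp add: r_def)
    qed
    also have "\<dots> = 2 * (A - Re (g c)) * (2 - b) / (b - a)" by (simp add: r_def)
    also have "\<dots> \<le> 2 * (D * (1 + ln t)) * 2 / (b - a)"
    proof (intro divide_right_mono mult_mono)
      have "A = 1 + ln (6 * C1) + ln t" using C1 t by (simp add: A_def ln_mult)
      then have "A - Re (g c) \<le> D + ln t" using gc by (simp add: D_def)
      also have "\<dots> \<le> D * (1 + ln t)"
        using K lnt mult_right_mono[of 1 D "ln t"] by (simp add: D_def distrib_left)
      finally show "A - Re (g c) \<le> D * (1 + ln t)" .
    qed (use assms D lnt re[OF cr] in auto)
    finally have "norm (g s - g c) \<le> 2 * D * 2 / (b - a) * (1 + ln t)" by (simp add: field_simps)
    moreover have "norm (g s) \<le> norm (g s - g c) + norm (g c)" using norm_triangle_ineq[of "g s - g c" "g c"] by simp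
    moreover have "K \<le> (K + 1) * (1 + ln t)" using K lnt by (simp add: algebra_simps add_nonneg_nonneg)
    ultimately show ?thesis using gc by (simp add: C_def algebra_simps)
  qed
  show ?thesis by (rule that[OF Cp]) (rule main; assumption)
qed

subsection \<open>Gaussian kernels\<close>

text \<open>All contour shifts below compare two vertical lines; each horizontal side costs at most
  \<open>h * (b - a)\<close>.\<close>

lemma rectpath_vertical_sides:
  assumes F: "continuous_on (path_image (rectpath (Complex a c) (Complex b d))) F" and ab: "a < b" and cd: "c < d"
    and bd: "\<And>x y. a \<le> x \<Longrightarrow> x \<le> b \<Longrightarrow> y = c \<or> y = d \<Longrightarrow> norm (F (Complex x y)) \<le> h"
  shows "norm (contour_integral (rectpath (Complex a c) (Complex b d)) F -
      (\<i> * integral {c..d} (\<lambda>y. F (Complex b y)) - \<i> * integral {c..d} (\<lambda>y. F (Complex a y)))) \<le> 2 * h * (b - a)"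
proof -
  let ?R = "rectpath (Complex a c) (Complex b d)"
  let ?l1 = "linepath (Complex a c) (Complex b c)"
  let ?l2 = "linepath (Complex b c) (Complex b d)"
  let ?l3 = "linepath (Complex b d) (Complex a d)"
  let ?l4 = "linepath (Complex a d) (Complex a c)"
  have R: "?R = ?l1 +++ ?l2 +++ ?l3 +++ ?l4" by (simp add: rectpath_def Let_def)
  have pim: "path_image ?R = closed_segment (Complex a c) (Complex b c) \<union> closed_segment (Complex b c) (Complex b d)
      \<union> closed_segment (Complex b d) (Complex a d) \<union> closed_segment (Complex a d) (Complex a c)"
    unfolding R by (simp add: path_image_join Un_assoc)
  have int: "F contour_integrable_on ?l1" "F contour_integrable_on ?l2" "F contour_integrable_on ?l3" "F contour_integrable_on ?l4"
    by (rule contour_integrable_continuous_linepath, rule continuous_on_subset[OF F], unfold pim, blast)+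
  have eq: "contour_integral ?R F = contour_integral ?l1 F + contour_integral ?l2 F + contour_integral ?l3 F + contour_integral ?l4 F"
    unfolding R using int by (simp add: contour_integrable_joinI valid_path_join)
  have 2: "contour_integral ?l2 F = \<i> * integral {c..d} (\<lambda>y. F (Complex b y))"
    by (rule contour_integral_linepath_same_Re) (use cd in auto)
  have "contour_integral (linepath (Complex a c) (Complex a d)) F = \<i> * integral {c..d} (\<lambda>y. F (Complex a y))"
    by (rule contour_integral_linepath_same_Re) (use cd in auto)
  then have 4: "contour_integral ?l4 F = - (\<i> * integral {c..d} (\<lambda>y. F (Complex a y)))"
    using contour_integral_reversepath[of "linepath (Complex a c) (Complex a d)" F] by (simp add: reversepath_linepath)
  have h: "h \<ge> 0" using bd[of a c] ab norm_ge_zero[of "F (Complex a c)"] by linarith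
  have 1: "norm (contour_integral ?l1 F) \<le> h * norm (Complex b c - Complex a c)"
  proof (rule contour_integral_bound_linepath[OF int(1) h])
    fix x assume "x \<in> closed_segment (Complex a c) (Complex b c)"
    then have "Im x = c" "a \<le> Re x" "Re x \<le> b" using ab by (auto simp: closed_segment_same_Im closed_segment_eq_real_ivl)
    then show "norm (F x) \<le> h" using bd[of "Re x" c] by (metis complex_surj)
  qed
  have 3: "norm (contour_integral ?l3 F) \<le> h * norm (Complex a d - Complex b d)"
  proof (rule contour_integral_bound_linepath[OF int(3) h])
    fix x assume "x \<in> closed_segment (Complex b d) (Complex a d)"
    then have "Im x = d" "a \<le> Re x" "Re x \<le> b" using ab by (auto simp: closed_segment_same_Im closed_segment_eq_real_ivl)
    then show "norm (F x) \<le> h" using bd[of "Re x" d] by (metis complex_surj)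
  qed
  have "Complex b c - Complex a c = of_real (b - a)" "Complex a d - Complex b d = of_real (a - b)" by (simp_all add: complex_eq_iff)
  then have "norm (Complex b c - Complex a c) = \<bar>b - a\<bar>" "norm (Complex a d - Complex b d) = \<bar>a - b\<bar>"
    by (metis norm_of_real)+
  then have n: "norm (Complex b c - Complex a c) = b - a" "norm (Complex a d - Complex b d) = b - a"
    using ab by simp_all
  have "contour_integral ?R F - (\<i> * integral {c..d} (\<lambda>y. F (Complex b y)) - \<i> * integral {c..d} (\<lambda>y. F (Complex a y)))
     = contour_integral ?l1 F + contour_integral ?l3 F"
    unfolding eq 2 4 by simp
  also have "norm \<dots> \<le> h * (b - a) + h * (b - a)"
    using norm_triangle_ineq[of "contour_integral ?l1 F" "contour_integral ?l3 F"] 1 3 unfolding n by linarith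
  finally show ?thesis by simp
qed

text \<open>The integral is independent of the abscissa. This is read off from the characteristic
  function of the normal distribution, since the exponent equals
  \<open>c\<^sup>2 / 2 + \<i> * c * u - u\<^sup>2 / 2\<close>.\<close>

lemma gaussian_line_integral:
  fixes c :: real
  shows "integrable lborel (\<lambda>u. exp ((Complex c u)\<^sup>2 / 2))"
    and "(LINT u|lborel. exp ((Complex c u)\<^sup>2 / 2)) = of_real (sqrt (2 * pi))"
proof -
  have d: "std_normal_density u *\<^sub>R iexp (c * u) = of_real (exp (- (c\<^sup>2) / 2) / sqrt (2 * pi)) * exp ((Complex c u)\<^sup>2 / 2)" for u
  proof -
    have "std_normal_density u *\<^sub>R iexp (c * u) = of_real (1 / sqrt (2 * pi)) * (of_real (exp (- (u\<^sup>2) / 2)) * iexp (c * u))"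
      by (simp add: std_normal_density_def scaleR_conv_of_real)
    also have "of_real (exp (- (u\<^sup>2) / 2)) * iexp (c * u) = exp (of_real (- (u\<^sup>2) / 2) + \<i> * of_real (c * u))"
      by (simp only: exp_add exp_of_real)
    also have "of_real (- (u\<^sup>2) / 2) + \<i> * of_real (c * u) = of_real (- (c\<^sup>2) / 2) + (Complex c u)\<^sup>2 / 2"
      by (simp add: complex_eq_iff power2_eq_square field_simps)
    also have "exp \<dots> = of_real (exp (- (c\<^sup>2) / 2)) * exp ((Complex c u)\<^sup>2 / 2)"
      by (simp only: exp_add exp_of_real)
    finally show ?thesis by simp
  qed
  define k where "k = complex_of_real (exp (- (c\<^sup>2) / 2) / sqrt (2 * pi))"
  have k: "k \<noteq> 0" by (simp add: k_def)
  have "integrable std_normal_distribution (\<lambda>u. iexp (c * u))"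
    by (rule finite_measure.integrable_const_bound[of _ _ 1])
       (auto intro!: prob_space.finite_measure prob_space_normal_density)
  then have i: "integrable lborel (\<lambda>u. std_normal_density u *\<^sub>R iexp (c * u))"
    by (subst (asm) integrable_density) auto
  then have "integrable lborel (\<lambda>u. k * exp ((Complex c u)\<^sup>2 / 2))" unfolding d k_def .
  then have "integrable lborel (\<lambda>u. inverse k * (k * exp ((Complex c u)\<^sup>2 / 2)))" by (rule integrable_mult_right)
  then show "integrable lborel (\<lambda>u. exp ((Complex c u)\<^sup>2 / 2))" using k by (simp add: mult.assoc[symmetric])
  have "char std_normal_distribution c = (LINT u|lborel. std_normal_density u *\<^sub>R iexp (c * u))"
    unfolding char_def by (subst integral_density) auto
  then have "complex_of_real (exp (- (c\<^sup>2) / 2)) = (LINT u|lborel. k * exp ((Complex c u)\<^sup>2 / 2))"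
    unfolding char_std_normal_distribution d k_def by simp
  also have "\<dots> = k * (LINT u|lborel. exp ((Complex c u)\<^sup>2 / 2))" by simp
  finally have "(LINT u|lborel. exp ((Complex c u)\<^sup>2 / 2)) = complex_of_real (exp (- (c\<^sup>2) / 2)) / k"
    using k by (simp add: field_simps)
  also have "\<dots> = of_real (sqrt (2 * pi))" by (simp add: k_def)
  finally show "(LINT u|lborel. exp ((Complex c u)\<^sup>2 / 2)) = of_real (sqrt (2 * pi))" .
qed

lemma gaussian_integral_real:
  assumes "a > 0"
  shows "integrable lborel (\<lambda>u::real. exp (- (u\<^sup>2) / (2 * a\<^sup>2)))"
    and "(LINT u|lborel. exp (- (u\<^sup>2) / (2 * a\<^sup>2))) = sqrt (2 * pi) * a"
proof -
  have e: "exp (- (u\<^sup>2) / (2 * a\<^sup>2)) = sqrt (2 * pi * a\<^sup>2) * normal_density 0 a u" for u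
    using assms by (simp add: normal_density_def)
  show "integrable lborel (\<lambda>u::real. exp (- (u\<^sup>2) / (2 * a\<^sup>2)))"
    unfolding e using assms by (intro integrable_mult_right) auto
  show "(LINT u|lborel. exp (- (u\<^sup>2) / (2 * a\<^sup>2))) = sqrt (2 * pi) * a"
    unfolding e using assms by (simp add: real_sqrt_mult)
qed

lemma truncated_gaussian_integral:
  fixes f :: "real \<Rightarrow> complex"
  assumes f: "integrable lborel f" and bd: "\<And>u. norm (f u) \<le> D * exp (- (u\<^sup>2) / 2)" and Y: "Y \<ge> 0"
  shows "norm (integral {-Y..Y} f - (LINT u|lborel. f u)) \<le> 4 * D * exp (- (Y\<^sup>2) / 4)"
proof -
  have D: "D \<ge> 0" using order_trans[OF norm_ge_zero bd[of 0]] by simp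
  have si: "set_integrable lborel {-Y..Y} f"
    unfolding set_integrable_def by (rule integrable_mult_indicator) (use f in auto)
  have i2: "integrable lborel (\<lambda>u. indicator (- {-Y..Y}) u *\<^sub>R f u)"
    by (rule integrable_mult_indicator) (use f in auto)
  have "integral {-Y..Y} f = (LINT u:{-Y..Y}|lborel. f u)"
    by (rule set_borel_integral_eq_integral(2)[OF si, symmetric])
  then have "integral {-Y..Y} f - (LINT u|lborel. f u) = (LINT u|lborel. indicator {-Y..Y} u *\<^sub>R f u - f u)"
    using f si unfolding set_lebesgue_integral_def set_integrable_def by simp
  also have "\<dots> = (LINT u|lborel. - (indicator (- {-Y..Y}) u *\<^sub>R f u))"
    by (rule Bochner_Integration.integral_cong) (auto simp: indicator_def)
  also have "norm \<dots> \<le> (LINT u|lborel. norm (- (indicator (- {-Y..Y}) u *\<^sub>R f u)))"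
    by (rule integral_norm_bound)
  \<comment> \<open>Half of the exponent is spent on \<open>u\<^sup>2 \<ge> Y\<^sup>2\<close>; the
    other half stays as a Gaussian of standard deviation \<open>sqrt 2\<close>.\<close>
  also have "\<dots> \<le> (LINT u|lborel. D * exp (- (Y\<^sup>2) / 4) * exp (- (u\<^sup>2) / (2 * (sqrt 2)\<^sup>2)))"
  proof (rule integral_mono)
    show "integrable lborel (\<lambda>u. norm (- (indicator (- {-Y..Y}) u *\<^sub>R f u)))"
      using i2 by (intro integrable_norm integrable_minus)
    show "integrable lborel (\<lambda>u. D * exp (- (Y\<^sup>2) / 4) * exp (- (u\<^sup>2) / (2 * (sqrt 2)\<^sup>2)))"
      by (intro integrable_mult_right gaussian_integral_real) auto
    show "norm (- (indicator (- {-Y..Y}) u *\<^sub>R f u)) \<le> D * exp (- (Y\<^sup>2) / 4) * exp (- (u\<^sup>2) / (2 * (sqrt 2)\<^sup>2))" for u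
    proof (cases "u \<in> {-Y..Y}")
      case False
      then have "\<bar>Y\<bar> \<le> \<bar>u\<bar>" using Y by (cases "u < - Y") auto
      then have "Y\<^sup>2 \<le> u\<^sup>2" by (simp only: abs_le_square_iff)
      then have "- (u\<^sup>2) / 2 \<le> - (Y\<^sup>2) / 4 + - (u\<^sup>2) / 4" by simp
      then have "exp (- (u\<^sup>2) / 2) \<le> exp (- (Y\<^sup>2) / 4) * exp (- (u\<^sup>2) / 4)" by (simp add: exp_add[symmetric])
      then have "D * exp (- (u\<^sup>2) / 2) \<le> D * (exp (- (Y\<^sup>2) / 4) * exp (- (u\<^sup>2) / 4))"
        using D by (rule mult_left_mono)
      then show ?thesis using bd[of u] False by simp
    qed (use D in simp)
  qed
  also have "\<dots> = D * exp (- (Y\<^sup>2) / 4) * (sqrt (2 * pi) * sqrt 2)"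
    using gaussian_integral_real(2)[of "sqrt 2"] by simp
  also have "\<dots> \<le> D * exp (- (Y\<^sup>2) / 4) * 4"
  proof (rule mult_left_mono)
    have "sqrt (2 * pi) * sqrt 2 = sqrt (4 * pi)" by (simp add: real_sqrt_mult[symmetric])
    also have "\<dots> \<le> sqrt (4\<^sup>2)" using pi_less_4 by (intro real_sqrt_le_mono) simp
    finally show "sqrt (2 * pi) * sqrt 2 \<le> 4" by simp
  qed (use D in simp)
  finally show ?thesis by simp
qed

text \<open>On the imaginary axis this is the non-negative kernel
  \<open>exp (- u\<^sup>2 / 2) * (1 + cos (\<theta> + l u))\<close>, whose Fourier transform is concentrated at the frequencies \<open>0\<close> and \<open>\<plusminus>l\<close>.\<close>

definition mkernel :: "real \<Rightarrow> real \<Rightarrow> complex \<Rightarrow> complex" where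
  "mkernel \<theta> l z = exp (z\<^sup>2 / 2) * (1 + (exp (\<i> * \<theta> + l * z) + exp (- (\<i> * \<theta> + l * z))) / 2)"

text \<open>The transform of \<open>mkernel\<close> at frequency \<open>y\<close>, up to the factor
  \<open>sqrt (2 * pi)\<close>: one bump for each of the three exponentials, centred at 0,
  \<open>l\<close> and \<open>- l\<close>. At \<open>y = ln n\<close> the middle term selects
  \<open>n\<close> near \<open>exp l\<close> and carries the phase
  \<open>exp (\<i> * \<theta>)\<close>.\<close>

definition mkernel_fourier :: "real \<Rightarrow> real \<Rightarrow> real \<Rightarrow> complex" where
  "mkernel_fourier \<theta> l y = exp (- (y\<^sup>2) / 2) + (exp (\<i> * \<theta>) * exp (- ((l - y)\<^sup>2) / 2) + exp (- (\<i> * \<theta>)) * exp (- ((l + y)\<^sup>2) / 2)) / 2"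

lemma mkernel_imaginary: "mkernel \<theta> l (Complex 0 u) = of_real (exp (- (u\<^sup>2) / 2) * (1 + cos (\<theta> + l * u)))"
proof -
  have "(Complex 0 u)\<^sup>2 / 2 = of_real (- (u\<^sup>2) / 2)" by (simp add: complex_eq_iff power2_eq_square)
  moreover have "\<i> * of_real \<theta> + of_real l * Complex 0 u = \<i> * of_real (\<theta> + l * u)"
    by (simp add: complex_eq_iff)
  moreover have "(exp (\<i> * of_real x) + exp (- (\<i> * of_real x))) / 2 = of_real (cos x)" for x
    by (simp add: cos_of_real[symmetric] cos_exp_eq)
  ultimately show ?thesis by (simp add: mkernel_def exp_of_real del: of_real_add of_real_mult of_real_divide of_real_minus of_real_power)
      (simp only: of_real_mult of_real_add of_real_1)
qed

lemma norm_mkernel_le: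
  assumes "l \<ge> 0" "x \<ge> 0"
  shows "norm (mkernel \<theta> l (Complex x u)) \<le> 2 * exp (x\<^sup>2 / 2 + l * x) * exp (- (u\<^sup>2) / 2)"
proof -
  have r: "Re ((Complex x u)\<^sup>2 / 2) = x\<^sup>2 / 2 - u\<^sup>2 / 2" by (simp add: power2_eq_square)
  have lx: "0 \<le> l * x" using assms by simp
  have tri: "norm (1 + (A + B) / 2) \<le> 1 + (norm A + norm B) / 2" for A B :: complex
  proof -
    have "norm (1 + (A + B) / 2) \<le> norm (1::complex) + norm ((A + B) / 2)" by (rule norm_triangle_ineq)
    also have "\<dots> = 1 + norm (A + B) / 2" by (simp add: norm_divide)
    also have "\<dots> \<le> 1 + (norm A + norm B) / 2" using norm_triangle_ineq[of A B] by simp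
    finally show ?thesis .
  qed
  have "norm (1 + (exp (\<i> * \<theta> + l * Complex x u) + exp (- (\<i> * \<theta> + l * Complex x u))) / 2)
     \<le> 1 + (norm (exp (\<i> * \<theta> + l * Complex x u)) + norm (exp (- (\<i> * \<theta> + l * Complex x u)))) / 2"
    by (rule tri)
  also have "\<dots> = 1 + (exp (l * x) + exp (- (l * x))) / 2" by (simp add: norm_exp_eq_Re)
  also have "\<dots> \<le> 2 * exp (l * x)"
  proof -
    have "1 + (A + B) / 2 \<le> 2 * A" if "A \<ge> 1" "B \<le> 1" for A B :: real
      using that by argo
    then show ?thesis using lx by simp
  qed
  finally have "norm (mkernel \<theta> l (Complex x u)) \<le> exp (x\<^sup>2 / 2 - u\<^sup>2 / 2) * (2 * exp (l * x))"
    unfolding mkernel_def norm_mult norm_exp_eq_Re r by (intro mult_left_mono) auto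
  also have "\<dots> = 2 * exp (x\<^sup>2 / 2 + l * x) * exp (- (u\<^sup>2) / 2)" 
  proof -
    have "exp (x\<^sup>2 / 2 - u\<^sup>2 / 2) = exp (x\<^sup>2 / 2) * exp (- (u\<^sup>2) / 2)"
      by (simp add: exp_add[symmetric])
    then show ?thesis by (simp add: exp_add mult_ac)
  qed
  finally show ?thesis .
qed

text \<open>Completing the square moves the line from \<open>x\<close> to \<open>x + w\<close> with
  \<open>w = \<mu> - ln n\<close> and leaves the factor \<open>exp (- (w\<^sup>2) / 2)\<close>; the
  abscissa then drops out by \<open>gaussian_line_integral\<close>.\<close>

lemma gaussian_frequency:
  fixes n :: nat and \<mu> x :: real and s :: complex
  assumes n: "n > 0"
  shows "integrable lborel (\<lambda>u. of_nat n powr (- (s + Complex x u)) * (exp ((Complex x u)\<^sup>2 / 2) * exp (\<mu> * Complex x u)))"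
    and "(LINT u|lborel. of_nat n powr (- (s + Complex x u)) * (exp ((Complex x u)\<^sup>2 / 2) * exp (\<mu> * Complex x u))) =
       sqrt (2 * pi) * of_nat n powr (- s) * exp (- ((\<mu> - ln n)\<^sup>2) / 2)"
proof -
  define w where "w = \<mu> - ln (real n)"
  have e: "of_nat n powr (- (s + Complex x u)) * (exp ((Complex x u)\<^sup>2 / 2) * exp (\<mu> * Complex x u)) =
      (of_nat n powr (- s) * of_real (exp (- (w\<^sup>2) / 2))) * exp ((Complex (x + w) u)\<^sup>2 / 2)" for u
  proof -
    have "of_nat n powr (- (s + Complex x u)) = of_nat n powr (- s) * exp (- (Complex x u * of_real (ln (real n))))"
      using n by (simp add: powr_def exp_add[symmetric] algebra_simps Ln_of_nat)
    moreover have "exp (- (Complex x u * of_real (ln (real n)))) * (exp ((Complex x u)\<^sup>2 / 2) * exp (\<mu> * Complex x u))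
       = exp (- (Complex x u * of_real (ln (real n))) + ((Complex x u)\<^sup>2 / 2 + \<mu> * Complex x u))"
      by (simp only: exp_add)
    moreover have "- (Complex x u * of_real (ln (real n))) + ((Complex x u)\<^sup>2 / 2 + \<mu> * Complex x u)
       = of_real (- (w\<^sup>2) / 2) + (Complex (x + w) u)\<^sup>2 / 2"
      by (simp add: complex_eq_iff power2_eq_square w_def field_simps)
    moreover have "exp (of_real (- (w\<^sup>2) / 2) + (Complex (x + w) u)\<^sup>2 / 2) = of_real (exp (- (w\<^sup>2) / 2)) * exp ((Complex (x + w) u)\<^sup>2 / 2)"
      by (simp only: exp_add exp_of_real)
    ultimately show ?thesis by (simp add: mult.assoc)
  qed
  show "integrable lborel (\<lambda>u. of_nat n powr (- (s + Complex x u)) * (exp ((Complex x u)\<^sup>2 / 2) * exp (\<mu> * Complex x u)))"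
    unfolding e by (intro integrable_mult_right gaussian_line_integral)
  show "(LINT u|lborel. of_nat n powr (- (s + Complex x u)) * (exp ((Complex x u)\<^sup>2 / 2) * exp (\<mu> * Complex x u))) =
       sqrt (2 * pi) * of_nat n powr (- s) * exp (- ((\<mu> - ln n)\<^sup>2) / 2)"
    unfolding e by (simp add: gaussian_line_integral(2) w_def exp_of_real[symmetric] mult_ac)
qed

lemma mkernel_transform:
  fixes n :: nat and x :: real and s :: complex
  assumes n: "n > 0"
  shows "integrable lborel (\<lambda>u. of_nat n powr (- (s + Complex x u)) * mkernel \<theta> l (Complex x u))"
    and "(LINT u|lborel. of_nat n powr (- (s + Complex x u)) * mkernel \<theta> l (Complex x u)) =
       sqrt (2 * pi) * (of_nat n powr (- s) * mkernel_fourier \<theta> l (ln n))"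
proof -
  define T where "T \<mu> u = of_nat n powr (- (s + Complex x u)) * (exp ((Complex x u)\<^sup>2 / 2) * exp (of_real \<mu> * Complex x u))" for \<mu> :: real and u
  define c where "c = exp (\<i> * of_real \<theta>) / 2"
  define d where "d = exp (- (\<i> * of_real \<theta>)) / 2"
  have e: "of_nat n powr (- (s + Complex x u)) * mkernel \<theta> l (Complex x u) = T 0 u + (c * T l u + d * T (- l) u)" for u
  proof -
    have m: "exp (- (\<i> * of_real \<theta> + of_real l * Complex x u)) = exp (- (\<i> * of_real \<theta>)) * exp (of_real (- l) * Complex x u)"
      by (simp add: exp_add[symmetric])
    show ?thesis unfolding mkernel_def T_def c_def d_def m exp_add by (simp add: algebra_simps add_divide_distrib)
  qed
  have i: "integrable lborel (T \<mu>)" for \<mu> unfolding T_def by (rule gaussian_frequency(1)[OF n])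
  have L: "(LINT u|lborel. T \<mu> u) = sqrt (2 * pi) * of_nat n powr (- s) * exp (- ((\<mu> - ln n)\<^sup>2) / 2)" for \<mu>
    unfolding T_def by (rule gaussian_frequency(2)[OF n])
  show "integrable lborel (\<lambda>u. of_nat n powr (- (s + Complex x u)) * mkernel \<theta> l (Complex x u))"
    unfolding e by (intro Bochner_Integration.integrable_add integrable_mult_right i)
  have sq: "(- l - ln (real n))\<^sup>2 = (l + ln (real n))\<^sup>2" by (simp add: power2_eq_square algebra_simps)
  have "(LINT u|lborel. of_nat n powr (- (s + Complex x u)) * mkernel \<theta> l (Complex x u)) =
    (LINT u|lborel. T 0 u) + (c * (LINT u|lborel. T l u) + d * (LINT u|lborel. T (- l) u))"
    unfolding e using i by (simp add: Bochner_Integration.integral_add integrable_mult_right)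
  also have "\<dots> = sqrt (2 * pi) * (of_nat n powr (- s) * mkernel_fourier \<theta> l (ln n))"
    unfolding L sq by (simp add: mkernel_fourier_def c_def d_def field_simps exp_of_real[symmetric])
  finally show "(LINT u|lborel. of_nat n powr (- (s + Complex x u)) * mkernel \<theta> l (Complex x u)) =
    sqrt (2 * pi) * (of_nat n powr (- s) * mkernel_fourier \<theta> l (ln n))" .
qed

subsection \<open>Convolution with the kernel\<close>

text \<open>Here 9/8 is \<open>(3/2)\<^sup>2 / 2\<close>, where 3/2 bounds the distance
  \<open>2 - \<sigma>\<close> of the contour shift. Taking a fifth root first makes the crude bound
  \<open>1 + x \<le> exp x\<close> precise enough.\<close>

lemma exp_9_8_le: "exp (9/8::real) \<le> 4"
proof -
  have "exp (9/40::real) = inverse (exp (- (9/40)))" by (simp add: exp_minus)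
  also have "\<dots> \<le> inverse (31/40)"
    using exp_ge_add_one_self[of "- (9/40::real)"] by (intro le_imp_inverse_le) auto
  finally have "exp (9/40::real) ^ 5 \<le> (40/31) ^ 5" by (intro power_mono) auto
  also have "(40/31::real) ^ 5 \<le> 4" by (simp add: power_divide)
  finally show ?thesis by (simp add: exp_of_nat_mult[symmetric])
qed

lemma norm_of_nat_powr_Re2: "n > 0 \<Longrightarrow> Re s = 2 \<Longrightarrow> norm (complex_of_nat n powr (- s)) = real n powr (- 2)"
  by (simp add: norm_of_nat_powr)

text \<open>On abscissa 2 the series is dominated by inverse squares uniformly in \<open>u\<close>,
  so sum and integral may be exchanged. The value depends on \<open>s0\<close> alone, although it is
  computed on the line shifted by \<open>x\<close>.\<close>

lemma mkernel_prime_sum: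
  fixes s0 :: complex and x l \<theta> :: real
  assumes s0: "Re s0 + x = 2" and x: "0 \<le> x" and l: "0 \<le> l"
  defines "f \<equiv> \<lambda>u. prime_zeta (s0 + Complex x u) * mkernel \<theta> l (Complex x u)"
    and "P \<equiv> (\<Sum>n. real n powr (- 2))"
  shows "integrable lborel f"
    and "(LINT u|lborel. f u) = sqrt (2 * pi) * (\<Sum>n. if prime n then of_nat n powr (- s0) * mkernel_fourier \<theta> l (ln n) else 0)"
    and "norm (f u) \<le> P * (2 * exp (x\<^sup>2 / 2 + l * x)) * exp (- (u\<^sup>2) / 2)"
proof -
  define F where "F n u = (if prime n then of_nat n powr (- (s0 + Complex x u)) * mkernel \<theta> l (Complex x u) else 0)" for n u
  define B where "B = 2 * exp (x\<^sup>2 / 2 + l * x)"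
  have B: "B \<ge> 0" by (simp add: B_def)
  have k: "norm (mkernel \<theta> l (Complex x u)) \<le> B * exp (- (u\<^sup>2) / 2)" for u
    unfolding B_def by (rule norm_mkernel_le[OF l x])
  have re: "Re (s0 + Complex x u) = 2" for u using s0 by simp
  have sP: "summable (\<lambda>n. real n powr (- 2))" by (rule summable_nat_powr) simp
  have b: "norm (F n u) \<le> real n powr (- 2) * (B * exp (- (u\<^sup>2) / 2))" for n u
  proof (cases "prime n")
    case True
    then have "norm (complex_of_nat n powr (- (s0 + Complex x u))) = real n powr (- 2)"
      using prime_gt_0_nat re by (intro norm_of_nat_powr_Re2) auto
    then show ?thesis using True k[of u] by (simp add: F_def norm_mult mult_left_mono)
  qed (use B in \<open>simp add: F_def\<close>)
  have iF: "integrable lborel (F n)" for n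
  proof (cases "prime n")
    case True
    then show ?thesis unfolding F_def using mkernel_transform(1)[of n s0 x \<theta> l] prime_gt_0_nat by simp
  qed (simp add: F_def[abs_def])
  have sF: "summable (\<lambda>n. norm (F n u))" for u
    by (rule summable_comparison_test[OF _ summable_mult2[OF sP, of "B * exp (- (u\<^sup>2) / 2)"]])
       (use b in auto)
  have gi: "integrable lborel (\<lambda>u::real. exp (- (u\<^sup>2) / 2))" "(LINT u|lborel. exp (- (u\<^sup>2) / 2)) = sqrt (2 * pi)"
    using gaussian_integral_real[of 1] by simp_all
  have sI: "summable (\<lambda>n. LINT u|lborel. norm (F n u))"
  proof (rule summable_comparison_test)
    show "summable (\<lambda>n. real n powr (- 2) * (B * sqrt (2 * pi)))" by (rule summable_mult2[OF sP])
    have "(LINT u|lborel. norm (F n u)) \<le> real n powr (- 2) * (B * sqrt (2 * pi))" for n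
    proof -
      have "(LINT u|lborel. norm (F n u)) \<le> (LINT u|lborel. real n powr (- 2) * (B * exp (- (u\<^sup>2) / 2)))"
        by (rule integral_mono) (use iF b gi in \<open>auto intro!: integrable_norm\<close>)
      also have "\<dots> = real n powr (- 2) * (B * sqrt (2 * pi))" using gi by simp
      finally show ?thesis .
    qed
    then show "\<exists>N. \<forall>n\<ge>N. norm (LINT u|lborel. norm (F n u)) \<le> real n powr (- 2) * (B * sqrt (2 * pi))"
      by (auto intro!: exI[of _ 0])
  qed
  have eq: "f u = (\<Sum>n. F n u)" for u
  proof -
    have "Re (s0 + Complex x u) > 1" using re by simp
    then have "summable (\<lambda>n. if prime n then complex_of_nat n powr (- (s0 + Complex x u)) else 0)"
      by (intro summable_norm_cancel[OF summable_prime_zeta])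
    from suminf_mult2[OF this, of "mkernel \<theta> l (Complex x u)"]
    have "f u = (\<Sum>n. (if prime n then complex_of_nat n powr (- (s0 + Complex x u)) else 0) * mkernel \<theta> l (Complex x u))"
      unfolding f_def prime_zeta_def .
    also have "\<dots> = (\<Sum>n. F n u)" by (rule arg_cong[of _ _ suminf]) (auto simp: F_def)
    finally show ?thesis .
  qed
  show "integrable lborel f" unfolding eq by (rule integrable_suminf) (use iF sF sI in auto)
  have "(LINT u|lborel. f u) = (\<Sum>n. LINT u|lborel. F n u)"
    unfolding eq by (rule integral_suminf) (use iF sF sI in auto)
  also have "\<dots> = (\<Sum>n. sqrt (2 * pi) * (if prime n then of_nat n powr (- s0) * mkernel_fourier \<theta> l (ln n) else 0))"
    unfolding F_def using mkernel_transform(2)[of _ s0 x \<theta> l] prime_gt_0_nat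
    by (intro arg_cong[of _ _ suminf] ext) auto
  also have "\<dots> = sqrt (2 * pi) * (\<Sum>n. if prime n then of_nat n powr (- s0) * mkernel_fourier \<theta> l (ln n) else 0)"
  proof (rule suminf_mult)
    have "summable (\<lambda>n. LINT u|lborel. F n u)"
      by (rule summable_norm_cancel, rule summable_comparison_test[OF _ sI]) (auto intro!: exI[of _ 0] integral_norm_bound)
    also have "(\<lambda>n. LINT u|lborel. F n u) = (\<lambda>n. sqrt (2 * pi) * (if prime n then of_nat n powr (- s0) * mkernel_fourier \<theta> l (ln n) else 0))"
      unfolding F_def using mkernel_transform(2)[of _ s0 x \<theta> l] prime_gt_0_nat by auto
    finally show "summable (\<lambda>n. if prime n then of_nat n powr (- s0) * mkernel_fourier \<theta> l (ln n) else 0)"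
      by (subst (asm) summable_cmult_iff) simp
  qed
  finally show "(LINT u|lborel. f u) = sqrt (2 * pi) * (\<Sum>n. if prime n then of_nat n powr (- s0) * mkernel_fourier \<theta> l (ln n) else 0)" .
  have "norm (f u) \<le> (\<Sum>n. norm (F n u))" unfolding eq by (rule summable_norm[OF sF])
  also have "\<dots> \<le> (\<Sum>n. real n powr (- 2) * (B * exp (- (u\<^sup>2) / 2)))"
    by (rule suminf_le[OF b sF summable_mult2[OF sP]])
  also have "\<dots> = P * (B * exp (- (u\<^sup>2) / 2))" unfolding P_def by (rule suminf_mult2[OF sP, symmetric])
  finally show "norm (f u) \<le> P * (2 * exp (x\<^sup>2 / 2 + l * x)) * exp (- (u\<^sup>2) / 2)" by (simp add: B_def mult_ac)
qed

lemma mkernel_holomorphic: "mkernel \<theta> l holomorphic_on A"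
  unfolding mkernel_def by (intro holomorphic_intros) auto

text \<open>Two evaluations of one integral. On \<open>Re z = 0\<close> the kernel is real,
  non-negative and at most \<open>2 * exp (- (u\<^sup>2) / 2)\<close>, which gives the bound by
  \<open>V + Bh\<close>. On \<open>Re z = 2 - \<sigma>\<close> the integrand is the prime series,
  which gives \<open>sqrt (2 * pi)\<close> times the smoothed sum. The error term collects the
  horizontal sides and the truncation at \<open>Y\<close>; \<open>exp (2 * l)\<close> bounds the
  growth of the kernel to the right.\<close>

lemma convolution_upper_bound:
  fixes g :: "complex \<Rightarrow> complex"
  assumes a: "1/2 \<le> a" "a < \<sigma>" "\<sigma> < 1"
    and g: "g holomorphic_on half_strip a t H" "\<And>s. s \<in> half_strip a t H \<Longrightarrow> Re s > 1 \<Longrightarrow> g s = log_zeta_series s"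
    and Y: "0 < Y" "Y < H" and l: "l \<ge> 0" and V: "V \<ge> 0"
    and gV: "\<And>u. \<bar>u\<bar> \<le> Y \<Longrightarrow> Re (exp (- (\<i> * \<theta>)) * g (Complex \<sigma> (t + u))) \<le> V"
    and gB: "\<And>s. \<sigma> \<le> Re s \<Longrightarrow> Re s \<le> 2 \<Longrightarrow> \<bar>Im s - t\<bar> \<le> Y \<Longrightarrow> norm (g s) \<le> Bg"
    and hB: "\<And>s. \<sigma> \<le> Re s \<Longrightarrow> norm (log_zeta_rest s) \<le> Bh"
  shows "Re (exp (- (\<i> * \<theta>)) * (\<Sum>n. if prime n then of_nat n powr (- Complex \<sigma> t) * mkernel_fourier \<theta> l (ln n) else 0))
     \<le> 2 * (V + Bh) + 32 * (Bg + Bh + (\<Sum>n. real n powr (- 2))) * exp (2 * l) * exp (- (Y\<^sup>2) / 4)"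
proof -
  define s0 where "s0 = Complex \<sigma> t"
  define x where "x = 2 - \<sigma>"
  define P where "P = (\<Sum>n. real n powr (- 2))"
  have x: "1 < x" "x < 3/2" using a by (auto simp: x_def)
  define S where "S = half_strip (a - \<sigma>) 0 H"
  \<comment> \<open>Left of the region of convergence this difference continues
    \<open>prime_zeta\<close>, so after the shift only primes remain.\<close>
  define G where "G z = g (s0 + z) - log_zeta_rest (s0 + z)" for z
  define F where "F z = G z * mkernel \<theta> l z" for z
  have memS: "s0 + z \<in> half_strip a t H" if "z \<in> S" for z
    using that by (auto simp: S_def half_strip_def s0_def)
  have Bs: "Bh \<ge> 0" "Bg \<ge> 0" "P \<ge> 0"
    using order_trans[OF norm_ge_zero hB[of s0]] order_trans[OF norm_ge_zero gB[of s0]] a Y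
    by (auto simp: s0_def P_def intro!: suminf_nonneg summable_nat_powr)
  have hol: "F holomorphic_on S"
  proof -
    have t: "(\<lambda>z. s0 + z) holomorphic_on S" by (intro holomorphic_intros)
    have "(g \<circ> (\<lambda>z. s0 + z)) holomorphic_on S"
      by (rule holomorphic_on_compose_gen[OF t g(1)]) (use memS in auto)
    moreover have "(log_zeta_rest \<circ> (\<lambda>z. s0 + z)) holomorphic_on S"
    proof (rule holomorphic_on_compose_gen[OF t log_zeta_rest_holomorphic])
      show "(\<lambda>z. s0 + z) ` S \<subseteq> {s. Re s > 1/2}"
        using memS a by (fastforce simp: half_strip_def)
    qed
    ultimately show ?thesis unfolding F_def G_def o_def by (intro holomorphic_intros mkernel_holomorphic)
  qed
  have rect: "cbox (Complex 0 (- Y)) (Complex x Y) \<subseteq> S"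
    using a Y by (auto simp: S_def half_strip_def in_cbox_complex_iff)
  have pim: "path_image (rectpath (Complex 0 (- Y)) (Complex x Y)) \<subseteq> S"
    using path_image_rectpath_subset_cbox[of "Complex 0 (- Y)" "Complex x Y"] rect x Y by auto
  have zero: "contour_integral (rectpath (Complex 0 (- Y)) (Complex x Y)) F = 0"
    by (rule contour_integral_unique[OF Cauchy_theorem_convex_simple[OF hol]])
       (use pim in \<open>auto simp: S_def convex_half_strip\<close>)
  define h where "h = (Bg + Bh) * (8 * exp (2 * l)) * exp (- (Y\<^sup>2) / 4)"
  have k: "norm (mkernel \<theta> l (Complex y v)) \<le> 8 * exp (2 * l) * exp (- (v\<^sup>2) / 2)" if y: "0 \<le> y" "y \<le> x" for y v
  proof -
    have "exp (y\<^sup>2 / 2 + l * y) \<le> exp (9/8 + l * 2)"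
    proof -
      have "y\<^sup>2 \<le> (3/2)\<^sup>2" using y x by (intro power_mono) auto
      moreover have "l * y \<le> l * 2" using y x l by (intro mult_left_mono) auto
      ultimately show ?thesis by (simp add: power2_eq_square)
    qed
    also have "\<dots> = exp (9/8) * exp (2 * l)" by (simp add: exp_add mult.commute)
    also have "\<dots> \<le> 4 * exp (2 * l)"
    proof (rule mult_right_mono)
      show "exp (9/8::real) \<le> 4" by (rule exp_9_8_le)
    qed simp
    finally have "2 * exp (y\<^sup>2 / 2 + l * y) * exp (- (v\<^sup>2) / 2) \<le> 8 * exp (2 * l) * exp (- (v\<^sup>2) / 2)"
      by (intro mult_right_mono) auto
    then show ?thesis using norm_mkernel_le[OF l y(1), of \<theta> v] by linarith
  qed
  have Gb: "norm (G (Complex y v)) \<le> Bg + Bh" if "0 \<le> y" "y \<le> x" "\<bar>v\<bar> \<le> Y" for y v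
    unfolding G_def using gB[of "s0 + Complex y v"] hB[of "s0 + Complex y v"] that
      norm_triangle_ineq4[of "g (s0 + Complex y v)" "log_zeta_rest (s0 + Complex y v)"]
    by (simp add: s0_def x_def)
  have hb: "norm (F (Complex y v)) \<le> h" if "0 \<le> y" "y \<le> x" "v = - Y \<or> v = Y" for y v
  proof -
    have "norm (F (Complex y v)) \<le> (Bg + Bh) * (8 * exp (2 * l) * exp (- (v\<^sup>2) / 2))"
      unfolding F_def norm_mult using Gb[of y v] k[of y v] that Y Bs by (intro mult_mono) auto
    also have "\<dots> \<le> (Bg + Bh) * (8 * exp (2 * l) * exp (- (Y\<^sup>2) / 4))"
      using that Bs by (intro mult_left_mono) auto
    finally show ?thesis by (simp add: h_def mult_ac)
  qed
  define J where "J = integral {- Y..Y} (\<lambda>u. F (Complex 0 u))"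
  define I where "I = integral {- Y..Y} (\<lambda>u. F (Complex x u))"
  have "norm (0 - (\<i> * I - \<i> * J)) \<le> 2 * h * (x - 0)"
    unfolding zero[symmetric] I_def J_def
    by (rule rectpath_vertical_sides)
       (use x Y hb holomorphic_on_imp_continuous_on[OF hol] pim continuous_on_subset in auto)
  moreover have "norm (0 - (\<i> * I - \<i> * J)) = norm (I - J)"
    by (simp add: right_diff_distrib[symmetric] norm_mult norm_minus_commute)
  moreover have "2 * h * (x - 0) \<le> 3 * h"
    using x Bs mult_left_mono[of x "3/2" "2 * h"] by (simp add: h_def)
  ultimately have IJ: "norm (I - J) \<le> 3 * h" by linarith
  define \<Sigma> where "\<Sigma> = (\<Sum>n. if prime n then of_nat n powr (- s0) * mkernel_fourier \<theta> l (ln n) else 0)"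
  define f where "f u = prime_zeta (s0 + Complex x u) * mkernel \<theta> l (Complex x u)" for u
  have fI: "F (Complex x u) = f u" if "u \<in> {- Y..Y}" for u
  proof -
    have "Complex x u \<in> S" using that rect x by (auto simp: in_cbox_complex_iff)
    then have "g (s0 + Complex x u) = log_zeta_series (s0 + Complex x u)"
      by (intro g(2) memS) (auto simp: s0_def x_def)
    then show ?thesis unfolding F_def G_def f_def
      using log_zeta_series_eq[of "s0 + Complex x u"] by (simp add: s0_def x_def)
  qed
  have "I = integral {- Y..Y} f" unfolding I_def using fI by (rule Henstock_Kurzweil_Integration.integral_cong)
  moreover have re2: "Re s0 + x = 2" by (simp add: s0_def x_def)
  moreover have "norm (integral {- Y..Y} f - (LINT u|lborel. f u)) \<le> 4 * (P * (8 * exp (2 * l))) * exp (- (Y\<^sup>2) / 4)"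
  proof (rule truncated_gaussian_integral)
    show "integrable lborel f" unfolding f_def using mkernel_prime_sum(1)[OF re2] x l by simp
    fix u
    have "norm (prime_zeta (s0 + Complex x u)) \<le> P"
    proof -
      have r: "Re (s0 + Complex x u) = 2" using re2 by simp
      then have sm: "summable (\<lambda>n. norm (if prime n then complex_of_nat n powr (- (s0 + Complex x u)) else 0))"
        by (intro summable_prime_zeta) simp
      have "norm (prime_zeta (s0 + Complex x u)) \<le> (\<Sum>n. norm (if prime n then complex_of_nat n powr (- (s0 + Complex x u)) else 0))"
        unfolding prime_zeta_def by (rule summable_norm[OF sm])
      also have "\<dots> \<le> P" unfolding P_def
      proof (rule suminf_le[OF _ sm])
        show "norm (if prime n then complex_of_nat n powr (- (s0 + Complex x u)) else 0) \<le> real n powr (- 2)" for n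
          using norm_of_nat_powr_Re2[OF _ r, of n] prime_gt_0_nat[of n] by (cases "prime n") auto
      qed (rule summable_nat_powr, simp)
      finally show ?thesis .
    qed
    then show "norm (f u) \<le> P * (8 * exp (2 * l)) * exp (- (u\<^sup>2) / 2)"
      unfolding f_def norm_mult mult.assoc using k[of x u] x Bs by (intro mult_mono) (auto simp: mult.assoc)
  qed (use Y in simp)
  moreover have "(LINT u|lborel. f u) = sqrt (2 * pi) * \<Sigma>"
    unfolding f_def \<Sigma>_def using mkernel_prime_sum(2)[OF re2] x l by simp
  ultimately have I\<Sigma>: "norm (I - sqrt (2 * pi) * \<Sigma>) \<le> 32 * P * exp (2 * l) * exp (- (Y\<^sup>2) / 4)" by simp
  define K where "K u = exp (- (u\<^sup>2) / 2) * (1 + cos (\<theta> + l * u))" for u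
  have Kb: "0 \<le> K u" "K u \<le> 2 * exp (- (u\<^sup>2) / 2)" for u
  proof -
    have "0 \<le> 1 + cos (\<theta> + l * u)" using cos_ge_minus_one[of "\<theta> + l * u"] by linarith
    then show "0 \<le> K u" unfolding K_def by (rule mult_nonneg_nonneg[OF exp_ge_zero])
    have "exp (- (u\<^sup>2) / 2) * (1 + cos (\<theta> + l * u)) \<le> exp (- (u\<^sup>2) / 2) * 2"
      using cos_le_one[of "\<theta> + l * u"] by (intro mult_left_mono) auto
    then show "K u \<le> 2 * exp (- (u\<^sup>2) / 2)" by (simp add: K_def mult.commute)
  qed
  have FK: "F (Complex 0 u) = G (Complex 0 u) * of_real (K u)" for u
    by (simp add: F_def mkernel_imaginary K_def)
  have contF: "continuous_on {- Y..Y} (\<lambda>u. F (Complex 0 u))"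
  proof (rule continuous_on_compose2[OF holomorphic_on_imp_continuous_on[OF hol]])
    show "continuous_on {- Y..Y} (Complex 0)" unfolding Complex_eq by (intro continuous_intros)
    show "Complex 0 ` {- Y..Y} \<subseteq> S" using rect x by (auto simp: in_cbox_complex_iff)
  qed
  have "Re (exp (- (\<i> * \<theta>)) * J) = integral {- Y..Y} ((\<lambda>z. Re (exp (- (\<i> * \<theta>)) * z)) \<circ> (\<lambda>u. F (Complex 0 u)))"
    unfolding J_def
    by (rule integral_linear[symmetric, OF integrable_continuous_real[OF contF]
          bounded_linear_compose[OF bounded_linear_Re bounded_linear_mult_right]])
  also have "\<dots> \<le> integral {- Y..Y} (\<lambda>u. (V + Bh) * (2 * exp (- (u\<^sup>2) / 2)))"
  proof (rule Henstock_Kurzweil_Integration.integral_le)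
    show "(\<lambda>z. Re (exp (- (\<i> * \<theta>)) * z)) \<circ> (\<lambda>u. F (Complex 0 u)) integrable_on {- Y..Y}"
      unfolding o_def by (intro integrable_continuous_real continuous_intros contF)
    show "(\<lambda>u. (V + Bh) * (2 * exp (- (u\<^sup>2) / 2))) integrable_on {- Y..Y}"
      by (intro integrable_continuous_real continuous_intros) auto
    fix u assume u: "u \<in> {- Y..Y}"
    have s: "s0 + Complex 0 u = Complex \<sigma> (t + u)" by (simp add: s0_def complex_eq_iff)
    have "Re (exp (- (\<i> * \<theta>)) * G (Complex 0 u)) = Re (exp (- (\<i> * \<theta>)) * g (Complex \<sigma> (t + u))) - Re (exp (- (\<i> * \<theta>)) * log_zeta_rest (Complex \<sigma> (t + u)))"
      unfolding G_def s by (simp add: algebra_simps)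
    also have "\<dots> \<le> V + Bh"
    proof -
      have "- Re (exp (- (\<i> * \<theta>)) * log_zeta_rest (Complex \<sigma> (t + u))) \<le> norm (exp (- (\<i> * \<theta>)) * log_zeta_rest (Complex \<sigma> (t + u)))"
        using abs_Re_le_cmod[of "exp (- (\<i> * \<theta>)) * log_zeta_rest (Complex \<sigma> (t + u))"] by linarith
      also have "\<dots> \<le> Bh" using hB[of "Complex \<sigma> (t + u)"] by (simp add: norm_mult norm_exp_eq_Re)
      finally show ?thesis using gV[of u] u by (simp add: abs_le_iff)
    qed
    \<comment> \<open>The one-sided bound survives multiplication because \<open>K\<close> is
      non-negative.\<close>
    finally have "Re (exp (- (\<i> * \<theta>)) * G (Complex 0 u)) * K u \<le> (V + Bh) * K u" using Kb by (intro mult_right_mono)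
    also have "\<dots> \<le> (V + Bh) * (2 * exp (- (u\<^sup>2) / 2))" using Kb V Bs by (intro mult_left_mono) auto
    also have "Re (exp (- (\<i> * \<theta>)) * G (Complex 0 u)) * K u = Re (exp (- (\<i> * \<theta>)) * F (Complex 0 u))"
      by (simp add: FK algebra_simps)
    finally show "((\<lambda>z. Re (exp (- (\<i> * \<theta>)) * z)) \<circ> (\<lambda>u. F (Complex 0 u))) u \<le> (V + Bh) * (2 * exp (- (u\<^sup>2) / 2))"
      by (simp only: o_def)
  qed
  also have "\<dots> = (V + Bh) * 2 * integral {- Y..Y} (\<lambda>u. exp (- (u\<^sup>2) / 2))" by (simp add: mult_ac)
  also have "\<dots> \<le> (V + Bh) * 2 * sqrt (2 * pi)"
  proof (rule mult_left_mono)
    have gi: "integrable lborel (\<lambda>u::real. exp (- (u\<^sup>2) / 2))" "(LINT u|lborel. exp (- (u\<^sup>2) / 2)) = sqrt (2 * pi)"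
      using gaussian_integral_real[of 1] by simp_all
    have hi: "((\<lambda>u::real. exp (- (u\<^sup>2) / 2)) has_integral sqrt (2 * pi)) UNIV"
      using has_integral_integral_lborel[OF gi(1)] gi(2) by simp
    show "integral {- Y..Y} (\<lambda>u. exp (- (u\<^sup>2) / 2)) \<le> sqrt (2 * pi)"
      by (rule has_integral_subset_le[OF _ integrable_integral hi])
         (auto intro!: integrable_continuous_real continuous_intros)
  qed (use V Bs in auto)
  finally have J: "Re (exp (- (\<i> * \<theta>)) * J) \<le> (V + Bh) * 2 * sqrt (2 * pi)" .
  define E where "E = 32 * (Bg + Bh + P) * exp (2 * l) * exp (- (Y\<^sup>2) / 4)"
  have E0: "E \<ge> 0" using Bs by (simp add: E_def)
  have "norm (sqrt (2 * pi) * \<Sigma> - J) \<le> norm (I - J) + norm (I - sqrt (2 * pi) * \<Sigma>)"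
    using norm_triangle_ineq4[of "I - J" "I - sqrt (2 * pi) * \<Sigma>"] by simp
  also have "\<dots> \<le> 3 * h + 32 * P * exp (2 * l) * exp (- (Y\<^sup>2) / 4)" using IJ I\<Sigma> by linarith
  also have "\<dots> \<le> E"
  proof -
    have "3 * h \<le> 32 * (Bg + Bh) * exp (2 * l) * exp (- (Y\<^sup>2) / 4)"
      unfolding h_def using Bs mult_nonneg_nonneg[of "(Bg + Bh) * exp (2 * l)" "exp (- (Y\<^sup>2) / 4)"] by simp
    then show ?thesis by (simp add: E_def algebra_simps)
  qed
  finally have d: "norm (sqrt (2 * pi) * \<Sigma> - J) \<le> E" .
  have "sqrt (2 * pi) * Re (exp (- (\<i> * \<theta>)) * \<Sigma>) = Re (exp (- (\<i> * \<theta>)) * (sqrt (2 * pi) * \<Sigma>))"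
    by (simp add: algebra_simps)
  also have "\<dots> = Re (exp (- (\<i> * \<theta>)) * J) + Re (exp (- (\<i> * \<theta>)) * (sqrt (2 * pi) * \<Sigma> - J))"
    by (simp add: algebra_simps)
  also have "\<dots> \<le> (V + Bh) * 2 * sqrt (2 * pi) + E"
  proof -
    have "Re (exp (- (\<i> * \<theta>)) * (sqrt (2 * pi) * \<Sigma> - J)) \<le> norm (exp (- (\<i> * \<theta>)) * (sqrt (2 * pi) * \<Sigma> - J))"
      by (rule complex_Re_le_cmod)
    also have "\<dots> \<le> E" using d by (simp add: norm_mult norm_exp_eq_Re)
    finally show ?thesis using J by linarith
  qed
  also have "\<dots> \<le> sqrt (2 * pi) * (2 * (V + Bh) + E)"
  proof -
    have "1 \<le> sqrt (2 * pi)" using pi_ge_two by simp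
    then have "E \<le> sqrt (2 * pi) * E" using E0 mult_right_mono[of 1 "sqrt (2 * pi)" E] by simp
    then show ?thesis by (simp add: algebra_simps)
  qed
  finally have "Re (exp (- (\<i> * \<theta>)) * \<Sigma>) \<le> 2 * (V + Bh) + E"
    by (rule mult_left_le_imp_le) simp
  then show ?thesis unfolding E_def \<Sigma>_def s0_def P_def .
qed

subsection \<open>Chebyshev estimates\<close>

text \<open>From \<open>n\<close> to \<open>Suc n\<close> the quotient by \<open>d\<close> grows by
  1 exactly when \<open>d\<close> divides \<open>Suc n\<close>, and the Mangoldt function sums to
  the logarithm over divisors. The common range \<open>N\<close> lets two factorials be compared
  term by term.\<close>

lemma ln_fact_eq_sum_mangoldt:
  assumes "n \<le> N"
  shows "ln (fact n :: real) = (\<Sum>d=1..N. mangoldt d * real (n div d))"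
  using assms
proof (induction n)
  case (Suc n)
  have "(\<Sum>d=1..N. mangoldt d * real (Suc n div d)) = (\<Sum>d=1..N. mangoldt d * real (n div d) + (if d dvd Suc n then mangoldt d else 0))"
    by (intro sum.cong) (auto simp: div_Suc dvd_eq_mod_eq_0 algebra_simps)
  also have "\<dots> = ln (fact n) + (\<Sum>d=1..N. if d dvd Suc n then mangoldt d else 0)"
    using Suc by (simp add: sum.distrib)
  also have "(\<Sum>d=1..N. if d dvd Suc n then mangoldt d else (0::real)) = (\<Sum>d | d dvd Suc n. mangoldt d)"
  proof (rule sum.mono_neutral_cong_right)
    show "{d. d dvd Suc n} \<subseteq> {1..N}"
    proof
      fix d assume "d \<in> {d. d dvd Suc n}"
      then have "d \<le> Suc n" by (auto intro: dvd_imp_le)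
      moreover from \<open>d \<in> {d. d dvd Suc n}\<close> have "d \<noteq> 0" by (cases "d = 0") auto
      ultimately show "d \<in> {1..N}" using Suc.prems by simp
    qed
  qed auto
  also have "\<dots> = ln (real (Suc n))" using mangoldt_sum[of "Suc n", where 'a = real] by simp
  finally show ?case by (simp add: ln_mult)
qed (simp)

lemma ln_central_binomial_eq_sum_mangoldt:
  "ln (real ((2 * n) choose n)) = (\<Sum>d=1..2*n. mangoldt d * (real (2 * n div d) - 2 * real (n div d)))"
proof -
  have "real ((2 * n) choose n) = fact (2 * n) / (fact n * fact n)"
    using binomial_fact[of n "2 * n", where 'a = real] by simp
  then have "ln (real ((2 * n) choose n)) = ln (fact (2 * n) :: real) - 2 * ln (fact n :: real)"
    by (simp add: ln_div ln_mult)
  also have "\<dots> = (\<Sum>d=1..2*n. mangoldt d * real (2 * n div d)) - 2 * (\<Sum>d=1..2*n. mangoldt d * real (n div d))"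
    by (subst (1 2) ln_fact_eq_sum_mangoldt[where N = "2 * n"]) auto
  also have "\<dots> = (\<Sum>d=1..2*n. mangoldt d * (real (2 * n div d) - 2 * real (n div d)))"
    by (simp add: sum_distrib_left sum_subtractf[symmetric] algebra_simps)
  finally show ?thesis .
qed

lemma double_div_bounds: "2 * (n div d) \<le> 2 * n div d" "2 * n div d \<le> 2 * (n div d) + (1::nat)"
proof -
  show "2 * (n div d) \<le> 2 * n div d" by (cases "d = 0") (auto simp: less_eq_div_iff_mult_less_eq)
  show "2 * n div d \<le> 2 * (n div d) + 1"
  proof (cases "d = 0")
    case False
    have "n < (n div d + 1) * d" using False dividend_less_times_div[of d n] by (simp add: algebra_simps)
    then have "2 * n < (2 * (n div d) + 2) * d" by (simp add: algebra_simps)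
    then have "2 * n div d < 2 * (n div d) + 2" using False by (simp add: less_mult_imp_div_less)
    then show ?thesis by simp
  qed simp
qed

definition prime_count :: "nat \<Rightarrow> nat" where
  "prime_count n = card {p. prime p \<and> p \<le> n}"

definition chebyshev_theta :: "nat \<Rightarrow> real" where
  "chebyshev_theta n = (\<Sum>p | prime p \<and> p \<le> n. ln (real p))"

text \<open>A prime \<open>p\<close> has at most \<open>ln N / ln p\<close> powers up to
  \<open>N\<close>, each weighted by \<open>ln p\<close>, so its share is at most
  \<open>ln N\<close> whatever \<open>p\<close> is.\<close>

lemma sum_mangoldt_le: "(\<Sum>d=1..N. mangoldt d) \<le> real (prime_count N) * ln (real N)"
proof -
  let ?A = "{d\<in>{1..N}. primepow d}"
  let ?P = "{p. prime p \<and> p \<le> N}"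
  have "(\<Sum>d=1..N. mangoldt d :: real) = (\<Sum>d\<in>?A. ln (real (aprimedivisor d)))"
    by (rule sum.mono_neutral_cong_right) (auto simp: mangoldt_def)
  also have "\<dots> = (\<Sum>p\<in>?P. \<Sum>d\<in>{d\<in>?A. aprimedivisor d = p}. ln (real (aprimedivisor d)))"
  proof (rule sum.group[symmetric])
    show "aprimedivisor ` ?A \<subseteq> ?P"
    proof
      fix p assume "p \<in> aprimedivisor ` ?A"
      then obtain d where d: "d \<in> ?A" "p = aprimedivisor d" by auto
      then obtain q k where "prime q" "k > 0" "d = q ^ k" by (auto simp: primepow_def)
      moreover from this have "q \<le> q ^ k" using prime_gt_0_nat[of q] self_le_power[of q k] by (simp add: Suc_leI)
      ultimately show "p \<in> ?P" using d by (auto simp: aprimedivisor_prime_power)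
    qed
  qed auto
  also have "\<dots> \<le> (\<Sum>p\<in>?P. ln (real N))"
  proof (rule sum_mono)
    fix p assume p: "p \<in> ?P"
    then have p2: "p \<ge> 2" using prime_ge_2_nat by auto
    define K where "K = nat \<lfloor>ln (real N) / ln (real p)\<rfloor>"
    have lp: "ln (real p) > 0" and lN: "ln (real N) \<ge> 0" using p p2 by auto
    have sub: "{d\<in>?A. aprimedivisor d = p} \<subseteq> (\<lambda>k. p ^ k) ` {1..K}"
    proof
      fix d assume d: "d \<in> {d\<in>?A. aprimedivisor d = p}"
      then obtain q k where qk: "prime q" "k > 0" "d = q ^ k" by (auto simp: primepow_def)
      then have "q = p" using d by (auto simp: aprimedivisor_prime_power)
      then have "real p ^ k \<le> real N" using d qk by (metis (mono_tags, lifting) atLeastAtMost_iff mem_Collect_eq of_nat_le_iff of_nat_power)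
      then have "ln (real p ^ k) \<le> ln (real N)" using p p2 by (subst ln_le_cancel_iff) auto
      then have "real k * ln (real p) \<le> ln (real N)" using p2 by (simp add: ln_realpow)
      then have "real k \<le> ln (real N) / ln (real p)" using lp by (simp add: field_simps)
      then have "k \<le> K" unfolding K_def by linarith
      then show "d \<in> (\<lambda>k. p ^ k) ` {1..K}" using qk \<open>q = p\<close> by auto
    qed
    have "(\<Sum>d\<in>{d\<in>?A. aprimedivisor d = p}. ln (real (aprimedivisor d))) = real (card {d\<in>?A. aprimedivisor d = p}) * ln (real p)"
      by simp
    also have "\<dots> \<le> real K * ln (real p)"
    proof (rule mult_right_mono)
      have "card {d\<in>?A. aprimedivisor d = p} \<le> card ((\<lambda>k. p ^ k) ` {1..K})" by (rule card_mono[OF _ sub]) auto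
      also have "\<dots> \<le> K" using card_image_le[of "{1..K}" "\<lambda>k. p ^ k"] by simp
      finally show "real (card {d\<in>?A. aprimedivisor d = p}) \<le> real K" by simp
    qed (use lp in simp)
    also have "\<dots> \<le> ln (real N) / ln (real p) * ln (real p)"
      using lp lN by (intro mult_right_mono) (auto simp: K_def)
    finally show "(\<Sum>d\<in>{d\<in>?A. aprimedivisor d = p}. ln (real (aprimedivisor d))) \<le> ln (real N)" using lp by simp
  qed
  finally show ?thesis by (simp add: prime_count_def)
qed

text \<open>In the logarithm of the central binomial coefficient all weights are non-negative, and a
  prime between \<open>n\<close> and \<open>2 * n\<close> has weight exactly 1. The coefficient
  itself is at most \<open>2 ^ (2 * n)\<close>.\<close>

lemma chebyshev_theta_double: "chebyshev_theta (2 * n) \<le> chebyshev_theta n + 2 * real n * ln 2"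
proof -
  let ?Q = "{p. prime p \<and> n < p \<and> p \<le> 2 * n}"
  have "chebyshev_theta (2 * n) = (\<Sum>p \<in> {p. prime p \<and> p \<le> n} \<union> ?Q. ln (real p))"
    unfolding chebyshev_theta_def by (rule sum.cong) auto
  also have "\<dots> = chebyshev_theta n + (\<Sum>p\<in>?Q. ln (real p))"
    unfolding chebyshev_theta_def by (rule sum.union_disjoint) auto
  also have "(\<Sum>p\<in>?Q. ln (real p)) = (\<Sum>p\<in>?Q. mangoldt p * (real (2 * n div p) - 2 * real (n div p)))"
  proof (rule sum.cong)
    fix p assume p: "p \<in> ?Q"
    then have "n div p = 0" "2 * n div p \<ge> 1" by (auto simp: div_greater_zero_iff Suc_le_eq)
    then have "real (2 * n div p) - 2 * real (n div p) = 1" using double_div_bounds[of n p] by simp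
    then show "ln (real p) = mangoldt p * (real (2 * n div p) - 2 * real (n div p))" using p by simp
  qed simp
  also have "\<dots> \<le> (\<Sum>d=1..2*n. mangoldt d * (real (2 * n div d) - 2 * real (n div d)))"
  proof (rule sum_mono2)
    fix d
    have "real (2 * (n div d)) \<le> real (2 * n div d)" using double_div_bounds(1)[of n d] by (rule of_nat_mono)
    then have "0 \<le> real (2 * n div d) - 2 * real (n div d)"
      by (simp only: of_nat_mult of_nat_numeral diff_ge_0_iff_ge)
    then show "0 \<le> mangoldt d * (real (2 * n div d) - 2 * real (n div d))"
      by (rule mult_nonneg_nonneg[OF mangoldt_nonneg])
    show "?Q \<subseteq> {1..2 * n}" by auto
  qed (rule finite_atLeastAtMost)
  also have "\<dots> = ln (real ((2 * n) choose n))" by (rule ln_central_binomial_eq_sum_mangoldt[of n, symmetric])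
  also have "\<dots> \<le> ln (2 ^ (2 * n))"
  proof (rule ln_mono)
    have "(2 * n) choose n \<le> 2 ^ (2 * n)"
    proof -
      have "(2 * n) choose n \<le> (\<Sum>k\<le>2 * n. (2 * n) choose k)" by (rule member_le_sum) auto
      then show ?thesis by (simp only: choose_row_sum)
    qed
    then show "real ((2 * n) choose n) \<le> 2 ^ (2 * n)" by (metis of_nat_le_iff of_nat_numeral of_nat_power)
  qed auto
  also have "\<dots> = 2 * real n * ln 2" by (simp add: ln_realpow)
  finally show ?thesis by simp
qed

lemma chebyshev_theta_mono: "m \<le> n \<Longrightarrow> chebyshev_theta m \<le> chebyshev_theta n"
  unfolding chebyshev_theta_def by (rule sum_mono2) (auto intro!: ln_ge_zero simp: Suc_le_eq prime_gt_0_nat)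

text \<open>Repeated halving. The constant 4 leaves room for rounding up an odd
  \<open>n = 2 * m + 1\<close>: what is needed is \<open>6 * (m + 1) \<le> 8 * m + 4\<close>, true
  for \<open>m \<ge> 1\<close>.\<close>

lemma chebyshev_theta_le: "chebyshev_theta n \<le> 4 * real n * ln 2"
proof (induction n rule: less_induct)
  case (less n)
  consider "n \<le> 1" | m where "m \<ge> 1" "n = 2 * m" | m where "m \<ge> 1" "n = 2 * m + 1"
  proof (cases "n \<le> 1")
    case False
    then show ?thesis
    proof (cases "even n")
      case True
      then obtain m where "n = 2 * m" by (rule evenE)
      moreover from this False have "m \<ge> 1" by linarith
      ultimately show ?thesis by (rule that(2)[rotated])
    next
      case False
      then obtain m where "n = 2 * m + 1" by (rule oddE)
      moreover from this \<open>\<not> n \<le> 1\<close> have "m \<ge> 1" by linarith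
      ultimately show ?thesis by (rule that(3)[rotated])
    qed
  qed (rule that(1))
  then show ?case
  proof cases
    case 1
    then have e: "{p. prime p \<and> p \<le> n} = {}" by (auto dest!: prime_ge_2_nat)
    show ?thesis unfolding chebyshev_theta_def e by simp
  next
    case 2
    then have "chebyshev_theta m \<le> 4 * real m * ln 2" by (intro less.IH) auto
    then have "chebyshev_theta n \<le> 6 * (real m * ln 2)" using chebyshev_theta_double[of m] 2 by simp
    also have "\<dots> \<le> 8 * (real m * ln 2)" by simp
    finally show ?thesis using 2 by simp
  next
    case 3
    then have "chebyshev_theta (m + 1) \<le> 4 * real (m + 1) * ln 2" by (intro less.IH) auto
    moreover have "chebyshev_theta n \<le> chebyshev_theta (2 * (m + 1))" by (rule chebyshev_theta_mono) (use 3 in auto)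
    ultimately have "chebyshev_theta n \<le> 6 * (real m + 1) * ln 2"
      using chebyshev_theta_double[of "m + 1"] by (simp add: algebra_simps)
    also have "\<dots> \<le> (8 * real m + 4) * ln 2" using 3 by (intro mult_right_mono) auto
    finally show ?thesis using 3 by (simp add: algebra_simps)
  qed
qed

text \<open>At most \<open>sqrt n\<close> primes lie below \<open>sqrt n\<close>, and each larger
  one contributes at least \<open>ln n / 2\<close> to \<open>chebyshev_theta n\<close>.\<close>

lemma prime_count_upper:
  assumes "n \<ge> 2"
  shows "real (prime_count n) \<le> 10 * real n / ln (real n)"
proof -
  define r where "r = sqrt (real n)"
  have r: "r > 1" "ln r = ln (real n) / 2" using assms by (auto simp: r_def ln_sqrt)
  have lr: "ln r > 0" using r by simp
  let ?A = "{p. prime p \<and> real p \<le> r}" and ?B = "{p. prime p \<and> r < real p \<and> p \<le> n}"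
  have fA: "finite ?A" by (rule finite_subset[of _ "{..nat \<lfloor>r\<rfloor>}"]) (auto simp: le_nat_floor)
  have "prime_count n \<le> card (?A \<union> ?B)" unfolding prime_count_def using fA by (intro card_mono) auto
  also have "\<dots> \<le> card ?A + card ?B" by (rule card_Un_le)
  finally have 1: "real (prime_count n) \<le> real (card ?A) + real (card ?B)" by linarith
  have "card ?A \<le> card {1..nat \<lfloor>r\<rfloor>}" by (rule card_mono) (auto simp: le_nat_floor Suc_le_eq prime_gt_0_nat)
  then have A: "real (card ?A) \<le> r" using r by simp linarith
  have "real (card ?B) * ln r \<le> (\<Sum>p\<in>?B. ln (real p))"
    using r by (intro sum_bounded_below) auto
  also have "\<dots> \<le> chebyshev_theta n"
    unfolding chebyshev_theta_def by (rule sum_mono2) (auto intro!: ln_ge_zero simp: Suc_le_eq prime_gt_0_nat)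
  also have "\<dots> \<le> 4 * real n * ln 2" by (rule chebyshev_theta_le)
  also have "\<dots> \<le> 4 * real n * 1" using ln_2_less_1 by (intro mult_left_mono) auto
  finally have B: "real (card ?B) \<le> 4 * real n / ln r" using lr by (simp add: field_simps)
  have "r \<le> real n / ln r"
  proof -
    have "ln r \<le> r" using ln_le_minus_one[of r] r by simp
    then have "r * ln r \<le> r * r" using r by (intro mult_left_mono) auto
    also have "r * r = real n" by (simp add: r_def)
    finally show ?thesis using lr by (simp add: field_simps)
  qed
  then have "real (prime_count n) \<le> 5 * (real n / ln r)" using 1 A B by simp
  also have "5 * (real n / ln r) = 10 * real n / (2 * ln r)" by simp
  also have "2 * ln r = ln (real n)" using r by simp
  finally show ?thesis .
qed

text \<open>No weight in the logarithm of the central binomial coefficient exceeds 1, so that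
  logarithm is at most \<open>prime_count n * ln n\<close>. It is at least \<open>m / 3\<close> by
  \<open>4 ^ m / (2 * m)\<close>, and \<open>m \<ge> n / 3\<close> gives the 9.\<close>

lemma prime_count_lower:
  assumes "n \<ge> 3"
  shows "real (prime_count n) \<ge> real n / (9 * ln (real n))"
proof -
  define m where "m = n div 2"
  have m: "m \<ge> 1" "2 * m \<le> n" "real m \<ge> real n / 3" using assms by (auto simp: m_def)
  have ln4: "ln (real ((2 * m) choose m)) \<ge> real m / 3"
  proof -
    have "4 ^ m / (2 * real m) \<le> real ((2 * m) choose m)" using central_binomial_lower_bound[of m] m by simp
    then have "ln (4 ^ m / (2 * real m)) \<le> ln (real ((2 * m) choose m))" using m by (intro ln_mono) auto
    moreover have "ln (4 ^ m / (2 * real m)) = real m * ln 4 - ln 2 - ln (real m)"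
      using m by (simp add: ln_div ln_mult ln_realpow)
    moreover have "ln (4::real) = 2 * ln 2" using ln_realpow[of 2 2] by simp
    moreover have "real m * (2 * ln 2) \<ge> real m * (4 / 3)" using ln2_ge_two_thirds by (intro mult_left_mono) auto
    moreover have "ln (real m) \<le> real m - 1" using m by (intro ln_le_minus_one) auto
    ultimately show ?thesis using ln_2_less_1 by simp
  qed
  have "ln (real ((2 * m) choose m)) = (\<Sum>d=1..2*m. mangoldt d * (real (2 * m div d) - 2 * real (m div d)))"
    by (rule ln_central_binomial_eq_sum_mangoldt)
  also have "\<dots> \<le> (\<Sum>d=1..2*m. mangoldt d * 1)"
  proof (intro sum_mono mult_left_mono mangoldt_nonneg)
    fix d
    have "real (2 * m div d) \<le> real (2 * (m div d) + 1)" using double_div_bounds(2)[of m d] by (rule of_nat_mono)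
    then show "real (2 * m div d) - 2 * real (m div d) \<le> 1" by simp
  qed
  also have "\<dots> \<le> (\<Sum>d=1..n. mangoldt d * 1)" using m by (intro sum_mono2) (auto simp: mangoldt_nonneg)
  also have "\<dots> \<le> real (prime_count n) * ln (real n)" using sum_mangoldt_le[of n] by simp
  finally have "real n / 9 \<le> real (prime_count n) * ln (real n)" using ln4 m by simp
  moreover have "ln (real n) > 0" using assms by simp
  ultimately show ?thesis by (simp add: field_simps)
qed

subsection \<open>Gaussian sums over primes\<close>

lemma prime_count_real_upper:
  fixes x :: real
  assumes "x \<ge> 4"
  shows "real (prime_count (nat \<lfloor>x\<rfloor>)) \<le> 20 * x / ln x"
proof -
  define n where "n = nat \<lfloor>x\<rfloor>"
  have n: "real n \<le> x" "real n \<ge> x / 2" "n \<ge> 2" using assms unfolding n_def by linarith+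
  have "sqrt x * 2 \<le> sqrt x * sqrt x" using assms by (intro mult_left_mono real_le_rsqrt) auto
  then have "sqrt x \<le> x / 2" using assms by simp
  then have "ln (sqrt x) \<le> ln (real n)" using n assms by (intro ln_mono) auto
  then have ln: "ln x / 2 \<le> ln (real n)" using assms by (simp add: ln_sqrt)
  have lx: "ln x > 0" using assms by simp
  have "real (prime_count n) \<le> 10 * real n / ln (real n)" by (rule prime_count_upper[OF n(3)])
  also have "\<dots> \<le> 10 * x / (ln x / 2)" using n ln lx by (intro frac_le) auto
  finally show ?thesis by (simp add: n_def)
qed

lemma prime_count_real_lower:
  fixes x :: real
  assumes "x \<ge> 3"
  shows "x / (18 * ln x) \<le> real (prime_count (nat \<lfloor>x\<rfloor>))"
proof -
  define n where "n = nat \<lfloor>x\<rfloor>"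
  have n: "real n \<le> x" "real n \<ge> x / 2" "n \<ge> 3" using assms unfolding n_def by linarith+
  have "x / (18 * ln x) = (x / 2) / (9 * ln x)" by simp
  also have "\<dots> \<le> real n / (9 * ln (real n))"
    using n assms by (intro frac_le mult_left_mono ln_mono) auto
  also have "\<dots> \<le> real (prime_count n)" by (rule prime_count_lower[OF n(3)])
  finally show ?thesis by (simp add: n_def)
qed

lemma prime_count_eq_card_real: "prime_count (nat \<lfloor>x\<rfloor>) = card {p. prime p \<and> real p \<le> x}"
proof -
  have "{p. prime p \<and> p \<le> nat \<lfloor>x\<rfloor>} = {p. prime p \<and> real p \<le> x}"
  proof (intro Collect_cong conj_cong refl)
    fix p :: nat assume "prime p"
    then have "p > 0" by (rule prime_gt_0_nat)
    then show "p \<le> nat \<lfloor>x\<rfloor> \<longleftrightarrow> real p \<le> x" by linarith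
  qed
  then show ?thesis by (simp add: prime_count_def)
qed

lemma finite_primes_real: "finite {p::nat. prime p \<and> real p \<le> x}"
  by (rule finite_subset[of _ "{..nat \<lfloor>x\<rfloor>}"]) (auto simp: le_nat_floor)

text \<open>Partial summation against \<open>prime_count\<close>, carried out as an induction on
  \<open>N\<close> with the negative boundary term at \<open>m\<close> dropped. The upper Chebyshev
  bound then makes the differences telescope.\<close>

lemma sum_primes_inverse_square:
  assumes "3 \<le> m" "m \<le> N"
  shows "(\<Sum>p | prime p \<and> m < p \<and> p \<le> N. 1 / real p ^ 2) \<le> 30 / (real m * ln (real m))"
proof -
  have "(\<Sum>p | prime p \<and> m < p \<and> p \<le> N. 1 / real p ^ 2) \<le> real (prime_count N) / real N ^ 2 +
      (\<Sum>n=m..<N. real (prime_count n) * (1 / real n ^ 2 - 1 / real (Suc n) ^ 2))"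
    using assms(2)
  proof (induction N rule: dec_induct)
    case (step N)
    let ?S = "\<lambda>N. \<Sum>p | prime p \<and> m < p \<and> p \<le> N. 1 / real p ^ 2"
    define a where "a = 1 / real N ^ 2"
    define b where "b = 1 / real (Suc N) ^ 2"
    have fin: "finite {p::nat. prime p \<and> m < p \<and> p \<le> N}" "finite {p::nat. prime p \<and> p \<le> N}" by auto
    have 1: "?S (Suc N) = ?S N + (if prime (Suc N) then b else 0)"
    proof (cases "prime (Suc N)")
      case True
      then have "{p. prime p \<and> m < p \<and> p \<le> Suc N} = insert (Suc N) {p. prime p \<and> m < p \<and> p \<le> N}"
        using step by (auto simp: le_Suc_eq)
      then show ?thesis using True fin by (simp add: b_def)
    next
      case False
      then have "{p. prime p \<and> m < p \<and> p \<le> Suc N} = {p. prime p \<and> m < p \<and> p \<le> N}"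
        by (auto simp: le_Suc_eq)
      then show ?thesis using False by simp
    qed
    have 2: "real (prime_count (Suc N)) = real (prime_count N) + (if prime (Suc N) then 1 else 0)"
    proof (cases "prime (Suc N)")
      case True
      then have "{p. prime p \<and> p \<le> Suc N} = insert (Suc N) {p. prime p \<and> p \<le> N}" by (auto simp: le_Suc_eq)
      then show ?thesis using True fin by (simp add: prime_count_def)
    next
      case False
      then have "{p. prime p \<and> p \<le> Suc N} = {p. prime p \<and> p \<le> N}" by (auto simp: le_Suc_eq)
      then show ?thesis using False by (simp add: prime_count_def)
    qed
    have IH: "?S N \<le> real (prime_count N) * a + (\<Sum>n=m..<N. real (prime_count n) * (1 / real n ^ 2 - 1 / real (Suc n) ^ 2))"
      using step.IH by (simp add: a_def)
    have "real (prime_count (Suc N)) / real (Suc N) ^ 2 = real (prime_count (Suc N)) * b" by (simp add: b_def)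
    moreover have "(\<Sum>n=m..<Suc N. real (prime_count n) * (1 / real n ^ 2 - 1 / real (Suc n) ^ 2)) =
        (\<Sum>n=m..<N. real (prime_count n) * (1 / real n ^ 2 - 1 / real (Suc n) ^ 2)) + real (prime_count N) * (a - b)"
      using step by (simp add: a_def b_def)
    ultimately show ?case unfolding 1 2 using IH by (auto simp: algebra_simps)
  next
    case base
    have e: "{p. prime p \<and> m < p \<and> p \<le> m} = {}" by auto
    show ?case unfolding e by simp
  qed
  also have "\<dots> \<le> 10 / ln (real m) * (1 / real N) + (\<Sum>n=m..<N. 10 / ln (real m) * (2 * (1 / real n - 1 / real (Suc n))))"
  proof (intro add_mono sum_mono)
    have u: "real (prime_count n) \<le> 10 / ln (real m) * real n" if "m \<le> n" for n
    proof -
      have "real (prime_count n) \<le> 10 * real n / ln (real n)" using that assms by (intro prime_count_upper) auto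
      also have "\<dots> \<le> 10 * real n / ln (real m)" using that assms by (intro divide_left_mono ln_mono) auto
      finally show ?thesis by simp
    qed
    have "real (prime_count N) / real N ^ 2 \<le> (10 / ln (real m) * real N) / real N ^ 2"
      using u[OF assms(2)] by (intro divide_right_mono) auto
    also have "\<dots> = 10 / ln (real m) * (1 / real N)" using assms by (simp add: power2_eq_square)
    finally show "real (prime_count N) / real N ^ 2 \<le> 10 / ln (real m) * (1 / real N)" .
    fix n assume n: "n \<in> {m..<N}"
    have n0: "real n > 0" using n assms by simp
    have gen: "1 / a - 1 / b = (b - a) / (a * b)" if "a \<noteq> 0" "b \<noteq> 0" for a b :: real
      using that by (simp add: field_simps)
    have d: "1 / real n ^ 2 - 1 / real (Suc n) ^ 2 = (2 * real n + 1) / (real n ^ 2 * real (Suc n) ^ 2)"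
    proof -
      have "1 / real n ^ 2 - 1 / real (Suc n) ^ 2 = (real (Suc n) ^ 2 - real n ^ 2) / (real n ^ 2 * real (Suc n) ^ 2)"
        by (rule gen) (use n0 in auto)
      also have "real (Suc n) ^ 2 - real n ^ 2 = 2 * real n + 1" by (simp add: power2_eq_square algebra_simps)
      finally show ?thesis .
    qed
    have d0: "1 / real n ^ 2 - 1 / real (Suc n) ^ 2 \<ge> 0" unfolding d by simp
    have "real (prime_count n) * (1 / real n ^ 2 - 1 / real (Suc n) ^ 2) \<le> (10 / ln (real m) * real n) * (1 / real n ^ 2 - 1 / real (Suc n) ^ 2)"
      using u[of n] n d0 by (intro mult_right_mono) auto
    also have "\<dots> = 10 / ln (real m) * (real n * (1 / real n ^ 2 - 1 / real (Suc n) ^ 2))" by simp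
    also have "\<dots> \<le> 10 / ln (real m) * (2 * (1 / real n - 1 / real (Suc n)))"
    proof (rule mult_left_mono)
      have "real n * (1 / real n ^ 2 - 1 / real (Suc n) ^ 2) = (2 * real n + 1) / (real n * real (Suc n) ^ 2)"
        unfolding d using n0 by (simp add: power2_eq_square)
      also have "\<dots> \<le> (2 * real (Suc n)) / (real n * real (Suc n) ^ 2)" using n0 by (intro divide_right_mono) auto
      also have "\<dots> = 2 * (1 / (real n * real (Suc n)))"
      proof -
        have "2 * M / (a * M\<^sup>2) = 2 * (1 / (a * M))" if "M \<noteq> 0" for a M :: real
          using that by (simp add: power2_eq_square)
        then show ?thesis by (metis of_nat_0_eq_iff old.nat.distinct(2))
      qed
      also have "1 / (real n * real (Suc n)) = 1 / real n - 1 / real (Suc n)"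
        using gen[of "real n" "real (Suc n)"] n0 by simp
      finally show "real n * (1 / real n ^ 2 - 1 / real (Suc n) ^ 2) \<le> 2 * (1 / real n - 1 / real (Suc n))" .
    qed (use assms in auto)
    finally show "real (prime_count n) * (1 / real n ^ 2 - 1 / real (Suc n) ^ 2) \<le> 10 / ln (real m) * (2 * (1 / real n - 1 / real (Suc n)))" .
  qed
  also have "\<dots> = 10 / ln (real m) * (1 / real N + 2 * (\<Sum>n=m..<N. 1 / real n - 1 / real (Suc n)))"
    by (simp add: sum_distrib_left distrib_left)
  also have "(\<Sum>n=m..<N. 1 / real n - 1 / real (Suc n)) = 1 / real m - 1 / real N"
    using sum_Suc_diff'[OF assms(2), of "\<lambda>n. - (1 / real n)"] by simp
  also have "10 / ln (real m) * (1 / real N + 2 * (1 / real m - 1 / real N)) \<le> 10 / ln (real m) * (3 * (1 / real m))"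
    using assms by (intro mult_left_mono) (auto simp: field_simps)
  finally show ?thesis by (simp add: mult.commute)
qed

text \<open>The modulus of \<open>n powr (- s)\<close> on \<open>Re s = \<sigma>\<close> times the
  bump of \<open>mkernel_fourier\<close> at frequency \<open>ln x\<close>.\<close>

definition gweight :: "real \<Rightarrow> real \<Rightarrow> nat \<Rightarrow> real" where
  "gweight \<sigma> x n = real n powr (- \<sigma>) * exp (- ((ln x - ln (real n))\<^sup>2) / 2)"

lemma gweight_nonneg: "gweight \<sigma> x n \<ge> 0"
  by (simp add: gweight_def)

text \<open>Counts primes in the window from \<open>x / V\<close> to \<open>x\<close>, which must be
  wide because the Chebyshev constants are far apart. Since
  \<open>ln (x / V) \<ge> ln x / 2\<close>, at most \<open>40 * x / (V * ln x)\<close> primes lie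
  below it; with \<open>V = 40 * 36\<close> this is half of the lower bound
  \<open>x / (18 * ln x)\<close>.\<close>

lemma gweight_main_part:
  fixes x V \<sigma> :: real
  defines "V \<equiv> 1440"
  assumes x: "x \<ge> V\<^sup>2" and \<sigma>: "0 < \<sigma>" and W: "W \<ge> 1"
  shows "exp (- ((ln V)\<^sup>2) / 2) / 36 * (x powr (1 - \<sigma>) / ln x) \<le> (\<Sum>p | prime p \<and> real p \<le> W * x. gweight \<sigma> x p)"
proof -
  have x0: "x \<ge> 1440 * 1440" using x by (simp add: V_def power2_eq_square)
  have lx: "ln x > 0" using x0 by simp
  let ?A = "{p. prime p \<and> x / V < real p \<and> real p \<le> x}"
  let ?B = "{p::nat. prime p \<and> real p \<le> x / V}"
  have e: "{p. prime p \<and> real p \<le> x} = ?A \<union> ?B" using x0 by (auto simp: V_def)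
  have "card {p. prime p \<and> real p \<le> x} \<le> card ?A + card ?B" unfolding e by (rule card_Un_le)
  then have "x / (18 * ln x) \<le> real (card ?A) + real (card ?B)"
    using prime_count_real_lower[of x] x0 unfolding prime_count_eq_card_real by linarith
  moreover have "real (card ?B) \<le> x / (36 * ln x)"
  proof -
    have "real (card ?B) \<le> 20 * (x / V) / ln (x / V)"
      using prime_count_real_upper[of "x / V"] x0 unfolding prime_count_eq_card_real by (simp add: V_def)
    also have "\<dots> \<le> 20 * (x / V) / (ln x / 2)"
    proof (intro divide_left_mono)
      have "ln (V\<^sup>2) \<le> ln x" using x by (intro ln_mono) (auto simp: V_def)
      moreover have "ln (V\<^sup>2) = 2 * ln V" by (subst ln_realpow) (auto simp: V_def)
      ultimately have "2 * ln V \<le> ln x" by simp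
      then show "ln x / 2 \<le> ln (x / V)" using x0 by (simp add: ln_div V_def)
      then show "0 < ln (x / V) * (ln x / 2)" using lx by (intro mult_pos_pos) auto
    qed (use x0 in \<open>auto simp: V_def\<close>)
    also have "\<dots> = x / (36 * ln x)" by (simp add: V_def)
    finally show ?thesis .
  qed
  moreover have "x / (18 * ln x) = 2 * (x / (36 * ln x))" by simp
  ultimately have cA: "real (card ?A) \<ge> x / (36 * ln x)" by linarith
  have fA: "finite ?A" by (rule finite_subset[OF _ finite_primes_real[of x]]) auto
  define w where "w = x powr (- \<sigma>) * exp (- ((ln V)\<^sup>2) / 2)"
  have "exp (- ((ln V)\<^sup>2) / 2) / 36 * (x powr (1 - \<sigma>) / ln x) = x / (36 * ln x) * w"
    using powr_add[of x "- \<sigma>" 1] x0 by (simp add: w_def)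
  also have "\<dots> \<le> real (card ?A) * w" using cA by (intro mult_right_mono) (auto simp: w_def)
  also have "\<dots> \<le> (\<Sum>p\<in>?A. gweight \<sigma> x p)"
  proof (rule sum_bounded_below)
    fix p assume p: "p \<in> ?A"
    then have p0: "real p > 0" by (auto simp: prime_gt_0_nat)
    have "x powr (- \<sigma>) \<le> real p powr (- \<sigma>)" using p p0 \<sigma> by (intro powr_mono2') auto
    moreover have "exp (- ((ln V)\<^sup>2) / 2) \<le> exp (- ((ln x - ln (real p))\<^sup>2) / 2)"
    proof -
      have "ln (real p) \<le> ln x" using p p0 by (intro ln_mono) auto
      moreover have "ln (x / V) \<le> ln (real p)" using p p0 x0 by (intro ln_mono) (auto simp: V_def)
      ultimately have "0 \<le> ln x - ln (real p)" "ln x - ln (real p) \<le> ln V" using x0 by (auto simp: ln_div V_def)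
      then have "(ln x - ln (real p))\<^sup>2 \<le> (ln V)\<^sup>2" by (intro power_mono) auto
      then show ?thesis by simp
    qed
    ultimately show "w \<le> gweight \<sigma> x p" unfolding w_def gweight_def by (intro mult_mono) auto
  qed
  also have "\<dots> \<le> (\<Sum>p | prime p \<and> real p \<le> W * x. gweight \<sigma> x p)"
  proof (rule sum_mono2[OF finite_primes_real])
    have "x \<le> W * x" using W x0 mult_right_mono[of 1 W x] by simp
    then show "?A \<subseteq> {p. prime p \<and> real p \<le> W * x}" by auto
  qed (auto simp: gweight_nonneg)
  finally show ?thesis .
qed

lemma gweight_tail_part:
  fixes x W \<sigma> :: real
  assumes x: "x \<ge> 6" and \<sigma>: "0 < \<sigma>" and W: "W \<ge> 1"
  shows "(\<Sum>p | prime p \<and> W * x < real p \<and> p \<le> N. gweight \<sigma> x p) \<le> exp (- ((ln W)\<^sup>2) / 4) * (120 * exp 4) * (x powr (1 - \<sigma>) / ln x)"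
proof -
  define m where "m = nat \<lfloor>x\<rfloor>"
  have m: "real m \<le> x" "real m \<ge> x / 2" "m \<ge> 3" using x unfolding m_def by linarith+
  define c where "c = exp (- ((ln W)\<^sup>2) / 4) * exp 4 * x powr (2 - \<sigma>)"
  have c: "c \<ge> 0" by (simp add: c_def)
  have lx: "ln x > 0" using x by simp
  have "(\<Sum>p | prime p \<and> W * x < real p \<and> p \<le> N. gweight \<sigma> x p) \<le> (\<Sum>p | prime p \<and> W * x < real p \<and> p \<le> N. c * (1 / real p ^ 2))"
  proof (rule sum_mono)
    fix p assume p: "p \<in> {p. prime p \<and> W * x < real p \<and> p \<le> N}"
    have "x \<le> W * x" using W x mult_right_mono[of 1 W x] by simp
    then have px: "real p > x" using p by auto
    then have p0: "real p > 0" using x by simp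
    define y where "y = ln (real p) - ln x"
    have "ln (W * x) \<le> ln (real p)" using p x W by (intro ln_mono) auto
    then have y: "y \<ge> ln W" "ln W \<ge> 0" using x W by (auto simp: y_def ln_mult)
    have "(ln W)\<^sup>2 \<le> y\<^sup>2" using y by (intro power_mono) auto
    \<comment> \<open>Half of the Gaussian exponent gives the small factor in \<open>W\<close>; by
      this square the other half is at most \<open>4 - 2 * y\<close>, which gives
      \<open>(x / p)\<close> squared and a convergent sum over primes.\<close>
    moreover have "(y / 2 - 2)\<^sup>2 \<ge> 0" by simp
    then have "y\<^sup>2 / 4 - 2 * y + 4 \<ge> 0" by (simp add: power2_eq_square algebra_simps)
    ultimately have "- (y\<^sup>2) / 2 \<le> - ((ln W)\<^sup>2) / 4 + (4 - 2 * y)" by simp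
    then have "exp (- (y\<^sup>2) / 2) \<le> exp (- ((ln W)\<^sup>2) / 4) * (exp 4 * exp (- (2 * y)))"
      by (simp add: exp_add[symmetric])
    moreover have "exp (- (2 * y)) = x ^ 2 / real p ^ 2"
    proof -
      have ey: "exp y = real p / x" unfolding y_def exp_diff using p0 x by simp
      have "exp (- (2 * y)) = inverse ((exp y) ^ 2)" by (simp only: exp_minus exp_double)
      also have "\<dots> = x ^ 2 / real p ^ 2" unfolding ey by (simp add: power_divide)
      finally show ?thesis .
    qed
    moreover have "real p powr (- \<sigma>) \<le> x powr (- \<sigma>)" using px x \<sigma> by (intro powr_mono2') auto
    ultimately have "real p powr (- \<sigma>) * exp (- (y\<^sup>2) / 2) \<le> x powr (- \<sigma>) * (exp (- ((ln W)\<^sup>2) / 4) * (exp 4 * (x ^ 2 / real p ^ 2)))"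
      by (intro mult_mono) auto
    also have "\<dots> = c * (1 / real p ^ 2)"
      using powr_add[of x "- \<sigma>" 2] x by (simp add: c_def)
    also have "y\<^sup>2 = (ln x - ln (real p))\<^sup>2" by (simp add: y_def power2_commute)
    finally show "gweight \<sigma> x p \<le> c * (1 / real p ^ 2)" by (simp add: gweight_def)
  qed
  also have "\<dots> = c * (\<Sum>p | prime p \<and> W * x < real p \<and> p \<le> N. 1 / real p ^ 2)" by (simp add: sum_distrib_left)
  also have "\<dots> \<le> c * (120 / (x * ln x))"
  proof (rule mult_left_mono[OF _ c])
    have "(\<Sum>p | prime p \<and> W * x < real p \<and> p \<le> N. 1 / real p ^ 2) \<le> (\<Sum>p | prime p \<and> m < p \<and> p \<le> max N m. 1 / real p ^ 2)"
    proof (rule sum_mono2)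
      have "x \<le> W * x" using W x mult_right_mono[of 1 W x] by simp
      then have "m < p" if "W * x < real p" for p using m that by linarith
      then show "{p. prime p \<and> W * x < real p \<and> p \<le> N} \<subseteq> {p. prime p \<and> m < p \<and> p \<le> max N m}" by auto
    qed auto
    also have "\<dots> \<le> 30 / (real m * ln (real m))" by (rule sum_primes_inverse_square) (use m in auto)
    also have "\<dots> \<le> 30 / (x / 2 * (ln x / 2))"
    proof (rule divide_left_mono)
      have "sqrt x * 2 \<le> sqrt x * sqrt x" using x by (intro mult_left_mono real_le_rsqrt) auto
      then have "sqrt x \<le> x / 2" using x by simp
      then have "ln (sqrt x) \<le> ln (real m)" using m x by (intro ln_mono) auto
      then have "ln x / 2 \<le> ln (real m)" using x by (simp add: ln_sqrt)
      then show "x / 2 * (ln x / 2) \<le> real m * ln (real m)" using m x lx by (intro mult_mono) auto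
      show "0 < real m * ln (real m) * (x / 2 * (ln x / 2))" using m x lx by (intro mult_pos_pos) auto
    qed simp
    finally show "(\<Sum>p | prime p \<and> W * x < real p \<and> p \<le> N. 1 / real p ^ 2) \<le> 120 / (x * ln x)" by simp
  qed
  also have "\<dots> = exp (- ((ln W)\<^sup>2) / 4) * (120 * exp 4) * (x powr (1 - \<sigma>) / ln x)"
  proof -
    have "x powr (2 - \<sigma>) = x powr (1 - \<sigma>) * x" using x powr_add[of x "1 - \<sigma>" 1] by simp
    then show ?thesis using x by (simp add: c_def)
  qed
  finally show ?thesis .
qed

text \<open>The weighting anticipates the phases: cosines are at least 1/2 for primes up to
  \<open>W * x\<close>, where the approximation acts, and only at least -1 beyond. The head is at
  least \<open>4 * c\<close> in units of the main term, and \<open>W\<close> is chosen so that the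
  tail is at most \<open>c\<close>, leaving \<open>2 * c - c\<close>.\<close>

lemma gweight_prime_sum:
  obtains W c x0 :: real where "W \<ge> 1" "c > 0" "x0 \<ge> 6"
    "\<And>x \<sigma> N. x \<ge> x0 \<Longrightarrow> 0 < \<sigma> \<Longrightarrow>
       c * (x powr (1 - \<sigma>) / ln x) \<le> (\<Sum>p | prime p \<and> real p \<le> W * x. gweight \<sigma> x p) / 2
          - (\<Sum>p | prime p \<and> W * x < real p \<and> p \<le> N. gweight \<sigma> x p)"
proof -
  define c :: real where "c = exp (- ((ln 1440)\<^sup>2) / 2) / 36 / 4"
  have c: "c > 0" by (simp add: c_def)
  have "((\<lambda>W::real. exp (- ((ln W)\<^sup>2) / 4) * (120 * exp 4)) \<longlongrightarrow> 0) at_top" by real_asymp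
  then have "\<forall>\<^sub>F W in at_top. exp (- ((ln W)\<^sup>2) / 4) * (120 * exp 4) < c" using c by (rule order_tendstoD)
  then have "\<forall>\<^sub>F W in at_top. exp (- ((ln W)\<^sup>2) / 4) * (120 * exp 4) < c \<and> W \<ge> 1"
    using eventually_ge_at_top by (rule eventually_conj)
  then obtain W :: real where W: "exp (- ((ln W)\<^sup>2) / 4) * (120 * exp 4) < c" "W \<ge> 1"
    using eventually_happens by fastforce
  show ?thesis
  proof (rule that[of W c "1440\<^sup>2"])
    fix x \<sigma> :: real and N
    assume x: "1440\<^sup>2 \<le> x" and \<sigma>: "0 < \<sigma>"
    have x6: "x \<ge> 6" using x by (simp add: power2_eq_square)
    define q where "q = x powr (1 - \<sigma>) / ln x"
    have q: "q \<ge> 0" using x6 by (simp add: q_def)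
    have "4 * c * q \<le> (\<Sum>p | prime p \<and> real p \<le> W * x. gweight \<sigma> x p)"
      using gweight_main_part[OF x \<sigma> W(2)] by (simp add: c_def q_def)
    moreover have "(\<Sum>p | prime p \<and> W * x < real p \<and> p \<le> N. gweight \<sigma> x p) \<le> c * q"
    proof -
      have "(\<Sum>p | prime p \<and> W * x < real p \<and> p \<le> N. gweight \<sigma> x p) \<le> exp (- ((ln W)\<^sup>2) / 4) * (120 * exp 4) * q"
        unfolding q_def by (rule gweight_tail_part[OF x6 \<sigma> W(2)])
      also have "\<dots> \<le> c * q" using W q by (intro mult_right_mono) auto
      finally show ?thesis .
    qed
    ultimately show "c * (x powr (1 - \<sigma>) / ln x) \<le> (\<Sum>p | prime p \<and> real p \<le> W * x. gweight \<sigma> x p) / 2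
          - (\<Sum>p | prime p \<and> W * x < real p \<and> p \<le> N. gweight \<sigma> x p)"
      unfolding q_def[symmetric] by argo
  qed (use W c in auto)
qed

subsection \<open>Mean values of Dirichlet polynomials\<close>

lemma norm_integral_exp_le:
  fixes w V :: real
  assumes w: "w \<noteq> 0" and V: "V \<ge> 0"
  shows "norm (integral {0..V} (\<lambda>v. exp (\<i> * of_real (w * v)))) \<le> 2 / \<bar>w\<bar>"
proof -
  define c where "c = \<i> * complex_of_real w"
  have c: "c \<noteq> 0" "norm c = \<bar>w\<bar>" using w by (auto simp: c_def norm_mult)
  have e: "exp (\<i> * of_real (w * v)) = exp (c * of_real v)" for v by (simp add: c_def mult.assoc)
  let ?F = "\<lambda>v. exp (c * complex_of_real v) / c"
  have "((\<lambda>v. exp (\<i> * of_real (w * v))) has_integral (?F V - ?F 0)) {0..V}"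
  proof (rule fundamental_theorem_of_calculus[OF V])
    fix x
    have "((\<lambda>z. exp (c * z) / c) has_field_derivative exp (c * of_real x)) (at (of_real x))"
      using c by (auto intro!: derivative_eq_intros)
    from has_vector_derivative_real_field[OF this, of "{0..V}"]
    show "(?F has_vector_derivative exp (\<i> * of_real (w * x))) (at x within {0..V})" unfolding e .
  qed
  then have "integral {0..V} (\<lambda>v. exp (\<i> * of_real (w * v))) = ?F V - ?F 0" by (rule integral_unique)
  also have "norm \<dots> \<le> norm (?F V) + norm (?F 0)" by (rule norm_triangle_ineq4)
  also have "\<dots> = 2 / \<bar>w\<bar>"
    using e[symmetric] c by (simp add: norm_divide del: of_real_mult)
  finally show ?thesis .
qed

text \<open>Prepares the off-diagonal terms of the mean square. From
  \<open>ln y - ln x \<ge> (y - x) / y\<close> the left side is at most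
  \<open>sqrt (y / x) / (y - x)\<close>, and the arithmetic-geometric mean inequality replaces the
  root by \<open>1 + (y - x) / (2 * x)\<close>.\<close>

lemma inverse_sqrt_ln_diff_le:
  assumes "m \<ge> (1::nat)" "n \<ge> 1" "m \<noteq> n"
  shows "1 / (sqrt m * sqrt n * \<bar>ln (real m) - ln (real n)\<bar>) \<le> 1 / \<bar>real m - real n\<bar> + (1 / m + 1 / n) / 2"
  using assms
proof (induction m n rule: linorder_wlog)
  case (sym a b)
  then show ?case by (simp add: abs_minus_commute mult.commute add.commute)
next
  case (le m n)
  define x y where "x = real m" and "y = real n"
  have xy: "1 \<le> x" "x < y" using le by (auto simp: x_def y_def)
  have "ln (x / y) \<le> x / y - 1" using xy by (intro ln_le_minus_one) auto
  then have L: "ln y - ln x \<ge> (y - x) / y" using xy by (simp add: ln_div diff_divide_distrib)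
  have "1 / (sqrt x * sqrt y * \<bar>ln x - ln y\<bar>) = 1 / (sqrt x * sqrt y * (ln y - ln x))"
    using xy by simp
  also have "\<dots> \<le> 1 / (sqrt x * sqrt y * ((y - x) / y))"
    using xy L by (intro divide_left_mono mult_left_mono mult_pos_pos) auto
  also have "\<dots> = (sqrt y / sqrt x) / (y - x)"
    using xy by (simp add: field_simps)
  also have "\<dots> \<le> (1 + (y - x) / (2 * x)) / (y - x)"
  proof (rule divide_right_mono)
    have "sqrt y / sqrt x = sqrt (y / x * 1)" by (simp add: real_sqrt_divide)
    also have "\<dots> \<le> (y / x + 1) / 2" using xy by (intro arith_geo_mean_sqrt) auto
    also have "\<dots> = 1 + (y - x) / (2 * x)" using xy by (simp add: field_simps)
    finally show "sqrt y / sqrt x \<le> 1 + (y - x) / (2 * x)" .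
  qed (use xy in simp)
  also have "\<dots> = 1 / (y - x) + (1 / x) / 2" using xy by (simp add: field_simps)
  also have "\<dots> \<le> 1 / \<bar>x - y\<bar> + (1 / x + 1 / y) / 2" using xy by simp
  finally show ?case by (simp add: x_def y_def)
qed

lemma sum_inverse_dist_le:
  assumes "n \<in> {1..N}"
  shows "(\<Sum>m\<in>{1..N} - {n}. 1 / \<bar>real m - real n\<bar>) \<le> 2 * (\<Sum>k=1..N. 1 / real k)"
proof -
  have e: "{1..N} - {n} = {1..<n} \<union> {n<..N}" using assms by auto
  have "(\<Sum>m\<in>{1..N} - {n}. 1 / \<bar>real m - real n\<bar>) = (\<Sum>m\<in>{1..<n}. 1 / \<bar>real m - real n\<bar>) + (\<Sum>m\<in>{n<..N}. 1 / \<bar>real m - real n\<bar>)"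
    unfolding e by (rule sum.union_disjoint) auto
  also have "(\<Sum>m\<in>{1..<n}. 1 / \<bar>real m - real n\<bar>) = (\<Sum>k\<in>(\<lambda>m. n - m) ` {1..<n}. 1 / real k)"
    by (subst sum.reindex) (auto simp: inj_on_def of_nat_diff)
  also have "\<dots> \<le> (\<Sum>k=1..N. 1 / real k)" using assms by (intro sum_mono2) auto
  also have "(\<Sum>m\<in>{n<..N}. 1 / \<bar>real m - real n\<bar>) = (\<Sum>k\<in>(\<lambda>m. m - n) ` {n<..N}. 1 / real k)"
    by (subst sum.reindex) (auto simp: inj_on_def of_nat_diff)
  also have "\<dots> \<le> (\<Sum>k=1..N. 1 / real k)" using assms by (intro sum_mono2) auto
  finally show ?thesis by simp
qed

lemma of_nat_powr_vertical:
  "n > 0 \<Longrightarrow> complex_of_nat n powr (- Complex \<alpha> v) = of_nat n powr (- of_real \<alpha>) * exp (\<i> * of_real (- ln (real n) * v))"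
  by (simp add: powr_def exp_add[symmetric] Complex_eq algebra_simps Ln_of_nat)

text \<open>Squaring out, the diagonal gives \<open>V * H\<close> with the harmonic sum
  \<open>H\<close>. The off-diagonal part of column \<open>n\<close> is at most
  \<open>5 * H + N / n\<close>, which sums to \<open>6 * N * H\<close>. The loss of a logarithm
  against the sharp mean value theorem is harmless here.\<close>

lemma dirichlet_polynomial_mean_square:
  fixes a :: "nat \<Rightarrow> complex"
  assumes a: "\<And>n. norm (a n) \<le> 1" and \<alpha>: "\<alpha> \<ge> 1/2" and V: "V \<ge> 0"
  shows "integral {0..V} (\<lambda>v. (norm (\<Sum>n=1..N. a n * of_nat n powr (- Complex \<alpha> v)))\<^sup>2)
    \<le> (V + 6 * N) * (\<Sum>n=1..N. 1 / real n)"
proof -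
  define b where "b n = a n * of_nat n powr (- of_real \<alpha>)" for n
  define S where "S v = (\<Sum>n=1..N. a n * of_nat n powr (- Complex \<alpha> v))" for v
  define H where "H = (\<Sum>n=1..N. 1 / real n)"
  define w where "w m n = ln (real n) - ln (real m)" for m n :: nat
  define E where "E m n v = exp (\<i> * of_real (w m n * v))" for m n and v :: real
  have b: "norm (b n) \<le> 1 / sqrt n" if "n \<in> {1..N}" for n
  proof -
    have "norm (b n) \<le> 1 * real n powr (- \<alpha>)"
      using that a unfolding b_def norm_mult by (intro mult_mono) (auto simp: norm_of_nat_powr)
    also have "\<dots> \<le> real n powr (- (1/2))" using that \<alpha> by (simp, intro powr_mono) auto
    also have "\<dots> = 1 / sqrt n" using that powr_minus_divide[of "real n" "1/2"] powr_half_sqrt[of "real n"] by simp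
    finally show ?thesis .
  qed
  have Sb: "S v = (\<Sum>n=1..N. b n * exp (\<i> * of_real (- ln (real n) * v)))" for v
    unfolding S_def b_def by (intro sum.cong refl) (subst of_nat_powr_vertical, auto)
  have sq: "complex_of_real ((norm (S v))\<^sup>2) = (\<Sum>m=1..N. \<Sum>n=1..N. b m * cnj (b n) * E m n v)" for v
  proof -
    have "complex_of_real ((norm (S v))\<^sup>2) = S v * cnj (S v)" by (rule complex_norm_square)
    also have "\<dots> = (\<Sum>m=1..N. \<Sum>n=1..N. (b m * exp (\<i> * of_real (- ln (real m) * v))) * (cnj (b n) * exp (\<i> * of_real (ln (real n) * v))))"
      unfolding Sb cnj_sum sum_product by (simp add: exp_cnj)
    also have "\<dots> = (\<Sum>m=1..N. \<Sum>n=1..N. b m * cnj (b n) * E m n v)"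
    proof (intro sum.cong refl)
      fix m n
      have "E m n v = exp (\<i> * of_real (- ln (real m) * v)) * exp (\<i> * of_real (ln (real n) * v))"
        unfolding E_def w_def exp_add[symmetric] by (simp add: algebra_simps)
      then show "(b m * exp (\<i> * of_real (- ln (real m) * v))) * (cnj (b n) * exp (\<i> * of_real (ln (real n) * v))) = b m * cnj (b n) * E m n v"
        by simp
    qed
    finally show ?thesis .
  qed
  have Ei: "(\<lambda>v. c * E m n v) integrable_on {0..V}" for c m n
    unfolding E_def by (intro integrable_continuous_real continuous_intros)
  have Si: "(\<lambda>v. (norm (S v))\<^sup>2) integrable_on {0..V}"
    unfolding Sb by (intro integrable_continuous_real continuous_intros)
  have "complex_of_real (integral {0..V} (\<lambda>v. (norm (S v))\<^sup>2)) = integral {0..V} (\<lambda>v. complex_of_real ((norm (S v))\<^sup>2))"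
    using integral_linear[OF Si, of complex_of_real, OF bounded_linear_of_real] by (simp add: o_def)
  also have "\<dots> = (\<Sum>m=1..N. \<Sum>n=1..N. b m * cnj (b n) * integral {0..V} (E m n))"
    unfolding sq using Ei by (simp add: integral_sum integrable_sum)
  finally have I: "integral {0..V} (\<lambda>v. (norm (S v))\<^sup>2) = Re (\<Sum>m=1..N. \<Sum>n=1..N. b m * cnj (b n) * integral {0..V} (E m n))"
    by (metis Re_complex_of_real)
  define K where "K m n = (if m = n then V / n else 2 * (1 / \<bar>real m - real n\<bar> + (1 / real m + 1 / real n) / 2))" for m n :: nat
  have trm: "norm (b m * cnj (b n) * integral {0..V} (E m n)) \<le> K m n" if mn: "m \<in> {1..N}" "n \<in> {1..N}" for m n
  proof (cases "m = n")
    case True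
    have "E n n = (\<lambda>_. 1)" by (auto simp: E_def w_def)
    then have "norm (integral {0..V} (E n n)) = V" using V by simp
    moreover have "norm (b n) * norm (b n) \<le> 1 / sqrt n * (1 / sqrt n)" using b[OF mn(2)] by (intro mult_mono) auto
    then have "norm (b n) * norm (b n) \<le> 1 / real n" by simp
    ultimately show ?thesis using True V mult_right_mono[of "norm (b n) * norm (b n)" "1 / real n" V]
      by (simp add: K_def norm_mult)
  next
    case False
    have w0: "w m n \<noteq> 0" using False mn by (simp add: w_def)
    have "norm (b m * cnj (b n) * integral {0..V} (E m n)) = norm (b m) * norm (b n) * norm (integral {0..V} (E m n))"
      by (simp add: norm_mult)
    also have "\<dots> \<le> (1 / sqrt m) * (1 / sqrt n) * (2 / \<bar>w m n\<bar>)"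
      using b[OF mn(1)] b[OF mn(2)] norm_integral_exp_le[OF w0 V] unfolding E_def
      by (intro mult_mono) auto
    also have "\<dots> = 2 * (1 / (sqrt m * sqrt n * \<bar>ln (real m) - ln (real n)\<bar>))" by (simp add: w_def abs_minus_commute)
    also have "\<dots> \<le> 2 * (1 / \<bar>real m - real n\<bar> + (1 / real m + 1 / real n) / 2)"
      by (intro mult_left_mono inverse_sqrt_ln_diff_le) (use mn False in auto)
    also have "\<dots> = K m n" using False by (simp only: K_def if_False)
    finally show ?thesis .
  qed
  have "integral {0..V} (\<lambda>v. (norm (S v))\<^sup>2) \<le> norm (\<Sum>m=1..N. \<Sum>n=1..N. b m * cnj (b n) * integral {0..V} (E m n))"
    unfolding I by (rule complex_Re_le_cmod)
  also have "\<dots> \<le> (\<Sum>m=1..N. \<Sum>n=1..N. K m n)"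
    by (intro sum_norm_le) (use trm in auto)
  also have "\<dots> = (\<Sum>n=1..N. \<Sum>m=1..N. K m n)" by (rule sum.swap)
  also have "\<dots> \<le> (\<Sum>n=1..N. V / n + (4 * H + H + N / n))"
  proof (rule sum_mono)
    fix n assume n: "n \<in> {1..N}"
    have "(\<Sum>m=1..N. K m n) = K n n + (\<Sum>m\<in>{1..N} - {n}. K m n)" using n by (subst sum.remove[of _ n]) auto
    also have "(\<Sum>m\<in>{1..N} - {n}. K m n) = 2 * (\<Sum>m\<in>{1..N} - {n}. 1 / \<bar>real m - real n\<bar>) + (\<Sum>m\<in>{1..N} - {n}. 1 / real m + 1 / real n)"
      unfolding sum_distrib_left sum.distrib[symmetric] by (intro sum.cong) (auto simp: K_def)
    also have "(\<Sum>m\<in>{1..N} - {n}. 1 / real m + 1 / real n) \<le> (\<Sum>m\<in>{1..N}. 1 / real m + 1 / real n)"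
      by (rule sum_mono2) auto
    also have "\<dots> = H + N / n" by (simp add: H_def sum.distrib)
    also have "(\<Sum>m\<in>{1..N} - {n}. 1 / \<bar>real m - real n\<bar>) \<le> 2 * H"
      unfolding H_def by (rule sum_inverse_dist_le[OF n])
    finally show "(\<Sum>m=1..N. K m n) \<le> V / n + (4 * H + H + N / n)" by (simp add: K_def)
  qed
  also have "\<dots> = (V + 6 * N) * H"
  proof -
    have "(\<Sum>n=1..N. V / n) = V * H" "(\<Sum>n=1..N. real N / n) = N * H"
      by (simp_all add: H_def sum_distrib_left)
    then show ?thesis by (simp add: sum.distrib algebra_simps)
  qed
  finally show ?thesis by (simp add: S_def H_def)
qed

text \<open>Once \<open>M\<close> exceeds \<open>norm s + k\<close>, each of the \<open>k\<close>
  boundary terms is at most 1. In the remaining series two powers of the index are kept for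
  convergence; the others produce the high power of \<open>(norm s + k) / M\<close>.\<close>

lemma euler_tail_bound:
  assumes k: "k \<ge> 2" and s: "norm s + k \<le> M" "Re s \<ge> 0" and M: "M \<ge> 1"
  shows "norm (euler_tail k M s) \<le> k + ((norm s + k) / M) ^ k * M\<^sup>2 * (\<Sum>n. real (Suc n) powr (- 2))"
proof -
  have M0: "real M \<ge> 1" using M by simp
  have d: "norm (dpow j s (real M) / 2 ^ Suc j) \<le> 1" if j: "j < k" for j
  proof -
    have "norm (dpow j s (real M)) \<le> (norm s + j) ^ j * real M powr (- (Re s + j))"
      using s M0 by (intro norm_dpow_le) auto
    also have "\<dots> \<le> real M ^ j * real M powr (- real j)"
      using s M0 j by (intro mult_mono power_mono powr_mono) auto
    also have "\<dots> = 1" using M0 by (simp add: powr_minus powr_realpow)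
    finally have 1: "norm (dpow j s (real M)) \<le> 1" .
    have "norm (dpow j s (real M) / 2 ^ Suc j) = norm (dpow j s (real M)) / 2 ^ Suc j" by (simp add: norm_divide norm_power norm_mult)
    also have "\<dots> \<le> norm (dpow j s (real M)) / 1" by (intro divide_left_mono) (auto intro: one_le_power order_trans[of 1 2])
    finally show ?thesis using 1 by simp
  qed
  have "norm (\<Sum>j<k. dpow j s (real M) / 2 ^ Suc j) \<le> (\<Sum>j<k. 1)" by (intro sum_norm_le) (use d in auto)
  then have A: "norm (\<Sum>j<k. dpow j s (real M) / 2 ^ Suc j) \<le> k" by simp
  define c where "c = ((norm s + k) / M) ^ k * M\<^sup>2"
  have c: "c \<ge> 0" by (simp add: c_def)
  have sZ: "summable (\<lambda>n. c * real (Suc n) powr (- 2))" by (intro summable_mult summable_powr_Suc) simp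
  have t: "norm ((-1) ^ n * dpow k s (real M + real n)) \<le> c * real (Suc n) powr (- 2)" for n
  proof -
    have "norm ((-1) ^ n * dpow k s (real M + real n)) = norm (dpow k s (real M + real n))" by (simp add: norm_mult norm_power)
    also have "\<dots> \<le> (norm s + k) ^ k * (real M + real n) powr (- (Re s + k))"
      using s M0 by (intro norm_dpow_le) auto
    also have "\<dots> \<le> (norm s + k) ^ k * (real M powr (- (real k - 2)) * real (Suc n) powr (- 2))"
    proof (rule mult_left_mono)
      have "(real M + real n) powr (- (Re s + k)) \<le> (real M + real n) powr (- (real k - 2) + - 2)"
        using s M0 by (intro powr_mono) auto
      also have "\<dots> = (real M + real n) powr (- (real k - 2)) * (real M + real n) powr (- 2)" by (rule powr_add)
      also have "\<dots> \<le> real M powr (- (real k - 2)) * real (Suc n) powr (- 2)"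
        using M0 k by (intro mult_mono powr_mono2') auto
      finally show "(real M + real n) powr (- (Re s + k)) \<le> real M powr (- (real k - 2)) * real (Suc n) powr (- 2)" .
    qed auto
    also have "real M powr (- (real k - 2)) = M\<^sup>2 / real M ^ k"
      using M0 by (simp add: powr_diff powr_realpow powr_numeral)
    finally show ?thesis by (simp add: c_def power_divide)
  qed
  have sT: "summable (\<lambda>n. norm ((-1) ^ n * dpow k s (real M + real n)))"
    by (rule summable_comparison_test[OF _ sZ]) (use t in auto)
  have "norm (\<Sum>n. (-1) ^ n * dpow k s (real M + real n)) \<le> (\<Sum>n. norm ((-1) ^ n * dpow k s (real M + real n)))"
    by (rule summable_norm[OF sT])
  also have "\<dots> \<le> (\<Sum>n. c * real (Suc n) powr (- 2))" by (rule suminf_le[OF t sT sZ])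
  also have "\<dots> = c * (\<Sum>n. real (Suc n) powr (- 2))" by (intro suminf_mult summable_powr_Suc) simp
  finally have B: "norm (\<Sum>n. (-1) ^ n * dpow k s (real M + real n)) \<le> c * (\<Sum>n. real (Suc n) powr (- 2))" .
  have "norm ((\<Sum>n. (-1) ^ n * dpow k s (real M + real n)) / 2 ^ k) \<le> norm (\<Sum>n. (-1) ^ n * dpow k s (real M + real n)) / 1"
    unfolding norm_divide by (intro divide_left_mono) (auto simp: norm_power)
  then show ?thesis unfolding euler_tail_def
    using norm_triangle_le[OF add_mono[OF A order_trans[OF _ B]]] by (simp add: c_def)
qed

subsection \<open>The mollified second moment\<close>

lemma sum_inverse_le_ln:
  assumes "N \<ge> 1"
  shows "(\<Sum>n=1..N. 1 / real n) \<le> 1 + ln (real N)"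
  using assms
proof (induction N rule: dec_induct)
  case (step N)
  have "ln (real N / real (Suc N)) \<le> real N / real (Suc N) - 1" using step by (intro ln_le_minus_one) auto
  then have "1 / real (Suc N) \<le> ln (real (Suc N)) - ln (real N)" using step by (simp add: ln_div field_simps)
  then show ?case using step by simp
qed simp

lemma zeta_vertical_continuous: "a > 0 \<Longrightarrow> continuous_on {a..b} (\<lambda>v. zeta (Complex \<alpha> v))"
  by (rule continuous_on_compose2[OF holomorphic_on_imp_continuous_on[OF zeta_holomorphic]])
     (auto simp: Complex_eq intro!: continuous_intros simp: complex_eq_iff)

text \<open>Up to the factor \<open>1 - 2 powr (1 - s)\<close>, zeta is an alternating Dirichlet
  polynomial of length about \<open>T powr (1 + \<delta>)\<close> plus a bounded error, and a length
  only slightly above \<open>T\<close> costs only \<open>T powr \<delta>\<close> in the mean value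
  theorem.\<close>

lemma zeta_mean_square:
  assumes \<alpha>: "1/2 \<le> \<alpha>" "\<alpha> < 1" and \<epsilon>: "\<epsilon> > 0"
  shows "\<forall>\<^sub>F T in at_top. integral {1..2 * T} (\<lambda>v. (norm (zeta (Complex \<alpha> v)))\<^sup>2) \<le> T powr (1 + \<epsilon>)"
proof -
  define \<delta> where "\<delta> = \<epsilon> / 2"
  have \<delta>: "\<delta> > 0" using \<epsilon> by (simp add: \<delta>_def)
  \<comment> \<open>Makes \<open>\<delta> * k \<ge> 2 + 2 * \<delta>\<close>, so that the power
    \<open>T powr (- (\<delta> * k))\<close> absorbs the factor \<open>(Suc N)\<^sup>2\<close> in
    the error bound.\<close>
  define k where "k = nat \<lceil>2 / \<delta> + 2\<rceil>"
  have k: "real k \<ge> 2 / \<delta> + 2" "k \<ge> 2"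
    using \<delta> divide_pos_pos[of 2 \<delta>] unfolding k_def by linarith+
  then have k\<delta>: "\<delta> * real k \<ge> 2 + 2 * \<delta>" using \<delta> mult_left_mono[OF k(1), of \<delta>] by (simp add: algebra_simps)
  define Z where "Z = (\<Sum>n. real (Suc n) powr (- 2))"
  have Z: "Z \<ge> 0" unfolding Z_def by (intro suminf_nonneg summable_powr_Suc) auto
  define B where "B = real k + 4 ^ (k + 1) * Z"
  \<comment> \<open>On \<open>Re s = \<alpha> < 1\<close> the factor
    \<open>1 - 2 powr (1 - s)\<close> has modulus at least \<open>2 powr (1 - \<alpha>) - 1\<close>,
    which is positive.\<close>
  define c where "c = 1 / (2 powr (1 - \<alpha>) - 1)"
  have "(1::real) < 2 powr (1 - \<alpha>)" using \<alpha> by simp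
  then have c: "c > 0" by (simp add: c_def)
  have ev1: "\<forall>\<^sub>F T in at_top. 4 * T \<le> T powr (1 + \<delta>)" using \<delta> by real_asymp
  have ev2: "\<forall>\<^sub>F T in at_top. 1 + 2 * T + real k \<le> 4 * T" by real_asymp
  have ev3: "\<forall>\<^sub>F T in at_top. 2 * c\<^sup>2 * ((2 * T + 12 * T powr (1 + \<delta>)) * (1 + ln (2 * T powr (1 + \<delta>))) + 2 * T * B\<^sup>2) \<le> T powr (1 + \<epsilon>)"
  proof -
    have "((\<lambda>T. (2 * c\<^sup>2 * ((2 * T + 12 * T powr (1 + \<delta>)) * (1 + ln (2 * T powr (1 + \<delta>))) + 2 * T * B\<^sup>2)) / T powr (1 + 2 * \<delta>)) \<longlongrightarrow> 0) at_top"
      using \<delta> by real_asymp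
    then have "\<forall>\<^sub>F T in at_top. (2 * c\<^sup>2 * ((2 * T + 12 * T powr (1 + \<delta>)) * (1 + ln (2 * T powr (1 + \<delta>))) + 2 * T * B\<^sup>2)) / T powr (1 + 2 * \<delta>) < 1"
      by (rule order_tendstoD) simp
    then show ?thesis using eventually_gt_at_top[of 0]
      by eventually_elim (simp add: \<delta>_def pos_divide_less_eq)
  qed
  show ?thesis using ev1 ev2 ev3 eventually_ge_at_top[of 2]
  proof eventually_elim
    case (elim T)
    define X where "X = T powr (1 + \<delta>)"
    define N where "N = nat \<lceil>X\<rceil>"
    have X: "X \<ge> 4 * T" "X \<ge> 8" using elim by (auto simp: X_def)
    have N: "real N \<ge> X" "real (Suc N) \<le> 2 * X" "N \<ge> 1" using X unfolding N_def by linarith+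
    define S where "S v = (\<Sum>n=1..N. (-1) ^ Suc n * of_nat n powr (- Complex \<alpha> v))" for v
    have pt: "(norm (zeta (Complex \<alpha> v)))\<^sup>2 \<le> 2 * c\<^sup>2 * ((norm (S v))\<^sup>2 + B\<^sup>2)" if v: "v \<in> {1..2 * T}" for v
    proof -
      define s where "s = Complex \<alpha> v"
      have ns: "norm s \<le> 1 + 2 * T" using cmod_le[of s] v \<alpha> by (simp add: s_def)
      have "norm (euler_tail k (Suc N) s) \<le> k + ((norm s + k) / Suc N) ^ k * (real (Suc N))\<^sup>2 * Z"
        unfolding Z_def by (rule euler_tail_bound) (use k ns elim X N \<alpha> in \<open>auto simp: s_def\<close>)
      also have "\<dots> \<le> k + 4 ^ (k + 1) * Z"
      proof (intro add_left_mono mult_right_mono Z)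
        have "(norm s + k) / Suc N \<le> 4 * T / X" using ns elim X N by (intro frac_le) auto
        also have "\<dots> = 4 * T powr (- \<delta>)" using elim by (simp add: X_def powr_add powr_minus field_simps)
        finally have "((norm s + k) / Suc N) ^ k \<le> (4 * T powr (- \<delta>)) ^ k" by (intro power_mono) auto
        also have "\<dots> = 4 ^ k * T powr (- (\<delta> * k))" using elim by (simp add: power_mult_distrib powr_power mult.commute)
        also have "\<dots> \<le> 4 ^ k * T powr (- (2 + 2 * \<delta>))" using k\<delta> elim by (intro mult_left_mono powr_mono) auto
        finally have 1: "((norm s + k) / Suc N) ^ k \<le> 4 ^ k * T powr (- (2 + 2 * \<delta>))" .
        have "(real (Suc N))\<^sup>2 \<le> (2 * X)\<^sup>2" using N by (intro power_mono) auto
        also have "\<dots> = 4 * T powr (2 + 2 * \<delta>)" using elim by (simp add: X_def power_mult_distrib powr_power algebra_simps)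
        finally have "((norm s + k) / Suc N) ^ k * (real (Suc N))\<^sup>2 \<le> (4 ^ k * T powr (- (2 + 2 * \<delta>))) * (4 * T powr (2 + 2 * \<delta>))"
          using 1 by (intro mult_mono) auto
        also have "\<dots> = 4 ^ (k + 1) * (T powr (- (2 + 2 * \<delta>)) * T powr (2 + 2 * \<delta>))" by simp
        also have "\<dots> = 4 ^ (k + 1)" using elim by (simp add: powr_add[symmetric])
        finally show "((norm s + k) / Suc N) ^ k * (real (Suc N))\<^sup>2 \<le> 4 ^ (k + 1)" .
      qed
      finally have tl: "norm (euler_tail k (Suc N) s) \<le> B" by (simp add: B_def)
      have "(1 - 2 powr (1 - s)) * zeta s = S v + (-1) ^ N * euler_tail k (Suc N) s"
        using zeta_eq_euler_tail[of s k] euler_tail_split[of s k N] \<alpha> k by (simp add: s_def S_def)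
      then have "norm (1 - 2 powr (1 - s)) * norm (zeta s) \<le> norm (S v) + B"
        using tl norm_triangle_ineq[of "S v" "(-1) ^ N * euler_tail k (Suc N) s"]
        by (simp add: norm_mult[symmetric]) (simp add: norm_mult norm_power)
      moreover have "norm (1 - 2 powr (1 - s)) \<ge> 1 / c"
        using norm_triangle_ineq2[of "2 powr (1 - s)" 1] norm_of_real_powr[of 2 "1 - s"]
        by (simp add: c_def s_def norm_minus_commute)
      then have "1 / c * norm (zeta s) \<le> norm (1 - 2 powr (1 - s)) * norm (zeta s)" by (rule mult_right_mono) simp
      ultimately have "norm (zeta s) / c \<le> norm (S v) + B" by simp
      then have "norm (zeta s) \<le> c * (norm (S v) + B)" using c by (simp add: pos_divide_le_eq mult.commute)
      then have "(norm (zeta s))\<^sup>2 \<le> (c * (norm (S v) + B))\<^sup>2" by (rule power_mono) simp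
      also have "\<dots> = c\<^sup>2 * (norm (S v) + B)\<^sup>2" by (rule power_mult_distrib)
      also have "\<dots> \<le> c\<^sup>2 * (2 * ((norm (S v))\<^sup>2 + B\<^sup>2))"
        using sum_squares_bound[of "norm (S v)" B] by (intro mult_left_mono) (auto simp: power2_sum)
      finally show ?thesis by (simp add: s_def algebra_simps)
    qed
    have iS: "(\<lambda>v. (norm (S v))\<^sup>2) integrable_on {a..b}" for a b
      unfolding S_def Complex_eq by (intro integrable_continuous_real continuous_intros) auto
    have cS: "continuous_on A S" for A
      unfolding S_def Complex_eq by (intro continuous_intros) auto
    have "integral {1..2 * T} (\<lambda>v. (norm (zeta (Complex \<alpha> v)))\<^sup>2) \<le> integral {1..2 * T} (\<lambda>v. 2 * c\<^sup>2 * ((norm (S v))\<^sup>2 + B\<^sup>2))"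
    proof (rule integral_le[OF _ _ pt])
      show "(\<lambda>v. (norm (zeta (Complex \<alpha> v)))\<^sup>2) integrable_on {1..2 * T}"
        by (intro integrable_continuous_real continuous_intros zeta_vertical_continuous) simp
      show "(\<lambda>v. 2 * c\<^sup>2 * ((norm (S v))\<^sup>2 + B\<^sup>2)) integrable_on {1..2 * T}"
        by (intro integrable_continuous_real continuous_intros cS)
    qed
    also have "\<dots> = 2 * c\<^sup>2 * (integral {1..2 * T} (\<lambda>v. (norm (S v))\<^sup>2) + (2 * T - 1) * B\<^sup>2)"
    proof (rule integral_unique, intro has_integral_mult_right has_integral_add)
      show "((\<lambda>v. B\<^sup>2) has_integral (2 * T - 1) * B\<^sup>2) {1..2 * T}"
        using has_integral_const_real[of "B\<^sup>2" 1 "2 * T"] elim by simp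
    qed (rule integrable_integral iS)+
    also have "\<dots> \<le> 2 * c\<^sup>2 * ((2 * T + 12 * X) * (1 + ln (2 * X)) + 2 * T * B\<^sup>2)"
    proof (intro mult_left_mono add_mono)
      have "integral {1..2 * T} (\<lambda>v. (norm (S v))\<^sup>2) \<le> integral {0..2 * T} (\<lambda>v. (norm (S v))\<^sup>2)"
        using iS by (intro integral_subset_le) auto
      also have "\<dots> \<le> (2 * T + 6 * N) * (\<Sum>n=1..N. 1 / real n)"
        unfolding S_def by (rule dirichlet_polynomial_mean_square) (use \<alpha> elim in \<open>auto simp: norm_power\<close>)
      also have "\<dots> \<le> (2 * T + 12 * X) * (1 + ln (2 * X))"
      proof (rule mult_mono)
        have "(\<Sum>n=1..N. 1 / real n) \<le> 1 + ln (real N)" by (rule sum_inverse_le_ln[OF N(3)])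
        also have "\<dots> \<le> 1 + ln (2 * X)" using N X by (intro add_left_mono ln_mono) auto
        finally show "(\<Sum>n=1..N. 1 / real n) \<le> 1 + ln (2 * X)" .
      qed (use N X elim in \<open>auto intro!: sum_nonneg\<close>)
      finally show "integral {1..2 * T} (\<lambda>v. (norm (S v))\<^sup>2) \<le> (2 * T + 12 * X) * (1 + ln (2 * X))" .
    qed (auto intro!: mult_right_mono)
    also have "\<dots> \<le> T powr (1 + \<epsilon>)" using elim by (simp add: X_def)
    finally show ?case .
  qed
qed

definition mollifier :: "real \<Rightarrow> complex \<Rightarrow> complex" where
  "mollifier T s = (\<Sum>n=1..nat \<lfloor>T\<rfloor>. moebius n * of_nat n powr (- s))"

lemma mollifier_holomorphic: "mollifier T holomorphic_on A"
  unfolding mollifier_def by (intro holomorphic_intros) auto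

lemma norm_mollifier_le:
  assumes "Re s \<ge> 0" "T \<ge> 0"
  shows "norm (mollifier T s) \<le> T"
proof -
  have "norm (mollifier T s) \<le> (\<Sum>n=1..nat \<lfloor>T\<rfloor>. 1)"
    unfolding mollifier_def
  proof (rule sum_norm_le)
    fix n assume n: "n \<in> {1..nat \<lfloor>T\<rfloor>}"
    then have "norm (complex_of_nat n powr (- s)) = real n powr (- Re s)" by (subst norm_of_nat_powr) auto
    also have "\<dots> \<le> real n powr 0" using n assms by (intro powr_mono) auto
    finally have "norm (complex_of_nat n powr (- s)) \<le> 1" using n by simp
    then show "norm (moebius n * complex_of_nat n powr (- s)) \<le> 1"
      using norm_moebius_le[of n] by (simp add: norm_mult mult_le_one)
  qed
  also have "\<dots> \<le> T" using assms by simp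
  finally show ?thesis .
qed

text \<open>The product is split by the arithmetic-geometric mean inequality into the second moments
  of zeta and of the mollifier. The latter has length at most \<open>T\<close> and coefficients
  bounded by 1, so its second moment is \<open>O (T * ln T)\<close>.\<close>

lemma mollified_zeta_mean:
  assumes \<alpha>: "1/2 \<le> \<alpha>" "\<alpha> < 1" and \<epsilon>: "\<epsilon> > 0"
  shows "\<forall>\<^sub>F T in at_top. integral {1..2 * T} (\<lambda>v. norm (zeta (Complex \<alpha> v) * mollifier T (Complex \<alpha> v) - 1)) \<le> T powr (1 + \<epsilon>)"
proof -
  have "((\<lambda>T. (2 * T + (T powr (1 + \<epsilon> / 2) + 8 * T * (1 + ln T)) / 2) / T powr (1 + \<epsilon>)) \<longlongrightarrow> 0) at_top"
    using \<epsilon> by real_asymp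
  then have "\<forall>\<^sub>F T in at_top. (2 * T + (T powr (1 + \<epsilon> / 2) + 8 * T * (1 + ln T)) / 2) / T powr (1 + \<epsilon>) < 1"
    by (rule order_tendstoD) simp
  moreover have "\<forall>\<^sub>F T in at_top. integral {1..2 * T} (\<lambda>v. (norm (zeta (Complex \<alpha> v)))\<^sup>2) \<le> T powr (1 + \<epsilon> / 2)"
    by (rule zeta_mean_square) (use assms in auto)
  ultimately show ?thesis using eventually_ge_at_top[of 2]
  proof eventually_elim
    case (elim T)
    define z where "z v = zeta (Complex \<alpha> v)" for v
    define m where "m v = mollifier T (Complex \<alpha> v)" for v
    have cz: "continuous_on {1..2 * T} z" unfolding z_def by (rule zeta_vertical_continuous) simp
    have cm: "continuous_on A m" for A
      unfolding m_def mollifier_def Complex_eq by (intro continuous_intros) auto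
    have iz: "(\<lambda>v. (norm (z v))\<^sup>2) integrable_on {1..2 * T}"
      by (intro integrable_continuous_real continuous_intros cz)
    have im: "(\<lambda>v. (norm (m v))\<^sup>2) integrable_on {a..b}" for a b
      by (intro integrable_continuous_real continuous_intros cm)
    have "integral {1..2 * T} (\<lambda>v. norm (z v * m v - 1)) \<le> integral {1..2 * T} (\<lambda>v. 1 + ((norm (z v))\<^sup>2 + (norm (m v))\<^sup>2) / 2)"
    proof (rule integral_le)
      show "(\<lambda>v. norm (z v * m v - 1)) integrable_on {1..2 * T}"
        by (intro integrable_continuous_real continuous_intros cz cm)
      show "(\<lambda>v. 1 + ((norm (z v))\<^sup>2 + (norm (m v))\<^sup>2) / 2) integrable_on {1..2 * T}"
        by (intro integrable_continuous_real continuous_intros cz cm) auto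
      show "norm (z v * m v - 1) \<le> 1 + ((norm (z v))\<^sup>2 + (norm (m v))\<^sup>2) / 2" for v
        using norm_triangle_ineq4[of "z v * m v" 1] sum_squares_bound[of "norm (z v)" "norm (m v)"]
        unfolding norm_mult norm_one by argo
    qed
    also have "\<dots> = (2 * T - 1) + (integral {1..2 * T} (\<lambda>v. (norm (z v))\<^sup>2) + integral {1..2 * T} (\<lambda>v. (norm (m v))\<^sup>2)) / 2"
    proof (rule integral_unique, intro has_integral_add has_integral_divide)
      show "((\<lambda>v. 1) has_integral 2 * T - 1) {1..2 * T}"
        using has_integral_const_real[of "1::real" 1 "2 * T"] elim by simp
    qed (rule integrable_integral iz im)+
    also have "\<dots> \<le> 2 * T + (T powr (1 + \<epsilon> / 2) + 8 * T * (1 + ln T)) / 2"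
    proof (intro add_mono divide_right_mono)
      show "integral {1..2 * T} (\<lambda>v. (norm (z v))\<^sup>2) \<le> T powr (1 + \<epsilon> / 2)" using elim by (simp add: z_def)
      define N where "N = nat \<lfloor>T\<rfloor>"
      have N: "N \<ge> 1" "real N \<le> T" using elim unfolding N_def by linarith+
      have "integral {1..2 * T} (\<lambda>v. (norm (m v))\<^sup>2) \<le> integral {0..2 * T} (\<lambda>v. (norm (m v))\<^sup>2)"
        using im by (intro integral_subset_le) auto
      also have "\<dots> \<le> (2 * T + 6 * N) * (\<Sum>n=1..N. 1 / real n)"
        unfolding m_def mollifier_def N_def by (rule dirichlet_polynomial_mean_square) (use \<alpha> elim norm_moebius_le in auto)
      also have "\<dots> \<le> (2 * T + 6 * T) * (1 + ln T)"
      proof (rule mult_mono)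
        have "(\<Sum>n=1..N. 1 / real n) \<le> 1 + ln (real N)" by (rule sum_inverse_le_ln[OF N(1)])
        also have "\<dots> \<le> 1 + ln T" using N by (intro add_left_mono ln_mono) auto
        finally show "(\<Sum>n=1..N. 1 / real n) \<le> 1 + ln T" .
      qed (use N elim in \<open>auto intro!: sum_nonneg\<close>)
      finally show "integral {1..2 * T} (\<lambda>v. (norm (m v))\<^sup>2) \<le> 8 * T * (1 + ln T)" by simp
    qed auto
    also have "\<dots> \<le> T powr (1 + \<epsilon>)" using elim by (simp add: pos_divide_less_eq)
    finally show ?case by (simp add: z_def m_def)
  qed
qed

subsection \<open>Zero density\<close>

lemma zeta_line_2_bound:
  obtains K where "K > 0" "\<And>s. Re s = 2 \<Longrightarrow> norm (zeta s) \<le> K"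
proof
  let ?K = "exp (2 * (\<Sum>n. real n powr (- 2)))"
  show "?K > 0" by simp
  fix s :: complex assume s: "Re s = 2"
  have "norm (zeta s) = exp (Re (log_zeta_series s))"
    using exp_log_zeta_series[of s] s norm_exp_eq_Re[of "log_zeta_series s"] by simp
  also have "\<dots> \<le> ?K"
    using norm_log_zeta_series_le[of s] s complex_Re_le_cmod[of "log_zeta_series s"] by simp
  finally show "norm (zeta s) \<le> ?K" .
qed

lemma mollified_zeta_line_2:
  assumes K: "\<And>s. Re s = 2 \<Longrightarrow> norm (zeta s) \<le> K" and T: "T \<ge> 2" and s: "Re s = 2"
  shows "norm (zeta s * mollifier T s - 1) \<le> K * (2 / T)"
proof -
  have z: "zeta s \<noteq> 0" using s by (intro zeta_nonzero) auto
  define N where "N = nat \<lfloor>T\<rfloor>"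
  have N: "N \<ge> 1" "real N \<ge> T / 2" using T unfolding N_def by linarith+
  have "zeta s * mollifier T s - 1 = zeta s * (mollifier T s - 1 / zeta s)" using z by (simp add: algebra_simps)
  also have "norm \<dots> \<le> K * (1 / N)"
    unfolding norm_mult mollifier_def N_def[symmetric]
    using K[OF s] moebius_sum_approx[OF s N(1)] by (intro mult_mono order_trans[OF norm_ge_zero K[OF s]]) auto
  also have "\<dots> \<le> K * (2 / T)"
  proof (rule mult_left_mono)
    have "1 / real N \<le> 1 / (T / 2)" using N T by (intro divide_left_mono) auto
    then show "1 / real N \<le> 2 / T" by simp
  qed (rule order_trans[OF norm_ge_zero K[OF s]])
  finally show ?thesis .
qed

text \<open>At a zero of zeta the function \<open>zeta M - 1\<close> equals -1. Cauchy's formula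
  around the zero with weight \<open>exp (L * (w - s1) + (w - s1)\<^sup>2)\<close> recovers this
  value. The right side is negligible because the function is \<open>O (1 / T)\<close> there, and
  the Gaussian removes the horizontal sides at height \<open>ln T\<close>. So the integral on the
  left side cannot be small.\<close>

lemma zero_detection:
  assumes \<alpha>: "1/2 \<le> \<alpha>" "\<alpha> < b" "b < 1"
  obtains C where "C > 0" "\<forall>\<^sub>F T in at_top. \<forall>t s1. 5 * ln T \<le> t \<longrightarrow> t \<le> T \<longrightarrow> b \<le> Re s1 \<longrightarrow> Re s1 \<le> 1 \<longrightarrow>
     \<bar>Im s1 - t\<bar> \<le> 3 * ln T \<longrightarrow> zeta s1 = 0 \<longrightarrow>
     1 \<le> C * T powr (- (b - \<alpha>) / 2) * integral {t - 4 * ln T..t + 4 * ln T} (\<lambda>v. norm (zeta (Complex \<alpha> v) * mollifier T (Complex \<alpha> v) - 1))"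
proof -
  obtain C1 where C1: "C1 > 0" "\<And>s. Re s \<ge> 1/2 \<Longrightarrow> \<bar>Im s\<bar> \<ge> 1 \<Longrightarrow> norm (zeta s) \<le> C1 * norm s"
    using zeta_growth[of "1/2"] by auto
  obtain C2 where C2: "C2 > 0" "\<And>s. Re s = 2 \<Longrightarrow> norm (zeta s) \<le> C2"
    using zeta_line_2_bound by blast
  define C where "C = exp (9/4) / (b - \<alpha>)"
  have C: "C > 0" using \<alpha> by (simp add: C_def)
  have "((\<lambda>T. 2 * ln T * (C2 * (2 / T) * (T powr (3/4) * exp (9/4)))) \<longlongrightarrow> 0) at_top" by real_asymp
  then have ev1: "\<forall>\<^sub>F T in at_top. 2 * ln T * (C2 * (2 / T) * (T powr (3/4) * exp (9/4))) < 1" by (rule order_tendstoD) simp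
  have "((\<lambda>T. 3 * ((1 + C1 * (6 * T) * T) * (T powr (3/4) * exp (9/4 - (ln T)\<^sup>2)))) \<longlongrightarrow> 0) at_top" by real_asymp
  then have ev2: "\<forall>\<^sub>F T in at_top. 3 * ((1 + C1 * (6 * T) * T) * (T powr (3/4) * exp (9/4 - (ln T)\<^sup>2))) < 1" by (rule order_tendstoD) simp
  have ev3: "\<forall>\<^sub>F T::real in at_top. ln T \<ge> 1" by real_asymp
  have "\<forall>\<^sub>F T in at_top. \<forall>t s1. 5 * ln T \<le> t \<longrightarrow> t \<le> T \<longrightarrow> b \<le> Re s1 \<longrightarrow> Re s1 \<le> 1 \<longrightarrow>
     \<bar>Im s1 - t\<bar> \<le> 3 * ln T \<longrightarrow> zeta s1 = 0 \<longrightarrow>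
     1 \<le> C * T powr (- (b - \<alpha>) / 2) * integral {t - 4 * ln T..t + 4 * ln T} (\<lambda>v. norm (zeta (Complex \<alpha> v) * mollifier T (Complex \<alpha> v) - 1))"
    using ev1 ev2 ev3 eventually_ge_at_top[of 2]
  proof eventually_elim
    case (elim T)
    show ?case
    proof (intro allI impI)
      fix t and s1 :: complex
      define Y where "Y = ln T"
      assume t: "5 * ln T \<le> t" "t \<le> T" and s1: "b \<le> Re s1" "Re s1 \<le> 1" "\<bar>Im s1 - t\<bar> \<le> 3 * ln T" "zeta s1 = 0"
      have Y: "Y \<ge> 1" "Y \<le> T" using elim ln_le_minus_one[of T] by (auto simp: Y_def)
      have im: "Im s1 \<ge> 2 * Y" "\<bar>Im s1 - t\<bar> \<le> 3 * Y" using t s1 unfolding Y_def by linarith+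
      define f where "f w = zeta w * mollifier T w - 1" for w
      define S where "S = half_strip 0 (Im s1) (Y + 1)"
      \<comment> \<open>With \<open>exp L = T powr (1/2)\<close> the weight is at most a constant
        times \<open>T powr (3/4)\<close> on \<open>Re w = 2\<close>, less than the gain
        \<open>1 / T\<close>, and still saves \<open>T powr ((b - \<alpha>) / 2)\<close> on
        \<open>Re w = \<alpha>\<close>.\<close>
      define L where "L = Y / 2"
      have L: "L \<ge> 0" "exp (L * (3/2)) = T powr (3/4)" using Y elim by (auto simp: L_def Y_def powr_def)
      define k where "k w = exp (of_real L * (w - s1) + (w - s1)\<^sup>2)" for w
      have nk: "norm (k w) = exp (L * (Re w - Re s1) + ((Re w - Re s1)\<^sup>2 - (Im w - Im s1)\<^sup>2))" for w
        by (simp add: k_def norm_exp_eq_Re power2_eq_square)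
      define F where "F w = f w * k w" for w
      define G where "G w = F w / (w - s1)" for w
      have hol: "F holomorphic_on S"
        unfolding F_def f_def k_def S_def
        by (intro holomorphic_intros zeta_holomorphic_half_strip mollifier_holomorphic) (use im Y in auto)
      let ?a = "Complex \<alpha> (Im s1 - Y)" and ?c = "Complex 2 (Im s1 + Y)"
      have box: "s1 \<in> box ?a ?c" using s1 \<alpha> Y by (auto simp: in_box_complex_iff)
      have sub: "cbox ?a ?c \<subseteq> S" using \<alpha> Y by (auto simp: S_def half_strip_def in_cbox_complex_iff)
      have pim: "path_image (rectpath ?a ?c) \<subseteq> S - {s1}"
        using sub box \<alpha> Y by (subst path_image_rectpath_cbox_minus_box) auto
      have s1S: "s1 \<in> interior S"
        using sub box box_subset_cbox[of ?a ?c] unfolding S_def interior_open[OF open_half_strip] by blast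
      have "(G has_contour_integral (2 * pi * \<i> * winding_number (rectpath ?a ?c) s1 * F s1)) (rectpath ?a ?c)"
        unfolding G_def
        by (rule Cauchy_integral_formula_convex_simple[OF _ hol s1S _ pim]) (auto simp: S_def convex_half_strip)
      moreover have "F s1 = -1" using s1 by (simp add: F_def f_def k_def)
      ultimately have ci: "contour_integral (rectpath ?a ?c) G = - (2 * pi * \<i>)"
        using winding_number_rectpath[OF box] by (auto dest: contour_integral_unique)
      have contG: "continuous_on (S - {s1}) G"
        unfolding G_def by (intro continuous_intros holomorphic_on_imp_continuous_on holomorphic_on_subset[OF hol]) auto
      have fb: "norm (f w) \<le> 1 + C1 * (6 * T) * T" if w: "1/2 \<le> Re w" "Re w \<le> 2" "\<bar>Im w - Im s1\<bar> \<le> Y" for w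
      proof -
        have iw: "Im w \<ge> 1" "Im w \<le> 5 * T" using w im Y t by (auto simp: abs_le_iff)
        have "norm w \<le> 2 + 5 * T" using cmod_le[of w] w iw by simp
        then have nw: "norm w \<le> 6 * T" using elim by simp
        have "norm (zeta w) \<le> C1 * norm w" using w iw by (intro C1) auto
        also have "\<dots> \<le> C1 * (6 * T)" using nw C1 by (intro mult_left_mono) auto
        finally have z: "norm (zeta w) \<le> C1 * (6 * T)" .
        have m: "norm (mollifier T w) \<le> T" using w elim by (intro norm_mollifier_le) auto
        have "norm (f w) \<le> norm (zeta w * mollifier T w) + norm (1::complex)" unfolding f_def by (rule norm_triangle_ineq4)
        also have "\<dots> \<le> C1 * (6 * T) * T + 1"
          unfolding norm_mult using z m C1 elim by (intro add_mono mult_mono) auto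
        finally show ?thesis by simp
      qed
      define h where "h = (1 + C1 * (6 * T) * T) * (T powr (3/4) * exp (9/4 - (ln T)\<^sup>2))"
      have h: "3 * h < 1" using elim by (simp add: h_def)
      have x2: "(x - Re s1)\<^sup>2 \<le> 9/4" if "\<alpha> \<le> x" "x \<le> 2" for x
      proof -
        have "\<bar>x - Re s1\<bar> \<le> 3/2" unfolding abs_le_iff using that s1 \<alpha> by linarith
        then have "\<bar>x - Re s1\<bar>\<^sup>2 \<le> (3/2)\<^sup>2" by (intro power_mono) auto
        then show ?thesis by (simp add: power2_eq_square)
      qed
      have LX: "L * (x - Re s1) \<le> L * (3/2)" if "x \<le> 2" for x
        using L s1 \<alpha> that by (intro mult_left_mono) auto
      have hb: "norm (G (Complex x y)) \<le> h" if xy: "\<alpha> \<le> x" "x \<le> 2" "y = Im s1 - Y \<or> y = Im s1 + Y" for x y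
      proof -
        have y2: "(y - Im s1)\<^sup>2 = Y\<^sup>2" using xy by (auto simp: power2_eq_square)
        have "norm (k (Complex x y)) \<le> exp (L * (3/2) + (9/4 - (ln T)\<^sup>2))"
        proof -
          have "L * (x - Re s1) + ((x - Re s1)\<^sup>2 - (y - Im s1)\<^sup>2) \<le> L * (3/2) + (9/4 - (ln T)\<^sup>2)"
            unfolding y2 Y_def[symmetric] using x2[OF xy(1,2)] LX[OF xy(2)] by linarith
          then show ?thesis by (simp only: nk complex.sel exp_le_cancel_iff)
        qed
        also have "\<dots> = T powr (3/4) * exp (9/4 - (ln T)\<^sup>2)" by (simp only: exp_add L)
        finally have kb: "norm (k (Complex x y)) \<le> T powr (3/4) * exp (9/4 - (ln T)\<^sup>2)" .
        have "norm (F (Complex x y)) \<le> h" unfolding F_def h_def norm_mult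
          using fb[of "Complex x y"] kb xy \<alpha> Y C1 elim by (intro mult_mono) auto
        moreover have "1 \<le> norm (Complex x y - s1)"
          using abs_Im_le_cmod[of "Complex x y - s1"] xy Y by auto
        ultimately have "norm (F (Complex x y)) \<le> h * norm (Complex x y - s1)"
          using mult_left_mono[of 1 "norm (Complex x y - s1)" h] order_trans[OF norm_ge_zero, of "F (Complex x y)" h] by simp
        moreover have "norm (Complex x y - s1) > 0" using \<open>1 \<le> norm (Complex x y - s1)\<close> by linarith
        ultimately show ?thesis unfolding G_def norm_divide by (simp add: pos_divide_le_eq)
      qed
      define I2 where "I2 = integral {Im s1 - Y..Im s1 + Y} (\<lambda>y. G (Complex 2 y))"
      define I1 where "I1 = integral {Im s1 - Y..Im s1 + Y} (\<lambda>y. G (Complex \<alpha> y))"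
      have "norm (contour_integral (rectpath ?a ?c) G - (\<i> * I2 - \<i> * I1)) \<le> 2 * h * (2 - \<alpha>)"
        unfolding I2_def I1_def
        by (rule rectpath_vertical_sides) (use \<alpha> Y hb continuous_on_subset[OF contG pim] in auto)
      moreover have "2 * h * (2 - \<alpha>) \<le> 3 * h"
      proof -
        have "h \<ge> 0" using C1 elim by (simp add: h_def)
        then show ?thesis using \<alpha> mult_left_mono[of "2 - \<alpha>" "3/2" "2 * h"] by simp
      qed
      ultimately have "norm (- (2 * pi * \<i>) - (\<i> * I2 - \<i> * I1)) \<le> 1" unfolding ci using h by linarith
      moreover have "norm (- (2 * pi * \<i>)) = 2 * pi" by (simp add: norm_mult)
      moreover have "norm (- (2 * pi * \<i>)) \<le> norm (- (2 * pi * \<i>) - (\<i> * I2 - \<i> * I1)) + norm (\<i> * I2 - \<i> * I1)"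
        using norm_triangle_ineq[of "- (2 * pi * \<i>) - (\<i> * I2 - \<i> * I1)" "\<i> * I2 - \<i> * I1"] by simp
      moreover have "norm (\<i> * I2 - \<i> * I1) \<le> norm I2 + norm I1"
        using norm_triangle_ineq4[of "\<i> * I2" "\<i> * I1"] by (simp add: norm_mult)
      \<comment> \<open>Since \<open>norm I2 < 1\<close> and \<open>pi > 3\<close>, this leaves
        \<open>norm I1 > 1\<close>.\<close>
      ultimately have pi: "2 * pi \<le> 1 + norm I2 + norm I1" by linarith
      have iG: "(\<lambda>y. G (Complex x y)) integrable_on {Im s1 - Y..Im s1 + Y}" if x: "x = \<alpha> \<or> x = 2" for x
      proof (intro integrable_continuous_real continuous_on_compose2[OF contG])
        show "continuous_on {Im s1 - Y..Im s1 + Y} (Complex x)" unfolding Complex_eq by (intro continuous_intros)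
        show "Complex x ` {Im s1 - Y..Im s1 + Y} \<subseteq> S - {s1}"
          using x \<alpha> s1 Y by (auto simp: S_def half_strip_def complex_eq_iff)
      qed
      have "norm I2 \<le> C2 * (2 / T) * (T powr (3/4) * exp (9/4)) * (Im s1 + Y - (Im s1 - Y))"
        unfolding I2_def
      proof (rule integral_bound)
        show "continuous_on {Im s1 - Y..Im s1 + Y} (\<lambda>y. G (Complex 2 y))"
        proof (rule continuous_on_compose2[OF contG])
          show "continuous_on {Im s1 - Y..Im s1 + Y} (Complex 2)" unfolding Complex_eq by (intro continuous_intros)
          show "Complex 2 ` {Im s1 - Y..Im s1 + Y} \<subseteq> S - {s1}"
            using s1 Y by (auto simp: S_def half_strip_def complex_eq_iff)
        qed
        fix y assume y: "y \<in> {Im s1 - Y..Im s1 + Y}"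
        have "norm (k (Complex 2 y)) \<le> exp (L * (3/2) + 9/4)"
        proof -
          have "L * (2 - Re s1) + ((2 - Re s1)\<^sup>2 - (y - Im s1)\<^sup>2) \<le> L * (3/2) + 9/4"
            using x2[of 2] LX[of 2] \<alpha> zero_le_power2[of "y - Im s1"] by linarith
          then show ?thesis by (simp only: nk complex.sel exp_le_cancel_iff)
        qed
        also have "\<dots> = T powr (3/4) * exp (9/4)" by (simp only: exp_add L)
        finally have kb: "norm (k (Complex 2 y)) \<le> T powr (3/4) * exp (9/4)" .
        have "norm (f (Complex 2 y)) \<le> C2 * (2 / T)"
          unfolding f_def using elim by (intro mollified_zeta_line_2 C2) auto
        then have "norm (F (Complex 2 y)) \<le> C2 * (2 / T) * (T powr (3/4) * exp (9/4))"
          unfolding F_def norm_mult using kb C2 elim by (intro mult_mono) auto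
        moreover have "1 \<le> norm (Complex 2 y - s1)"
          using abs_Re_le_cmod[of "Complex 2 y - s1"] s1 by auto
        moreover from this have "norm (F (Complex 2 y)) / norm (Complex 2 y - s1) \<le> norm (F (Complex 2 y)) / 1"
          by (intro divide_left_mono) auto
        ultimately show "norm (G (Complex 2 y)) \<le> C2 * (2 / T) * (T powr (3/4) * exp (9/4))"
          unfolding G_def norm_divide by linarith
      qed (use Y in auto)
      also have "\<dots> = 2 * ln T * (C2 * (2 / T) * (T powr (3/4) * exp (9/4)))" by (simp add: Y_def)
      also have "\<dots> < 1" using elim by simp
      finally have I2: "norm I2 < 1" .
      have cf: "continuous_on {x..y} (\<lambda>v. norm (f (Complex \<alpha> v)))" if "x \<ge> 1" for x y
        unfolding f_def using that
        by (intro continuous_intros zeta_vertical_continuous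
            continuous_on_compose2[OF holomorphic_on_imp_continuous_on[OF mollifier_holomorphic[of T UNIV]]])
           (auto simp: Complex_eq intro!: continuous_intros)
      have "norm I1 \<le> integral {Im s1 - Y..Im s1 + Y} (\<lambda>v. C * T powr (- (b - \<alpha>) / 2) * norm (f (Complex \<alpha> v)))"
        unfolding I1_def
      proof (rule integral_norm_bound_integral)
        show "(\<lambda>v. C * T powr (- (b - \<alpha>) / 2) * norm (f (Complex \<alpha> v))) integrable_on {Im s1 - Y..Im s1 + Y}"
          by (intro integrable_continuous_real continuous_intros cf) (use im Y in auto)
        fix y assume y: "y \<in> {Im s1 - Y..Im s1 + Y}"
        have "norm (k (Complex \<alpha> y)) \<le> exp (L * (- (b - \<alpha>)) + 9/4)"
        proof -
          have "L * (\<alpha> - Re s1) \<le> L * (- (b - \<alpha>))" using L s1 by (intro mult_left_mono) auto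
          then have "L * (\<alpha> - Re s1) + ((\<alpha> - Re s1)\<^sup>2 - (y - Im s1)\<^sup>2) \<le> L * (- (b - \<alpha>)) + 9/4"
            using x2[of \<alpha>] \<alpha> zero_le_power2[of "y - Im s1"] by linarith
          then show ?thesis by (simp only: nk complex.sel exp_le_cancel_iff)
        qed
        also have "\<dots> = exp (9/4) * T powr (- (b - \<alpha>) / 2)"
          using elim by (simp add: powr_def L_def Y_def exp_add[symmetric] algebra_simps)
        finally have kb: "norm (k (Complex \<alpha> y)) \<le> exp (9/4) * T powr (- (b - \<alpha>) / 2)" .
        have d: "b - \<alpha> \<le> norm (Complex \<alpha> y - s1)"
          using abs_Re_le_cmod[of "Complex \<alpha> y - s1"] s1 by auto
        have "norm (G (Complex \<alpha> y)) = norm (f (Complex \<alpha> y)) * norm (k (Complex \<alpha> y)) / norm (Complex \<alpha> y - s1)"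
          by (simp add: G_def F_def norm_divide norm_mult)
        also have "\<dots> \<le> norm (f (Complex \<alpha> y)) * (exp (9/4) * T powr (- (b - \<alpha>) / 2)) / (b - \<alpha>)"
          using kb d \<alpha> by (intro frac_le mult_left_mono) auto
        finally show "norm (G (Complex \<alpha> y)) \<le> C * T powr (- (b - \<alpha>) / 2) * norm (f (Complex \<alpha> y))"
          by (simp add: C_def mult_ac)
      qed (use iG in auto)
      also have "\<dots> = C * T powr (- (b - \<alpha>) / 2) * integral {Im s1 - Y..Im s1 + Y} (\<lambda>v. norm (f (Complex \<alpha> v)))" by simp
      also have "\<dots> \<le> C * T powr (- (b - \<alpha>) / 2) * integral {t - 4 * ln T..t + 4 * ln T} (\<lambda>v. norm (f (Complex \<alpha> v)))"
      proof (intro mult_left_mono integral_subset_le)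
        show "{Im s1 - Y..Im s1 + Y} \<subseteq> {t - 4 * ln T..t + 4 * ln T}" using im unfolding Y_def by (auto simp: abs_le_iff)
        show "(\<lambda>v. norm (f (Complex \<alpha> v))) integrable_on {Im s1 - Y..Im s1 + Y}"
          by (intro integrable_continuous_real cf) (use im Y in auto)
        show "(\<lambda>v. norm (f (Complex \<alpha> v))) integrable_on {t - 4 * ln T..t + 4 * ln T}"
          by (intro integrable_continuous_real cf) (use t Y in \<open>auto simp: Y_def\<close>)
      qed (use C in auto)
      finally have "norm I1 \<le> C * T powr (- (b - \<alpha>) / 2) * integral {t - 4 * ln T..t + 4 * ln T} (\<lambda>v. norm (f (Complex \<alpha> v)))" .
      then show "1 \<le> C * T powr (- (b - \<alpha>) / 2) * integral {t - 4 * ln T..t + 4 * ln T} (\<lambda>v. norm (zeta (Complex \<alpha> v) * mollifier T (Complex \<alpha> v) - 1))"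
        unfolding f_def using pi I2 pi_gt3 by linarith
    qed
  qed
  with C show ?thesis using that by blast
qed

text \<open>A zero-density estimate in the form of a count of well-spaced points near zeros.\<close>

lemma spaced_zeros_bound:
  assumes b: "1/2 < b" "b < 1"
  shows "\<forall>\<^sub>F T in at_top. \<forall>D. finite D \<longrightarrow> D \<subseteq> {5 * ln T..T} \<longrightarrow>
     (\<forall>t\<in>D. \<forall>t'\<in>D. t \<noteq> t' \<longrightarrow> \<bar>t - t'\<bar> \<ge> 9 * ln T) \<longrightarrow>
     (\<forall>t\<in>D. \<exists>s. b \<le> Re s \<and> \<bar>Im s - t\<bar> \<le> 3 * ln T \<and> zeta s = 0) \<longrightarrow>
     real (card D) \<le> T powr (1 - (b - 1/2) / 8)"
proof -
  define \<eta> where "\<eta> = b - 1/2"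
  have \<eta>: "\<eta> > 0" using b by (simp add: \<eta>_def)
  \<comment> \<open>Exponents: detection saves \<open>(b - \<alpha>) / 2 = 3 * \<eta> / 8\<close>,
    the mean value loses \<open>\<eta> / 8\<close>, and another \<open>\<eta> / 8\<close> absorbs
    the constant \<open>C\<close>.\<close>
  define \<alpha> where "\<alpha> = 1/2 + \<eta> / 4"
  have \<alpha>: "1/2 \<le> \<alpha>" "\<alpha> < b" "\<alpha> < 1" using b by (auto simp: \<alpha>_def \<eta>_def field_simps)
  obtain C where C: "C > 0" and ev: "\<forall>\<^sub>F T in at_top. \<forall>t s1. 5 * ln T \<le> t \<longrightarrow> t \<le> T \<longrightarrow> b \<le> Re s1 \<longrightarrow> Re s1 \<le> 1 \<longrightarrow>
     \<bar>Im s1 - t\<bar> \<le> 3 * ln T \<longrightarrow> zeta s1 = 0 \<longrightarrow>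
     1 \<le> C * T powr (- (b - \<alpha>) / 2) * integral {t - 4 * ln T..t + 4 * ln T} (\<lambda>v. norm (zeta (Complex \<alpha> v) * mollifier T (Complex \<alpha> v) - 1))"
    using zero_detection[OF \<alpha>(1,2) b(2)] by blast
  have e8: "\<eta> / 8 > 0" using \<eta> by simp
  have "((\<lambda>T. C * T powr (1 - \<eta> / 4) / T powr (1 - \<eta> / 8)) \<longlongrightarrow> 0) at_top" using \<eta> by real_asymp
  then have "\<forall>\<^sub>F T in at_top. C * T powr (1 - \<eta> / 4) / T powr (1 - \<eta> / 8) < 1" by (rule order_tendstoD) simp
  moreover have "\<forall>\<^sub>F T::real in at_top. ln T \<ge> 1" by real_asymp
  moreover have "\<forall>\<^sub>F T::real in at_top. 4 * ln T \<le> T" by real_asymp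
  ultimately show ?thesis
    using ev mollified_zeta_mean[OF \<alpha>(1,3) e8] eventually_ge_at_top[of 2]
  proof eventually_elim
    case (elim T)
    define f where "f v = norm (zeta (Complex \<alpha> v) * mollifier T (Complex \<alpha> v) - 1)" for v
    define Y where "Y = ln T"
    have Y: "Y \<ge> 1" "4 * Y \<le> T" using elim by (auto simp: Y_def)
    have f0: "f v \<ge> 0" for v by (simp add: f_def)
    have cf: "f integrable_on {x..y}" if "x \<ge> 1" for x y
      unfolding f_def using that
      by (intro integrable_continuous_real continuous_intros zeta_vertical_continuous
          continuous_on_compose2[OF holomorphic_on_imp_continuous_on[OF mollifier_holomorphic[of T UNIV]]])
         (auto simp: Complex_eq intro!: continuous_intros)
    show ?case
    proof (intro allI impI)
      fix D :: "real set"
      assume D: "finite D" "D \<subseteq> {5 * ln T..T}" and sp: "\<forall>t\<in>D. \<forall>t'\<in>D. t \<noteq> t' \<longrightarrow> \<bar>t - t'\<bar> \<ge> 9 * ln T"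
        and z: "\<forall>t\<in>D. \<exists>s. b \<le> Re s \<and> \<bar>Im s - t\<bar> \<le> 3 * ln T \<and> zeta s = 0"
      define w where "w = C * T powr (- (b - \<alpha>) / 2)"
      have w: "w > 0" using C elim by (simp add: w_def)
      have one: "1 \<le> w * integral {t - 4 * Y..t + 4 * Y} f" if t: "t \<in> D" for t
      proof -
        obtain s where s: "b \<le> Re s" "\<bar>Im s - t\<bar> \<le> 3 * ln T" "zeta s = 0" using z t by blast
        then have "Re s \<le> 1" using zeta_nonzero[of s] by force
        then show ?thesis using elim(4) t D s unfolding w_def Y_def f_def[abs_def] by auto
      qed
      have sub: "{t - 4 * Y..t + 4 * Y} \<subseteq> {1..2 * T}" "t - 4 * Y \<ge> 1" if "t \<in> D" for t
        using that D Y by (auto simp: Y_def)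
      have HI: "((f has_integral (\<Sum>t\<in>D. integral {t - 4 * Y..t + 4 * Y} f)) (\<Union>t\<in>D. {t - 4 * Y..t + 4 * Y}))"
      proof (rule has_integral_UN[OF D(1)])
        show "(f has_integral integral {t - 4 * Y..t + 4 * Y} f) {t - 4 * Y..t + 4 * Y}" if "t \<in> D" for t
          using cf[OF sub(2)[OF that]] by (rule integrable_integral)
        \<comment> \<open>Spacing \<open>9 * Y\<close> exceeds the length \<open>8 * Y\<close> of
          the windows, so they are disjoint and their integrals add up to at most the full mean
          value.\<close>
        show "pairwise (\<lambda>i i'. negligible ({i - 4 * Y..i + 4 * Y} \<inter> {i' - 4 * Y..i' + 4 * Y})) D"
        proof (rule pairwiseI)
          fix i i' assume i: "i \<in> D" "i' \<in> D" "i \<noteq> i'"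
          then have "\<bar>i - i'\<bar> \<ge> 9 * Y" using sp by (simp add: Y_def)
          then have "{i - 4 * Y..i + 4 * Y} \<inter> {i' - 4 * Y..i' + 4 * Y} = {}" using Y by (auto simp: abs_le_iff abs_if split: if_splits)
          then show "negligible ({i - 4 * Y..i + 4 * Y} \<inter> {i' - 4 * Y..i' + 4 * Y})" by simp
        qed
      qed
      have U: "(\<Union>t\<in>D. {t - 4 * Y..t + 4 * Y}) \<subseteq> {1..2 * T}" using sub(1) by blast
      have "(\<Sum>t\<in>D. integral {t - 4 * Y..t + 4 * Y} f) \<le> integral {1..2 * T} f"
        by (rule has_integral_subset_le[OF U HI integrable_integral[OF cf]]) (use f0 in auto)
      also have "\<dots> \<le> T powr (1 + \<eta> / 8)" using elim(5) by (simp add: f_def[abs_def])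
      finally have tot: "(\<Sum>t\<in>D. integral {t - 4 * Y..t + 4 * Y} f) \<le> T powr (1 + \<eta> / 8)" .
      have "real (card D) \<le> (\<Sum>t\<in>D. w * integral {t - 4 * Y..t + 4 * Y} f)"
        using sum_bounded_below[of D 1 "\<lambda>t. w * integral {t - 4 * Y..t + 4 * Y} f"] one by simp
      also have "\<dots> = w * (\<Sum>t\<in>D. integral {t - 4 * Y..t + 4 * Y} f)" by (simp add: sum_distrib_left)
      also have "\<dots> \<le> w * T powr (1 + \<eta> / 8)" using tot w by (intro mult_left_mono) auto
      also have "\<dots> = C * T powr (1 - \<eta> / 4)"
      proof -
        have e: "- (b - \<alpha>) / 2 + (1 + \<eta> / 8) = 1 - \<eta> / 4" by (simp add: \<alpha>_def \<eta>_def field_simps)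
        show ?thesis by (simp only: w_def mult.assoc powr_add[symmetric] e)
      qed
      also have "\<dots> \<le> T powr (1 - \<eta> / 8)" using elim by (simp add: pos_divide_less_eq)
      finally show "real (card D) \<le> T powr (1 - (b - 1/2) / 8)" by (simp add: \<eta>_def)
    qed
  qed
qed

subsection \<open>Simultaneous approximation and the prime sum\<close>

lemma cos_ge_half_of_close_to_int:
  fixes r :: real and k :: int
  assumes "\<bar>r\<bar> \<le> 1/6"
  shows "cos (2 * pi * (k + r)) \<ge> 1/2"
proof -
  have "cos (2 * pi * (k + r)) = cos (2 * pi * r)"
    unfolding distrib_left cos_add cos_int_2pin sin_int_2pin by simp
  also have "\<dots> = cos (2 * pi * \<bar>r\<bar>)" by (simp add: abs_if)
  also have "\<dots> \<ge> cos (pi / 3)"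
    using assms pi_gt_zero by (intro cos_monotone_0_pi_le) auto
  finally show ?thesis by (simp add: cos_60)
qed

text \<open>All differences with the least element of the fullest box are kept, not just one,
  because most of them must later avoid zeros. Six cells per coordinate put fractional parts within
  1/6, hence angles within \<open>pi / 3\<close>, where the cosine is at least 1/2.\<close>

lemma dirichlet_simultaneous:
  fixes w :: "'a \<Rightarrow> real"
  assumes P: "finite P" and J: "J > 0"
  obtains D where "D \<subseteq> {..<J}" "J \<le> card D * 6 ^ card P" "\<And>d p. d \<in> D \<Longrightarrow> p \<in> P \<Longrightarrow> cos (real d * w p) \<ge> 1/2"
proof -
  define y where "y j p = real j * w p / (2 * pi)" for j :: nat and p
  define f where "f j = (\<lambda>p\<in>P. nat \<lfloor>6 * frac (y j p)\<rfloor>)" for j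
  let ?B = "P \<rightarrow>\<^sub>E {..<6::nat}"
  have fl: "nat \<lfloor>6 * frac (y j p)\<rfloor> < 6" for j p
    using frac_lt_1[of "y j p"] frac_ge_0[of "y j p"] by linarith
  have fB: "f \<in> {..<J} \<rightarrow> ?B" using fl by (auto simp: f_def)
  have "\<exists>z\<in>?B. card (f -` {z} \<inter> {..<J}) * card ?B \<ge> card {..<J}"
    by (rule pigeonhole_card[OF fB]) (use P in \<open>auto intro: finite_PiE simp: PiE_eq_empty_iff lessThan_empty_iff\<close>)
  then obtain z where z: "card (f -` {z} \<inter> {..<J}) * card ?B \<ge> J" by auto
  have cB: "card ?B = 6 ^ card P" using P by (simp add: card_funcsetE)
  define S where "S = f -` {z} \<inter> {..<J}"
  have S: "finite S" "S \<noteq> {}" using z J by (auto simp: S_def)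
  define j0 where "j0 = Min S"
  have j0: "j0 \<in> S" "\<And>j. j \<in> S \<Longrightarrow> j0 \<le> j" using S by (auto simp: j0_def)
  define D where "D = (\<lambda>j. j - j0) ` S"
  have "inj_on (\<lambda>j. j - j0) S"
  proof (rule inj_onI)
    fix i j assume "i \<in> S" "j \<in> S" "i - j0 = j - j0"
    then show "i = j" using j0(2)[of i] j0(2)[of j] by linarith
  qed
  then have "card D = card S" unfolding D_def by (rule card_image)
  moreover have "D \<subseteq> {..<J}" by (auto simp: D_def S_def)
  moreover have "cos (real d * w p) \<ge> 1/2" if d: "d \<in> D" "p \<in> P" for d p
  proof -
    obtain j where j: "j \<in> S" "d = j - j0" using d by (auto simp: D_def)
    have "f j = f j0" using j j0 by (auto simp: S_def)
    then have "nat \<lfloor>6 * frac (y j p)\<rfloor> = nat \<lfloor>6 * frac (y j0 p)\<rfloor>"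
      using d by (auto simp: f_def dest: fun_cong[of _ _ p])
    then have "\<bar>6 * frac (y j p) - 6 * frac (y j0 p)\<bar> \<le> 1"
      using frac_ge_0[of "y j p"] frac_ge_0[of "y j0 p"] by linarith
    then have r: "\<bar>frac (y j p) - frac (y j0 p)\<bar> \<le> 1/6" by linarith
    have rd: "real d = real j - real j0" using j j0(2)[of j] by (simp add: of_nat_diff)
    have "real d * w p = 2 * pi * (y j p - y j0 p)" unfolding rd y_def by (simp add: field_simps)
    also have "y j p - y j0 p = of_int (\<lfloor>y j p\<rfloor> - \<lfloor>y j0 p\<rfloor>) + (frac (y j p) - frac (y j0 p))"
      by (simp add: frac_def)
    finally have e: "real d * w p = 2 * pi * (of_int (\<lfloor>y j p\<rfloor> - \<lfloor>y j0 p\<rfloor>) + (frac (y j p) - frac (y j0 p)))" .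
    show ?thesis unfolding e by (rule cos_ge_half_of_close_to_int[OF r])
  qed
  ultimately show ?thesis using z cB that[of D] by (simp add: S_def)
qed

lemma exp_quadratic_le:
  fixes y l :: real
  shows "exp (- ((l - y)\<^sup>2) / 2) \<le> exp (l + 1/2 - y)"
proof -
  have "(l - y + 1)\<^sup>2 \<ge> 0" by simp
  then have "- ((l - y)\<^sup>2) / 2 \<le> l + 1/2 - y" by (simp add: power2_eq_square field_simps)
  then show ?thesis by simp
qed

text \<open>Dominates the bumps of \<open>mkernel_fourier\<close> at 0 and \<open>- l\<close> over
  all primes, uniformly in the other parameters as long as \<open>\<sigma> \<ge> 1/2\<close> and
  \<open>l \<ge> 0\<close>.\<close>

definition low_frequency_bound :: real where
  "low_frequency_bound = (\<Sum>n. real n powr (- (1/2)) * exp (- ((ln (real n))\<^sup>2) / 2))"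

lemma summable_low_frequency: "summable (\<lambda>n. real n powr (- (1/2)) * exp (- ((ln (real n))\<^sup>2) / 2))"
proof (rule summable_comparison_test)
  show "summable (\<lambda>n. exp (1/2) * real n powr (- (3/2)))" by (intro summable_mult summable_nat_powr) simp
  have "real n powr (- (1/2)) * exp (- ((ln (real n))\<^sup>2) / 2) \<le> exp (1/2) * real n powr (- (3/2))" for n
  proof (cases "n = 0")
    case False
    have "exp (- ((ln (real n))\<^sup>2) / 2) \<le> exp (1/2 - ln (real n))" using exp_quadratic_le[of 0 "ln (real n)"] by simp
    also have "\<dots> = exp (1/2) * real n powr (- 1)" using False powr_minus_divide[of "real n" 1] by (simp add: exp_diff)
    finally have "real n powr (- (1/2)) * exp (- ((ln (real n))\<^sup>2) / 2) \<le> real n powr (- (1/2)) * (exp (1/2) * real n powr (- 1))"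
      by (intro mult_left_mono) auto
    also have "\<dots> = exp (1/2) * real n powr (- (3/2))" using powr_add[of "real n" "- (1/2)" "- 1"] by simp
    finally show ?thesis .
  qed simp
  then show "\<exists>N. \<forall>n\<ge>N. norm (real n powr (- (1/2)) * exp (- ((ln (real n))\<^sup>2) / 2)) \<le> exp (1/2) * real n powr (- (3/2))"
    by auto
qed

text \<open>The rotation by \<open>exp (- (\<i> * \<theta>))\<close> cancels the phase of the bump
  at \<open>l\<close>, leaving a cosine. The bumps at 0 and \<open>- l\<close> keep unknown phases
  and are estimated by modulus, with total weight \<open>1 + 1/2\<close>.\<close>

lemma Re_mkernel_term_ge:
  assumes n: "n \<ge> (1::nat)" and \<sigma>: "\<sigma> \<ge> 1/2" and l: "l \<ge> 0"
  shows "real n powr (- \<sigma>) * exp (- ((l - ln (real n))\<^sup>2) / 2) * cos (t * ln (real n)) / 2 - 3/2 * (real n powr (- (1/2)) * exp (- ((ln (real n))\<^sup>2) / 2))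
     \<le> Re (exp (- (\<i> * of_real \<theta>)) * (of_nat n powr (- Complex \<sigma> t) * mkernel_fourier \<theta> l (ln (real n))))"
proof -
  define y where "y = ln (real n)"
  have y: "y \<ge> 0" using n by (simp add: y_def)
  define z where "z = complex_of_nat n powr (- Complex \<sigma> t)"
  define q where "q = real n powr (- (1/2)) * exp (- (y\<^sup>2) / 2)"
  define A where "A = exp (- (\<i> * complex_of_real \<theta>)) * z * of_real (exp (- (y\<^sup>2) / 2))"
  define B where "B = exp (- (\<i> * complex_of_real \<theta>)) * exp (- (\<i> * of_real \<theta>)) * z * of_real (exp (- ((l + y)\<^sup>2) / 2))"
  have nz: "norm z \<le> real n powr (- (1/2))"
    using n \<sigma> by (simp add: z_def norm_of_nat_powr, intro powr_mono) auto
  have e1: "exp (- (\<i> * complex_of_real \<theta>)) * exp (\<i> * of_real \<theta>) = 1" by (simp add: exp_add[symmetric])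
  have ne: "norm (exp (- (\<i> * complex_of_real \<theta>))) = 1" by (simp add: norm_exp_eq_Re)
  have eq: "exp (- (\<i> * of_real \<theta>)) * (z * mkernel_fourier \<theta> l y) = A + (z * of_real (exp (- ((l - y)\<^sup>2) / 2)) + B) / 2"
  proof -
    have "exp (- (\<i> * of_real \<theta>)) * (z * mkernel_fourier \<theta> l y) = A + ((exp (- (\<i> * complex_of_real \<theta>)) * exp (\<i> * of_real \<theta>)) * (z * of_real (exp (- ((l - y)\<^sup>2) / 2))) + B) / 2"
      by (simp add: mkernel_fourier_def A_def B_def algebra_simps add_divide_distrib exp_of_real[symmetric])
    then show ?thesis unfolding e1 by simp
  qed
  have "norm A \<le> q"
    unfolding A_def q_def norm_mult ne using nz by (simp add: mult_right_mono)
  then have A: "Re A \<ge> - q" using abs_Re_le_cmod[of A] by linarith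
  have "norm B \<le> q"
  proof -
    have "y\<^sup>2 \<le> (l + y)\<^sup>2" using y l by (intro power_mono) auto
    then have "exp (- ((l + y)\<^sup>2) / 2) \<le> exp (- (y\<^sup>2) / 2)" by simp
    then have "norm z * exp (- ((l + y)\<^sup>2) / 2) \<le> q" unfolding q_def using nz by (intro mult_mono) auto
    then show ?thesis unfolding B_def norm_mult ne by simp
  qed
  then have B: "Re B \<ge> - q" using abs_Re_le_cmod[of B] by linarith
  have "Re z = real n powr (- \<sigma>) * cos (t * y)"
  proof -
    have "z = of_real (real n powr (- \<sigma>)) * exp (\<i> * of_real (- (y * t)))"
      unfolding z_def y_def using n of_nat_powr_vertical[of n \<sigma> t] powr_of_real[of "real n" "- \<sigma>"] by simp
    moreover have "Re (exp (\<i> * of_real (- (y * t)))) = cos (t * y)" by (simp add: Re_exp mult.commute)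
    moreover have "Re (of_real a * w) = a * Re w" for a w by simp
    ultimately show ?thesis by (simp only:)
  qed
  then have "Re (A + (z * of_real (exp (- ((l - y)\<^sup>2) / 2)) + B) / 2)
     = Re A + (real n powr (- \<sigma>) * cos (t * y) * exp (- ((l - y)\<^sup>2) / 2) + Re B) / 2" by simp
  moreover have "real n powr (- \<sigma>) * exp (- ((l - y)\<^sup>2) / 2) * cos (t * y) = real n powr (- \<sigma>) * cos (t * y) * exp (- ((l - y)\<^sup>2) / 2)"
    by simp
  ultimately show ?thesis
    using A B unfolding y_def[symmetric] z_def[symmetric] q_def[symmetric] eq by argo
qed

text \<open>The weight 1/2 of the bump at \<open>l\<close> turns \<open>m\<close> into
  \<open>m / 2\<close>. The hypothesis on \<open>m\<close> is required for every cut-off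
  \<open>N\<close> because partial sums are bounded first and the limit is taken last.\<close>

lemma prime_series_lower_bound:
  assumes W: "W \<ge> 1" and x: "x \<ge> 1" and \<sigma>: "1/2 \<le> \<sigma>"
    and low: "\<And>N. m \<le> (\<Sum>p | prime p \<and> real p \<le> W * x. gweight \<sigma> x p) / 2
          - (\<Sum>p | prime p \<and> W * x < real p \<and> p \<le> N. gweight \<sigma> x p)"
    and cs: "\<And>p. prime p \<Longrightarrow> real p \<le> W * x \<Longrightarrow> cos (t * ln (real p)) \<ge> 1/2"
  shows "m / 2 - 3/2 * low_frequency_bound \<le> Re (exp (- (\<i> * of_real \<theta>)) *
     (\<Sum>n. if prime n then of_nat n powr (- Complex \<sigma> t) * mkernel_fourier \<theta> (ln x) (ln n) else 0))"
proof -
  define l where "l = ln x"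
  have l: "l \<ge> 0" using x by (simp add: l_def)
  define F where "F n = (if prime n then of_nat n powr (- Complex \<sigma> t) * mkernel_fourier \<theta> l (ln n) else 0)" for n :: nat
  define q where "q n = real n powr (- (1/2)) * exp (- ((ln (real n))\<^sup>2) / 2)" for n :: nat
  have q0: "q n \<ge> 0" for n by (simp add: q_def)
  have nF: "norm (F n) \<le> 2 * exp (l + 1/2) * real n powr (- (3/2))" for n
  proof (cases "prime n")
    case True
    then have n: "n \<ge> 1" by (rule prime_ge_1_nat)
    define y where "y = ln (real n)"
    have y: "y \<ge> 0" using n by (simp add: y_def)
    have "norm (mkernel_fourier \<theta> l y) \<le> exp (- (y\<^sup>2) / 2) + (exp (- ((l - y)\<^sup>2) / 2) + exp (- ((l + y)\<^sup>2) / 2)) / 2"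
      unfolding mkernel_fourier_def
      by (rule norm_triangle_le, intro add_mono)
         (auto simp: norm_divide norm_mult norm_exp_eq_Re intro!: divide_right_mono norm_triangle_le)
    also have "\<dots> \<le> exp (l + 1/2 - y) + (exp (l + 1/2 - y) + exp (l + 1/2 - y)) / 2"
    proof (intro add_mono divide_right_mono)
      show "exp (- ((l - y)\<^sup>2) / 2) \<le> exp (l + 1/2 - y)" by (rule exp_quadratic_le)
      have "exp (- ((0 - y)\<^sup>2) / 2) \<le> exp (0 + 1/2 - y)" by (rule exp_quadratic_le)
      also have "\<dots> \<le> exp (l + 1/2 - y)" using l by simp
      finally show "exp (- (y\<^sup>2) / 2) \<le> exp (l + 1/2 - y)" by simp
      have "exp (- ((- l - y)\<^sup>2) / 2) \<le> exp (- l + 1/2 - y)" by (rule exp_quadratic_le)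
      also have "\<dots> \<le> exp (l + 1/2 - y)" using l by simp
      also have "(- l - y)\<^sup>2 = (l + y)\<^sup>2" by (simp add: power2_eq_square algebra_simps)
      finally show "exp (- ((l + y)\<^sup>2) / 2) \<le> exp (l + 1/2 - y)" .
    qed simp
    also have "\<dots> = 2 * exp (l + 1/2 - y)" by simp
    also have "exp (l + 1/2 - y) = exp (l + 1/2) * real n powr (- 1)"
      unfolding exp_diff using n powr_minus_divide[of "real n" 1] by (simp add: y_def)
    also have "2 * (exp (l + 1/2) * real n powr (- 1)) = 2 * exp (l + 1/2) * real n powr (- 1)" by simp
    finally have k: "norm (mkernel_fourier \<theta> l y) \<le> 2 * exp (l + 1/2) * real n powr (- 1)" .
    have "norm (complex_of_nat n powr (- Complex \<sigma> t)) \<le> real n powr (- (1/2))"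
      using n \<sigma> by (simp add: norm_of_nat_powr, intro powr_mono) auto
    then have "norm (complex_of_nat n powr (- Complex \<sigma> t)) * norm (mkernel_fourier \<theta> l y)
        \<le> real n powr (- (1/2)) * (2 * exp (l + 1/2) * real n powr (- 1))"
      using k by (intro mult_mono) auto
    then have "norm (F n) \<le> real n powr (- (1/2)) * (2 * exp (l + 1/2) * real n powr (- 1))"
      using True by (simp add: F_def y_def norm_mult)
    also have "\<dots> = 2 * exp (l + 1/2) * real n powr (- (3/2))" using powr_add[of "real n" "- (1/2)" "- 1"] by simp
    finally show ?thesis .
  qed (simp add: F_def)
  have sF: "summable F"
  proof (rule summable_norm_cancel, rule summable_comparison_test)
    show "summable (\<lambda>n. 2 * exp (l + 1/2) * real n powr (- (3/2)))" by (intro summable_mult summable_nat_powr) simp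
  qed (use nF in auto)
  define R where "R n = Re (exp (- (\<i> * of_real \<theta>)) * F n)" for n
  have "(\<lambda>n. exp (- (\<i> * of_real \<theta>)) * F n) sums (exp (- (\<i> * of_real \<theta>)) * suminf F)"
    using summable_sums[OF sF] by (rule sums_mult)
  then have "R sums Re (exp (- (\<i> * of_real \<theta>)) * suminf F)" unfolding R_def by (rule sums_Re)
  then have lim: "(\<lambda>N. sum R {..N}) \<longlonglongrightarrow> Re (exp (- (\<i> * of_real \<theta>)) * suminf F)" by (simp add: sums_def_le)
  have R: "R n \<ge> (if prime n then gweight \<sigma> x n * cos (t * ln (real n)) / 2 else 0) - 3/2 * q n" for n
  proof (cases "prime n")
    case True
    then have "n \<ge> 1" by (rule prime_ge_1_nat)
    from Re_mkernel_term_ge[OF this \<sigma> l, of t \<theta>] True show ?thesis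
      by (simp add: R_def F_def gweight_def l_def q_def)
  qed (use q0[of n] in \<open>simp add: R_def F_def\<close>)
  have bound: "m / 2 - 3/2 * low_frequency_bound \<le> sum R {..N}" if N: "real N \<ge> W * x" for N
  proof -
    let ?A = "{p. prime p \<and> real p \<le> W * x}" and ?B = "{p. prime p \<and> W * x < real p \<and> p \<le> N}"
    let ?g = "\<lambda>p. gweight \<sigma> x p * cos (t * ln (real p)) / 2"
    have fA: "finite ?A" by (rule finite_primes_real)
    have "(\<Sum>n\<le>N. q n) \<le> low_frequency_bound"
      unfolding low_frequency_bound_def q_def by (rule sum_le_suminf[OF summable_low_frequency]) auto
    moreover have "(\<Sum>n\<le>N. if prime n then ?g n else 0) = sum ?g (?A \<union> ?B)"
      using N by (intro sum.mono_neutral_cong_right) (auto simp: not_less)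
    moreover have "sum ?g (?A \<union> ?B) = sum ?g ?A + sum ?g ?B" using fA by (intro sum.union_disjoint) auto
    moreover have "sum ?g ?A \<ge> (\<Sum>p\<in>?A. gweight \<sigma> x p) / 2 / 2"
      unfolding sum_divide_distrib
    proof (rule sum_mono)
      fix p assume "p \<in> ?A"
      then have "gweight \<sigma> x p * (1/2) \<le> gweight \<sigma> x p * cos (t * ln (real p))"
        using cs gweight_nonneg by (intro mult_left_mono) auto
      then show "gweight \<sigma> x p / 2 / 2 \<le> ?g p" by simp
    qed
    moreover have "sum ?g ?B \<ge> - (\<Sum>p\<in>?B. gweight \<sigma> x p) / 2"
      unfolding sum_divide_distrib sum_negf[symmetric]
    proof (rule sum_mono)
      fix p
      have "gweight \<sigma> x p * (-1) \<le> gweight \<sigma> x p * cos (t * ln (real p))"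
        using gweight_nonneg by (intro mult_left_mono) auto
      then show "- gweight \<sigma> x p / 2 \<le> ?g p" by simp
    qed
    moreover have "sum R {..N} \<ge> (\<Sum>n\<le>N. (if prime n then ?g n else 0) - 3/2 * q n)"
      by (rule sum_mono) (rule R)
    moreover have "(\<Sum>n\<le>N. (if prime n then ?g n else 0) - 3/2 * q n) = (\<Sum>n\<le>N. if prime n then ?g n else 0) - 3/2 * (\<Sum>n\<le>N. q n)"
      by (simp only: sum_subtractf sum_distrib_left)
    ultimately show ?thesis using low[of N] by argo
  qed
  have "\<forall>\<^sub>F N in sequentially. m / 2 - 3/2 * low_frequency_bound \<le> sum R {..N}"
    using eventually_ge_at_top[of "nat \<lceil>W * x\<rceil>"]
  proof eventually_elim
    case (elim N)
    then have "real N \<ge> W * x" by linarith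
    then show ?case by (rule bound)
  qed
  from tendsto_lowerbound[OF lim this] show ?thesis unfolding F_def[abs_def] l_def by simp
qed

subsection \<open>Large values\<close>

lemma ln_6_le: "ln (6::real) \<le> 2"
proof -
  have "(5/2)\<^sup>2 \<le> (exp 1 :: real)\<^sup>2"
    using exp_lower_Taylor_quadratic[of 1] by (intro power_mono) auto
  also have "(exp 1 :: real)\<^sup>2 = exp 2" by (simp add: exp_of_nat_mult[symmetric])
  finally have "6 \<le> exp (2::real)" by (simp add: power2_eq_square)
  then have "ln 6 \<le> ln (exp (2::real))" by (intro ln_mono) auto
  then show ?thesis by simp
qed

text \<open>Exponents with \<open>k = \<kappa> / 32\<close>: more than
  \<open>4 * T powr (1 - k)\<close> multiples enter the pigeonhole, which divides by at most
  \<open>T powr k\<close>. Of the survivors at most \<open>T powr (1 - 2 * k)\<close> lie near zeros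
  and at most \<open>3 * T powr (1 - 2 * k)\<close> lie too low. The bounds
  \<open>2 * T powr \<beta>\<close> and \<open>T / 2\<close> leave room to move \<open>t\<close> by
  \<open>ln T\<close> afterwards.\<close>

lemma good_points:
  fixes W :: real
  assumes W: "W \<ge> 1" and \<sigma>: "1/2 < \<sigma>" "\<sigma> < 1" and \<beta>: "0 < \<beta>" and \<kappa>: "0 < \<kappa>" "\<kappa> < min (\<sigma> - 1/2) (1 - \<beta>)"
  shows "\<forall>\<^sub>F T in at_top. \<exists>t. 2 * T powr \<beta> \<le> t \<and> t \<le> T / 2 \<and>
    (\<forall>p. prime p \<longrightarrow> real p \<le> W * (\<kappa> / (2560 * W) * ln T * ln (ln T)) \<longrightarrow> cos (t * ln (real p)) \<ge> 1/2) \<and>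
    (\<forall>s. 1/2 + (\<sigma> - 1/2) / 2 \<le> Re s \<longrightarrow> \<bar>Im s - t\<bar> \<le> 3 * ln T \<longrightarrow> zeta s \<noteq> 0)"
proof -
  define b where "b = 1/2 + (\<sigma> - 1/2) / 2"
  have b: "1/2 < b" "b < 1" using \<sigma> by (auto simp: b_def field_simps)
  define k where "k = \<kappa> / 32"
  have k: "0 < k" "2 * k \<le> (b - 1/2) / 8" "\<beta> \<le> 1 - 2 * k" using \<kappa> by (auto simp: k_def b_def field_simps)
  define K where "K = \<kappa> / 2560"
  \<comment> \<open>With this \<open>K\<close> the primes up to \<open>X\<close> number at most
    \<open>40 * K * ln T = k * ln T / 2\<close>, and \<open>ln 6 \<le> 2\<close> turns this into
    \<open>6 ^ card P \<le> T powr k\<close>.\<close>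
  have K: "K > 0" using \<kappa> by (simp add: K_def)
  have ev1: "\<forall>\<^sub>F T in at_top. 4 * T powr (1 - k) < T / (18 * ln T) - 1" using k by real_asymp
  have ev2: "\<forall>\<^sub>F T in at_top. ln (K * ln T * ln (ln T)) \<ge> ln (ln T) / 2" using K by real_asymp
  have ev3: "\<forall>\<^sub>F T in at_top. K * ln T * ln (ln T) \<ge> 4" using K by real_asymp
  have ev4: "\<forall>\<^sub>F T::real in at_top. ln (ln T) > 0" by real_asymp
  have ev5: "\<forall>\<^sub>F T in at_top. 5 * ln T \<le> 2 * T powr \<beta>" using \<beta> by real_asymp
  have ev6: "\<forall>\<^sub>F T::real in at_top. ln T \<ge> 1" by real_asymp
  show ?thesis
    using ev1 ev2 ev3 ev4 ev5 ev6 eventually_ge_at_top[of 1] spaced_zeros_bound[OF b]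
  proof eventually_elim
    case (elim T)
    define X where "X = K * ln T * ln (ln T)"
    have WX: "W * (\<kappa> / (2560 * W) * ln T * ln (ln T)) = X" using W by (simp add: X_def K_def)
    define Y where "Y = ln T"
    have Y: "Y \<ge> 1" using elim by (simp add: Y_def)
    define P where "P = {p::nat. prime p \<and> real p \<le> X}"
    have finP: "finite P" unfolding P_def by (rule finite_primes_real)
    have pow6: "6 ^ card P \<le> T powr k"
    proof -
      have "real (card P) \<le> 20 * X / ln X"
        using prime_count_real_upper[of X] elim(3) unfolding prime_count_eq_card_real P_def X_def by blast
      also have "\<dots> \<le> 20 * X / (ln (ln T) / 2)"
        using elim(2-4) K Y by (intro divide_left_mono) (auto simp: X_def Y_def)
      also have "\<dots> = 40 * K * ln T" using elim(4) by (simp add: X_def)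
      also have "\<dots> = k * ln T / 2" by (simp add: K_def k_def)
      finally have c: "real (card P) \<le> k * ln T / 2" .
      have "real (card P) * ln 6 \<le> real (card P) * 2" using ln_6_le by (intro mult_left_mono) auto
      then have "real (card P) * ln 6 \<le> k * ln T" using c by linarith
      then have "exp (real (card P) * ln 6) \<le> exp (k * ln T)" by simp
      then show ?thesis using elim(7) by (simp add: powr_def exp_of_nat_mult)
    qed
    define J where "J = nat \<lfloor>T / (18 * Y)\<rfloor>"
    have T18: "T / (18 * Y) - 1 > 0" using elim(1) powr_ge_zero[of T "1 - k"] unfolding Y_def by linarith
    have J: "J > 0" "real J > T / (18 * Y) - 1" "real J \<le> T / (18 * Y)" using T18 unfolding J_def by linarith+
    \<comment> \<open>The spacing demanded by \<open>spaced_zeros_bound\<close>; \<open>J\<close> is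
      cut so that all multiples stay below \<open>T / 2\<close>.\<close>
    define \<Delta> where "\<Delta> = 9 * Y"
    have \<Delta>: "\<Delta> \<ge> 9" using Y by (simp add: \<Delta>_def)
    obtain D where D: "D \<subseteq> {..<J}" "J \<le> card D * 6 ^ card P"
      and cs: "\<And>d p. d \<in> D \<Longrightarrow> p \<in> P \<Longrightarrow> cos (real d * (\<Delta> * ln (real p))) \<ge> 1/2"
      using dirichlet_simultaneous[OF finP J(1), of "\<lambda>p. \<Delta> * ln (real p)"] by blast
    have finD: "finite D" using D(1) finite_subset by auto
    have up: "real d * \<Delta> \<le> T / 2" if "d \<in> D" for d
    proof -
      have "real d \<le> real J" using D(1) that by auto
      then have "real d \<le> T / (18 * Y)" using J by linarith
      then have "real d * \<Delta> \<le> T / (18 * Y) * \<Delta>" using \<Delta> by (intro mult_right_mono) auto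
      also have "\<dots> = T / 2" using Y by (simp add: \<Delta>_def)
      finally show ?thesis .
    qed
    show ?case
    proof (rule ccontr)
      assume contra: "\<not> ?case"
      define D1 where "D1 = {d\<in>D. 2 * T powr \<beta> \<le> real d * \<Delta>}"
      define E where "E = (\<lambda>d. real d * \<Delta>) ` D1"
      have inj: "inj_on (\<lambda>d. real d * \<Delta>) D1" using \<Delta> by (auto simp: inj_on_def)
      have bad: "\<exists>s. b \<le> Re s \<and> \<bar>Im s - t\<bar> \<le> 3 * ln T \<and> zeta s = 0" if t: "t \<in> E" for t
      proof (rule ccontr)
        assume nb: "\<not> (\<exists>s. b \<le> Re s \<and> \<bar>Im s - t\<bar> \<le> 3 * ln T \<and> zeta s = 0)"
        obtain d where d: "d \<in> D" "2 * T powr \<beta> \<le> t" "t = real d * \<Delta>" using t by (auto simp: E_def D1_def)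
        have "cos (t * ln (real p)) \<ge> 1/2" if "prime p" "real p \<le> X" for p
          using cs[OF d(1), of p] that d by (simp add: P_def mult.assoc)
        with contra d up[OF d(1)] nb show False unfolding WX b_def by blast
      qed
      have "real (card E) \<le> T powr (1 - (b - 1/2) / 8)"
      proof (rule elim(8)[rule_format])
        show "finite E" unfolding E_def D1_def using finD by auto
        show "E \<subseteq> {5 * ln T..T}"
          using up elim(5,7) by (fastforce simp: E_def D1_def)
        show "\<exists>s. b \<le> Re s \<and> \<bar>Im s - t\<bar> \<le> 3 * ln T \<and> zeta s = 0" if "t \<in> E" for t using bad[OF that] .
        fix t t' assume "t \<in> E" "t' \<in> E" "t \<noteq> t'"
        then obtain d d' where d: "t = real d * \<Delta>" "t' = real d' * \<Delta>" "d \<noteq> d'" by (auto simp: E_def)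
        then have "1 \<le> \<bar>real d - real d'\<bar>" by linarith
        then have "1 * \<Delta> \<le> \<bar>real d - real d'\<bar> * \<Delta>" using \<Delta> by (intro mult_right_mono) auto
        also have "\<dots> = \<bar>t - t'\<bar>" using \<Delta> by (simp add: d abs_mult left_diff_distrib[symmetric])
        finally show "9 * ln T \<le> \<bar>t - t'\<bar>" by (simp add: \<Delta>_def Y_def)
      qed
      also have "\<dots> \<le> T powr (1 - 2 * k)" using k elim(7) by (intro powr_mono) auto
      also have "card E = card D1" unfolding E_def by (rule card_image[OF inj])
      finally have c1: "real (card D1) \<le> T powr (1 - 2 * k)" .
      \<comment> \<open>This also disposes of the difference 0, which the pigeonhole construction
        always produces.\<close>
      have "D - D1 \<subseteq> {..nat \<lfloor>2 * T powr \<beta>\<rfloor>}"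
      proof
        fix d assume "d \<in> D - D1"
        then have "real d * \<Delta> < 2 * T powr \<beta>" by (auto simp: D1_def)
        moreover have "real d * 1 \<le> real d * \<Delta>" using \<Delta> by (intro mult_left_mono) auto
        ultimately show "d \<in> {..nat \<lfloor>2 * T powr \<beta>\<rfloor>}" by (simp add: le_nat_floor)
      qed
      then have "card (D - D1) \<le> card {..nat \<lfloor>2 * T powr \<beta>\<rfloor>}" by (intro card_mono) auto
      then have "card (D - D1) \<le> Suc (nat \<lfloor>2 * T powr \<beta>\<rfloor>)" by simp
      then have "real (card (D - D1)) \<le> real (Suc (nat \<lfloor>2 * T powr \<beta>\<rfloor>))" by (rule of_nat_mono)
      also have "\<dots> = real (nat \<lfloor>2 * T powr \<beta>\<rfloor>) + 1" by (simp only: of_nat_Suc add.commute)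
      also have "\<dots> \<le> 2 * T powr \<beta> + 1" by (intro add_right_mono of_nat_floor) simp
      also have "\<dots> \<le> 2 * T powr (1 - 2 * k) + T powr (1 - 2 * k)"
        using k elim(7) \<beta> by (intro add_mono mult_left_mono powr_mono ge_one_powr_ge_zero) auto
      finally have c2: "real (card (D - D1)) \<le> 3 * T powr (1 - 2 * k)" by simp
      have "card D = card D1 + card (D - D1)"
        using finD by (subst card_Un_disjoint[symmetric]) (auto simp: D1_def intro!: arg_cong[of _ _ card])
      then have cD: "real (card D) \<le> 4 * T powr (1 - 2 * k)" using c1 c2 by simp
      have "real J \<le> real (card D) * 6 ^ card P" using of_nat_mono[OF D(2), where 'a = real] by simp
      also have "\<dots> \<le> 4 * T powr (1 - 2 * k) * T powr k" using cD pow6 by (intro mult_mono) auto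
      also have "\<dots> = 4 * T powr (1 - k)" by (simp add: powr_add[symmetric])
      also have "\<dots> < T / (18 * Y) - 1" using elim(1) by (simp add: Y_def)
      finally show False using J by linarith
    qed
  qed
qed

text \<open>Only \<open>c\<close> has to be absolute. Quantities such as \<open>C\<close> and
  \<open>Bh\<close> blow up as \<sigma> approaches 1/2, but they only affect how large
  \<open>T\<close> must be, as \<open>Q T\<close> tends to infinity and the error terms to
  0.\<close>

lemma log_zeta_large_values:
  obtains c :: real where "c > 0" "\<And>\<sigma> \<beta> \<kappa> \<theta>. 1/2 < \<sigma> \<Longrightarrow> \<sigma> < 1 \<Longrightarrow> 0 < \<beta> \<Longrightarrow> 0 < \<kappa> \<Longrightarrow> \<kappa> < min (\<sigma> - 1/2) (1 - \<beta>) \<Longrightarrow>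
    \<forall>\<^sub>F T in at_top. \<exists>t\<in>{T powr \<beta>..T}. log_zeta_defined (Complex \<sigma> t) \<and>
      Re (exp (- \<i> * complex_of_real \<theta>) * log_zeta (Complex \<sigma> t)) \<ge> c * \<kappa> powr (1 - \<sigma>) * (ln T powr (1 - \<sigma>) / ln (ln T) powr \<sigma>)"
proof -
  obtain W c x0 :: real where W: "W \<ge> 1" and c: "c > 0" and x0: "x0 \<ge> 6"
    and gw: "\<And>x \<sigma> N. x \<ge> x0 \<Longrightarrow> 0 < \<sigma> \<Longrightarrow>
       c * (x powr (1 - \<sigma>) / ln x) \<le> (\<Sum>p | prime p \<and> real p \<le> W * x. gweight \<sigma> x p) / 2
          - (\<Sum>p | prime p \<and> W * x < real p \<and> p \<le> N. gweight \<sigma> x p)"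
    using gweight_prime_sum by blast
  define c3 where "c3 = 1 / (2560 * W)"
  have c3: "0 < c3" "c3 \<le> 1" using W by (auto simp: c3_def)
  define c0 where "c0 = c * c3 / 16"
  have c0: "c0 > 0" using c c3 by (simp add: c0_def)
  show ?thesis
  proof (rule that[OF c0])
    fix \<sigma> \<beta> \<kappa> \<theta> :: real
    assume \<sigma>: "1/2 < \<sigma>" "\<sigma> < 1" and \<beta>: "0 < \<beta>" and \<kappa>: "0 < \<kappa>" "\<kappa> < min (\<sigma> - 1/2) (1 - \<beta>)"
    \<comment> \<open>Half-way between 1/2 and \<sigma>, leaving room to the left of \<sigma> for
      the growth bound on the logarithm.\<close>
    define b where "b = 1/2 + (\<sigma> - 1/2) / 2"
    have b: "1/2 < b" "b < \<sigma>" "b \<le> 1" using \<sigma> by (auto simp: b_def field_simps)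
    obtain C where C: "C > 0" and gr: "\<And>g t H Y s. g holomorphic_on half_strip b t H \<Longrightarrow>
       (\<And>s. s \<in> half_strip b t H \<Longrightarrow> exp (g s) = zeta s) \<Longrightarrow>
       (\<And>s. s \<in> half_strip b t H \<Longrightarrow> Re s > 1 \<Longrightarrow> g s = log_zeta_series s) \<Longrightarrow>
       H \<ge> Y + 2 \<Longrightarrow> Y \<ge> 0 \<Longrightarrow> t \<ge> H + 1 \<Longrightarrow> \<sigma> \<le> Re s \<Longrightarrow> Re s \<le> 2 \<Longrightarrow> \<bar>Im s - t\<bar> \<le> Y \<Longrightarrow>
       norm (g s) \<le> C * (1 + ln t)"
      using log_zeta_growth[OF b(1,2) \<sigma>(2)] by blast
    define Bh where "Bh = 4 * (\<Sum>n. real n powr (- (2 * \<sigma>)))"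
    define P where "P = (\<Sum>n. real n powr (- 2))"
    define K where "K = \<kappa> * c3"
    have K: "K > 0" using \<kappa> c3 by (simp add: K_def)
    define x where "x T = K * ln T * ln (ln T)" for T
    define Q where "Q T = x T powr (1 - \<sigma>) / ln (x T)" for T
    have "filterlim Q at_top at_top" unfolding Q_def x_def using K \<sigma> by real_asymp
    then have ev1: "\<forall>\<^sub>F T in at_top. Q T > (3/2 * low_frequency_bound + 2 * Bh + 1) * 4 / c"
      by (simp add: filterlim_at_top_dense)
    have "((\<lambda>T. 32 * (C * (1 + ln T) + Bh + P) * exp (2 * ln (x T)) * exp (- ((ln T)\<^sup>2) / 4)) \<longlongrightarrow> 0) at_top"
      unfolding x_def using K by real_asymp
    then have ev2: "\<forall>\<^sub>F T in at_top. 32 * (C * (1 + ln T) + Bh + P) * exp (2 * ln (x T)) * exp (- ((ln T)\<^sup>2) / 4) < 1"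
      by (rule order_tendstoD) simp
    have ev3: "\<forall>\<^sub>F T in at_top. x T \<ge> x0" unfolding x_def using K by real_asymp
    have ev4: "\<forall>\<^sub>F T in at_top. ln (x T) \<le> 2 * ln (ln T)" unfolding x_def using K by real_asymp
    have ev5: "\<forall>\<^sub>F T in at_top. 3 * ln T + 1 \<le> T powr \<beta>" using \<beta> by real_asymp
    have ev6: "\<forall>\<^sub>F T::real in at_top. ln T \<ge> 1" by real_asymp
    have ev7: "\<forall>\<^sub>F T::real in at_top. ln T \<le> T / 2" by real_asymp
    have ev8: "\<forall>\<^sub>F T::real in at_top. ln (ln T) > 0" by real_asymp
    show "\<forall>\<^sub>F T in at_top. \<exists>t\<in>{T powr \<beta>..T}. log_zeta_defined (Complex \<sigma> t) \<and>
      Re (exp (- \<i> * complex_of_real \<theta>) * log_zeta (Complex \<sigma> t)) \<ge> c0 * \<kappa> powr (1 - \<sigma>) * (ln T powr (1 - \<sigma>) / ln (ln T) powr \<sigma>)"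
      using ev1 ev2 ev3 ev4 ev5 ev6 ev7 ev8 eventually_ge_at_top[of 1] good_points[OF W \<sigma> \<beta> \<kappa>]
    proof eventually_elim
      case (elim T)
      define Y where "Y = ln T"
      have Y: "Y \<ge> 1" using elim by (simp add: Y_def)
      define X where "X = x T"
      have X: "X \<ge> x0" "X \<ge> 6" using elim(3) x0 by (auto simp: X_def)
      have Xeq: "\<kappa> / (2560 * W) * ln T * ln (ln T) = X" by (simp add: X_def x_def K_def c3_def)
      obtain t where t: "2 * T powr \<beta> \<le> t" "t \<le> T / 2"
        and cs: "\<And>p. prime p \<Longrightarrow> real p \<le> W * X \<Longrightarrow> cos (t * ln (real p)) \<ge> 1/2"
        and nz: "\<And>s. b \<le> Re s \<Longrightarrow> \<bar>Im s - t\<bar> \<le> 3 * ln T \<Longrightarrow> zeta s \<noteq> 0"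
        using elim(10) unfolding Xeq b_def by blast
      define H where "H = 3 * Y"
      have tH: "t \<ge> H + 1" "t \<ge> H" "H > 0" "H \<ge> Y + 2" "Y < H" "Y > 0"
        using t elim(5) Y unfolding H_def Y_def by linarith+
      have "zeta s \<noteq> 0" if "s \<in> half_strip b t H" for s
        using that nz[of s] by (auto simp: half_strip_def H_def Y_def)
      then obtain g where g: "g holomorphic_on half_strip b t H" "\<And>s. s \<in> half_strip b t H \<Longrightarrow> exp (g s) = zeta s"
        "\<And>s. s \<in> half_strip b t H \<Longrightarrow> Re s > 1 \<Longrightarrow> g s = log_zeta_series s"
        using zeta_log_exists[of b t H, OF _ tH(2,3) b(3)] by blast
      \<comment> \<open>If the real part stayed below \<open>V\<close>, the upper bound for the
        prime sum would be \<open>c * Q T / 4\<close> plus a constant, against a lower bound of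
        \<open>c * Q T / 2\<close> minus a constant.\<close>
      define V where "V = c / 8 * Q T"
      have lX: "ln X > 0" using X by simp
      have Q0: "Q T \<ge> 0" using lX by (simp add: Q_def X_def)
      have V0: "V \<ge> 0" using Q0 c by (simp add: V_def)
      have "\<exists>u. \<bar>u\<bar> \<le> Y \<and> Re (exp (- (\<i> * \<theta>)) * g (Complex \<sigma> (t + u))) \<ge> V"
      proof (rule ccontr)
        assume "\<not> ?thesis"
        then have lt: "\<And>u. \<bar>u\<bar> \<le> Y \<Longrightarrow> Re (exp (- (\<i> * \<theta>)) * g (Complex \<sigma> (t + u))) \<le> V" by force
        have gB: "norm (g s) \<le> C * (1 + ln T)" if "\<sigma> \<le> Re s" "Re s \<le> 2" "\<bar>Im s - t\<bar> \<le> Y" for s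
        proof -
          have "norm (g s) \<le> C * (1 + ln t)" by (rule gr[OF g tH(4) _ tH(1)]) (use that Y in auto)
          also have "\<dots> \<le> C * (1 + ln T)"
            using C t tH elim(9) by (intro mult_left_mono add_left_mono ln_mono) auto
          finally show ?thesis .
        qed
        have hB: "norm (log_zeta_rest s) \<le> Bh" if "\<sigma> \<le> Re s" for s
          unfolding Bh_def by (rule norm_log_zeta_rest_le[OF \<sigma>(1) that])
        have up: "Re (exp (- (\<i> * \<theta>)) * (\<Sum>n. if prime n then of_nat n powr (- Complex \<sigma> t) * mkernel_fourier \<theta> (ln X) (ln n) else 0))
           \<le> 2 * (V + Bh) + 32 * (C * (1 + ln T) + Bh + (\<Sum>n. real n powr (- 2))) * exp (2 * ln X) * exp (- (Y\<^sup>2) / 4)"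
          by (rule convolution_upper_bound[OF _ b(2) \<sigma>(2) g(1,3) tH(6,5) _ _ lt gB hB])
             (use b X V0 in auto)
        have "c * Q T / 2 - 3/2 * low_frequency_bound \<le> Re (exp (- (\<i> * \<theta>)) * (\<Sum>n. if prime n then of_nat n powr (- Complex \<sigma> t) * mkernel_fourier \<theta> (ln X) (ln n) else 0))"
        proof (rule prime_series_lower_bound[OF W])
          show "c * Q T \<le> (\<Sum>p | prime p \<and> real p \<le> W * X. gweight \<sigma> X p) / 2
            - (\<Sum>p | prime p \<and> W * X < real p \<and> p \<le> N. gweight \<sigma> X p)" for N
            using gw[OF X(1), of \<sigma> N] \<sigma> by (simp add: Q_def X_def)
        qed (use X \<sigma> cs in auto)
        moreover have "32 * (C * (1 + ln T) + Bh + (\<Sum>n. real n powr (- 2))) * exp (2 * ln X) * exp (- (Y\<^sup>2) / 4) < 1"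
          using elim(2) unfolding P_def X_def Y_def .
        ultimately have "c * Q T / 2 - 3/2 * low_frequency_bound < 2 * (V + Bh) + 1" using up by linarith
        then have "c * Q T < (3/2 * low_frequency_bound + 2 * Bh + 1) * 4" unfolding V_def by argo
        moreover have "(3/2 * low_frequency_bound + 2 * Bh + 1) * 4 < c * Q T"
          using elim(1) c by (simp add: pos_divide_less_eq mult.commute)
        ultimately show False by linarith
      qed
      then obtain u where u: "\<bar>u\<bar> \<le> Y" "Re (exp (- (\<i> * \<theta>)) * g (Complex \<sigma> (t + u))) \<ge> V" by blast
      have mem: "Complex \<sigma> (t + u) \<in> half_strip b t H" using b u tH by (simp add: half_strip_def)
      have lz: "log_zeta_defined (Complex \<sigma> (t + u))" "log_zeta (Complex \<sigma> (t + u)) = g (Complex \<sigma> (t + u))"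
        by (rule log_zeta_eq_holomorphic_log[OF g mem tH(2)]; assumption)+
      have "V \<ge> c0 * \<kappa> powr (1 - \<sigma>) * (ln T powr (1 - \<sigma>) / ln (ln T) powr \<sigma>)"
      proof -
        define L where "L = ln (ln T)"
        have L: "L > 0" using elim(8) by (simp add: L_def)
        have "X powr (1 - \<sigma>) = (c3 powr (1 - \<sigma>) * \<kappa> powr (1 - \<sigma>)) * (ln T powr (1 - \<sigma>) * L powr (1 - \<sigma>))"
          using L c3 \<kappa> Y by (simp add: X_def x_def K_def L_def Y_def powr_mult mult_ac)
        \<comment> \<open>Since \<open>c3 \<le> 1\<close> and \<open>1 - \<sigma> \<le> 1\<close>,
          the dependence of this factor on \<sigma> is removed; \<kappa> keeps its exponent because
          it belongs to the claimed bound.\<close>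
        moreover have "c3 powr 1 \<le> c3 powr (1 - \<sigma>)" using c3 \<sigma> by (intro powr_mono') auto
        then have "c3 \<le> c3 powr (1 - \<sigma>)" using c3 by simp
        then have "(c3 * \<kappa> powr (1 - \<sigma>)) * (ln T powr (1 - \<sigma>) * L powr (1 - \<sigma>)) \<le> (c3 powr (1 - \<sigma>) * \<kappa> powr (1 - \<sigma>)) * (ln T powr (1 - \<sigma>) * L powr (1 - \<sigma>))"
          by (intro mult_right_mono) auto
        ultimately have X1: "(c3 * \<kappa> powr (1 - \<sigma>)) * (ln T powr (1 - \<sigma>) * L powr (1 - \<sigma>)) \<le> X powr (1 - \<sigma>)" by simp
        have "(c3 * \<kappa> powr (1 - \<sigma>)) * (ln T powr (1 - \<sigma>) * L powr (1 - \<sigma>)) / (2 * L) \<le> X powr (1 - \<sigma>) / ln X"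
          using X1 lX L elim(4) by (intro frac_le) (auto simp: X_def L_def)
        also have "\<dots> = Q T" by (simp add: Q_def X_def)
        finally have le: "c / 8 * ((c3 * \<kappa> powr (1 - \<sigma>)) * (ln T powr (1 - \<sigma>) * L powr (1 - \<sigma>)) / (2 * L)) \<le> V"
          unfolding V_def using c by (intro mult_left_mono) auto
        have e1: "c / 8 * ((c3 * k) * (a * p) / (2 * L)) = c0 * k * (a * (p / L))" for a k p :: real
          by (simp add: c0_def)
        have e2: "L powr (1 - \<sigma>) / L = 1 / L powr \<sigma>" using L by (simp add: powr_diff)
        show ?thesis using le unfolding e1 e2 by (simp add: L_def)
      qed
      then have "Re (exp (- \<i> * complex_of_real \<theta>) * log_zeta (Complex \<sigma> (t + u))) \<ge> c0 * \<kappa> powr (1 - \<sigma>) * (ln T powr (1 - \<sigma>) / ln (ln T) powr \<sigma>)"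
        using order_trans[OF _ u(2)] lz(2) by simp
      moreover have "t + u \<in> {T powr \<beta>..T}"
        using t u elim(5,7) Y by (auto simp: Y_def abs_le_iff)
      ultimately show ?case using lz(1) by blast
    qed
  qed
qed

theorem theorem1p1:
  "\<exists>c::real. c > 0 \<and>
     (\<forall>(\<sigma>::real) (\<beta>::real) (\<kappa>::real).
        \<sigma> \<in> {1/2<..<1} \<longrightarrow> \<beta> \<in> {0<..<1} \<longrightarrow>
        0 < \<kappa> \<longrightarrow> \<kappa> < min (\<sigma> - 1/2) (1 - \<beta>) \<longrightarrow>
        (\<exists>\<upsilon>::real \<Rightarrow> real.
           \<upsilon> \<in> {1/2<..<1} \<rightarrow> {0<..} \<and>
           (\<forall>x\<in>{1/2<..<1}.
              \<upsilon> x > c * min 1 ((exp 2 - exp 1) *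
                     (\<bar>ln (2 * x - 1)\<bar> / (\<bar>ln (2 * x - 1)\<bar> + 1)))) \<and>
           (\<forall>\<theta>::real. \<forall>\<^sub>F T::real in at_top.
              \<exists>t\<in>{T powr \<beta>..T}.
                log_zeta_defined (Complex \<sigma> t) \<and>
                Re (exp (- \<i> * complex_of_real \<theta>) * log_zeta (Complex \<sigma> t)) \<ge>
                  \<upsilon> \<sigma> * (\<kappa> powr (1 - \<sigma>) / sqrt \<bar>ln (2 * \<sigma> - 1)\<bar>) *
                  (ln T powr (1 - \<sigma>) / ln (ln T) powr \<sigma>))))"
proof -
  obtain c :: real where c: "c > 0" and large: "\<And>\<sigma> \<beta> \<kappa> \<theta>. 1/2 < \<sigma> \<Longrightarrow> \<sigma> < 1 \<Longrightarrow> 0 < \<beta> \<Longrightarrow> 0 < \<kappa> \<Longrightarrow> \<kappa> < min (\<sigma> - 1/2) (1 - \<beta>) \<Longrightarrow>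
    \<forall>\<^sub>F T in at_top. \<exists>t\<in>{T powr \<beta>..T}. log_zeta_defined (Complex \<sigma> t) \<and>
      Re (exp (- \<i> * complex_of_real \<theta>) * log_zeta (Complex \<sigma> t)) \<ge> c * \<kappa> powr (1 - \<sigma>) * (ln T powr (1 - \<sigma>) / ln (ln T) powr \<sigma>)"
    using log_zeta_large_values by blast
  define G where "G = exp 2 - exp (1::real)"
  have G: "0 < G" "G \<le> 9"
  proof -
    show "0 < G" by (simp add: G_def)
    have "exp (2::real) = (exp 1)\<^sup>2" by (simp add: exp_of_nat_mult[symmetric])
    also have "\<dots> \<le> 3\<^sup>2" using exp_le by (intro power_mono) auto
    finally have "exp (2::real) \<le> 9" by simp
    moreover have "G \<le> exp 2" by (simp add: G_def)
    ultimately show "G \<le> 9" by linarith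
  qed
  define M where "M x = min 1 (G * (\<bar>ln (2 * x - 1)\<bar> / (\<bar>ln (2 * x - 1)\<bar> + 1)))" for x :: real
  have Lpos: "\<bar>ln (2 * x - 1)\<bar> > 0" if "x \<in> {1/2<..<1}" for x :: real
    using that by simp
  have Mpos: "M x > 0" if "x \<in> {1/2<..<1}" for x
    using Lpos[OF that] G by (simp add: M_def)
  show ?thesis
  proof (intro exI[of _ "c / 9"] conjI allI impI)
    show "c / 9 > 0" using c by simp
    fix \<sigma> \<beta> \<kappa> :: real
    assume \<sigma>: "\<sigma> \<in> {1/2<..<1}" and \<beta>: "\<beta> \<in> {0<..<1}" and \<kappa>: "0 < \<kappa>" "\<kappa> < min (\<sigma> - 1/2) (1 - \<beta>)"
    define L where "L = \<bar>ln (2 * \<sigma> - 1)\<bar>"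
    have L: "L > 0" using Lpos[OF \<sigma>] by (simp add: L_def)
    \<comment> \<open>The constant 9 comes from the crude bound \<open>G \<le> 9\<close>: then
      \<open>M \<sigma>\<close> is at most \<open>9 / 2 * sqrt L\<close>, and the factor 2/9
      compensates exactly.\<close>
    have key: "2 * c / 9 * M \<sigma> / sqrt L \<le> c"
    proof -
      have "(sqrt L - 1)\<^sup>2 \<ge> 0" by simp
      then have "2 * sqrt L \<le> L + 1" using L by (simp add: power2_diff)
      then have "2 * sqrt L * sqrt L \<le> (L + 1) * sqrt L" using L by (intro mult_right_mono) auto
      moreover have "2 * sqrt L * sqrt L = 2 * L" using L by simp
      ultimately have "2 * L \<le> sqrt L * (L + 1)" by (simp only: mult.commute[of "sqrt L" "L + 1"])
      then have "2 * (L / (L + 1)) \<le> sqrt L" using L by (simp add: pos_divide_le_eq)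
      moreover have "M \<sigma> \<le> G * (L / (L + 1))" by (simp add: M_def L_def)
      moreover have "G * (L / (L + 1)) \<le> 9 * (L / (L + 1))" using G L by (intro mult_right_mono) auto
      ultimately have "2 / 9 * M \<sigma> \<le> sqrt L" by argo
      then have "2 / 9 * M \<sigma> / sqrt L \<le> 1" using L by simp
      then have "c * (2 / 9 * M \<sigma> / sqrt L) \<le> c * 1" using c by (intro mult_left_mono) auto
      then show ?thesis by (simp add: mult_ac)
    qed
    show "\<exists>\<upsilon>::real \<Rightarrow> real.
           \<upsilon> \<in> {1/2<..<1} \<rightarrow> {0<..} \<and>
           (\<forall>x\<in>{1/2<..<1}.
              \<upsilon> x > c / 9 * min 1 ((exp 2 - exp 1) *
                     (\<bar>ln (2 * x - 1)\<bar> / (\<bar>ln (2 * x - 1)\<bar> + 1)))) \<and>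
           (\<forall>\<theta>::real. \<forall>\<^sub>F T::real in at_top.
              \<exists>t\<in>{T powr \<beta>..T}.
                log_zeta_defined (Complex \<sigma> t) \<and>
                Re (exp (- \<i> * complex_of_real \<theta>) * log_zeta (Complex \<sigma> t)) \<ge>
                  \<upsilon> \<sigma> * (\<kappa> powr (1 - \<sigma>) / sqrt \<bar>ln (2 * \<sigma> - 1)\<bar>) *
                  (ln T powr (1 - \<sigma>) / ln (ln T) powr \<sigma>))"
    \<comment> \<open>Twice the required lower bound, which makes the inequality strict.\<close>
    proof (intro exI[of _ "\<lambda>x. 2 * c / 9 * M x"] conjI ballI allI)
      show "(\<lambda>x. 2 * c / 9 * M x) \<in> {1/2<..<1} \<rightarrow> {0<..}" using Mpos c by auto
      show "2 * c / 9 * M x > c / 9 * min 1 ((exp 2 - exp 1) * (\<bar>ln (2 * x - 1)\<bar> / (\<bar>ln (2 * x - 1)\<bar> + 1)))"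
        if "x \<in> {1/2<..<1}" for x
        unfolding G_def[symmetric] M_def[symmetric] using Mpos[OF that] c by simp
      fix \<theta> :: real
      have "1/2 < \<sigma>" "\<sigma> < 1" "0 < \<beta>" using \<sigma> \<beta> by auto
      from large[OF this \<kappa>, of \<theta>]
      show "\<forall>\<^sub>F T::real in at_top.
              \<exists>t\<in>{T powr \<beta>..T}.
                log_zeta_defined (Complex \<sigma> t) \<and>
                Re (exp (- \<i> * complex_of_real \<theta>) * log_zeta (Complex \<sigma> t)) \<ge>
                  2 * c / 9 * M \<sigma> * (\<kappa> powr (1 - \<sigma>) / sqrt \<bar>ln (2 * \<sigma> - 1)\<bar>) *
                  (ln T powr (1 - \<sigma>) / ln (ln T) powr \<sigma>)"
        using eventually_ge_at_top[of "exp 1"]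
      proof eventually_elim
        case (elim T)
        define R where "R = \<kappa> powr (1 - \<sigma>) * (ln T powr (1 - \<sigma>) / ln (ln T) powr \<sigma>)"
        have R: "R \<ge> 0" by (simp add: R_def)
        have "2 * c / 9 * M \<sigma> * (\<kappa> powr (1 - \<sigma>) / sqrt L) * (ln T powr (1 - \<sigma>) / ln (ln T) powr \<sigma>) = (2 * c / 9 * M \<sigma> / sqrt L) * R"
          by (simp add: R_def)
        also have "\<dots> \<le> c * R" using key R by (rule mult_right_mono)
        also have "\<dots> = c * \<kappa> powr (1 - \<sigma>) * (ln T powr (1 - \<sigma>) / ln (ln T) powr \<sigma>)" by (simp add: R_def)
        finally show ?case using elim(1) unfolding L_def by (meson order_trans)
      qed
    qed
  qed
qed

end
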